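(* Let $G$ be a group with a hyperbolically embedded subgroup $H$ and $\omega$ a free ultrafilter on $\mathbb N$. Then the von Neumann subalgebra $\mathcal{L}(G)\vee\mathcal{L}(H)^{\omega}$ of $\mathcal{L}(G)^\omega$ generated by $\mathcal{L}(G)$ and $\mathcal{L}(H)^{\omega}$ decomposes (canonically) as an amalgamated free product: $$\mathcal{L}(G)\vee\mathcal{L}(H)^{\omega}\cong\mathcal{L}(G)\ast_{\mathcal{L}(H)}\mathcal{L}(H)^{\omega}.$$
   Context: Groups are discrete. $\mathcal{L}(G)$ is the group von Neumann algebra of $G$ with canonical trace $\tau$; for $H\leqslant G$, $\mathcal L(H)\subset\mathcal L(G)$ naturally. Ultrapowers: for a tracial von Neumann algebra $(\mathcal M,\tau)$, $\mathcal M^\omega=\ell^\infty(\mathbb N,\mathcal M)/\{(x_n)_n\mid \lim_{n\to\omega}\|x_n\|_2=0\}$, with trace $\tau^\omega((x_n)_n)=\lim_{n\to\omega}\tau(x_n)$, where $\|x\|_2=\tau(x^*x)^{1/2}$; $\mathcal M$ is embedded in $\mathcal M^\omega$ by constant sequences, and $\mathcal N^\omega\subset\mathcal M^\omega$ for $\mathcal N\subset\mathcal M$. Amalgamated free products: for von Neumann subalgebras $\mathcal M_1,\mathcal M_2$ of a tracial von Neumann algebra $(\mathcal M,\tau)$ with a common von Neumann subalgebra $B$, and $\mathbb E_B$ the trace-preserving conditional expectation onto $B$, $\mathcal M_1$ and $\mathcal M_2$ are free with amalgamation over $B$ if $\tau(x_1\cdots x_n)=0$ whenever $n\ge1$, $i_1\ne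 i_2\ne\cdots\ne i_n$ in $\{1,2\}$ and $x_j\in\mathcal M_{i_j}$ with $\mathbb E_B(x_j)=0$ for all $j$. In that case $\mathcal M_1\vee\mathcal M_2\cong\mathcal M_1*_B\mathcal M_2$ canonically, i.e. by a trace-preserving isomorphism that is the identity on $\mathcal M_1$ and $\mathcal M_2$. The isomorphism in the statement is meant in this sense: $\mathcal L(G)$ and $\mathcal L(H)^\omega$ are free with amalgamation over $\mathcal L(H)$ inside $(\mathcal L(G)^\omega,\tau^\omega)$. Hyperbolically embedded subgroups: Let $H$ be a subgroup of a group $G$ and $X\subset G$ a set such that $X\cup H$ generates $G$. Let $\mathrm{Cay}(G,X\sqcup H)$ be the Cayley graph in which, for $a\in X\cap H$ and $g\in G$, there are two edges from $g$ to $ga$: one labeled by the copy of $a$ in $X$ and one by the copy of $a$ in $H$. Let $\mathrm{Cay}(H,H)$ be the Cayley graph of $H$ with respect to the generating set $H$, viewed naturally as a complete subgraph of $\mathrm{Cay}(G,X\sqcup H)$. The subgroup $H$ is hyperbolically embedded in $G$ if there is $X\subset G$ such that: (i) $X\cup H$ generates $G$; (ii) $\mathrm{Cay}(G,X\sqcup H)$ is a (Gromov) hyperbolic metric space; (iii) for every $n\in\mathbb N$, there are only finitely many $h\in H$ that can be connected to $1$ in $\mathrm{Cay}(G,X\sqcup H)$ by a path of length at most $n$ avoiding edges of $\mathrm{Cay}(H,H)$. *)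

theory Defs
  imports
    "HOL-Library.Nonpos_Ints"
    "HOL-Analysis.Infinite_Sum"
    "HOL-Algebra.Generated_Groups"
    "HOL-Algebra.Module"
    "HOL-Algebra.QuotRing"
begin

section \<open>Hyperbolically embedded subgroups\<close>

text \<open>
  The edge \<open>(g, l)\<close> of the Cayley graph runs from \<open>g\<close> to \<open>g \<otimes> a\<close>, where the label \<open>l\<close> is
  \<open>Inl a\<close> for \<open>a\<close> in \<open>X\<close> and \<open>Inr a\<close> for \<open>a\<close> in \<open>H\<close>.  An element of \<open>X \<inter> H\<close> therefore labels
  two different edges from \<open>g\<close> to \<open>g \<otimes> a\<close>.
\<close>

definition cayley_edges :: "('g, 'm) monoid_scheme \<Rightarrow> 'g set \<Rightarrow> 'g set \<Rightarrow> ('g \<times> ('g + 'g)) set" where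
  "cayley_edges G X H = carrier G \<times> (X <+> H)"

definition cayley_edges_sub :: "'g set \<Rightarrow> ('g \<times> ('g + 'g)) set" where
  "cayley_edges_sub H = H \<times> Inr ` H"

definition edge_target :: "('g, 'm) monoid_scheme \<Rightarrow> 'g \<times> ('g + 'g) \<Rightarrow> 'g" where
  "edge_target G e = fst e \<otimes>\<^bsub>G\<^esub> (case snd e of Inl a \<Rightarrow> a | Inr a \<Rightarrow> a)"

text \<open>
  Edges may be traversed in both directions; \<open>(u, v) \<in> adjacency G E ^^ n\<close> says that
  some path consisting of \<open>n\<close> edges from \<open>E\<close> connects \<open>u\<close> to \<open>v\<close>.
\<close>

definition adjacency :: "('g, 'm) monoid_scheme \<Rightarrow> ('g \<times> ('g + 'g)) set \<Rightarrow> ('g \<times> 'g) set" where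
  "adjacency G E = {(u, v). \<exists>e\<in>E. (fst e = u \<and> edge_target G e = v) \<or>
                                  (fst e = v \<and> edge_target G e = u)}"

definition path_dist :: "('g, 'm) monoid_scheme \<Rightarrow> ('g \<times> ('g + 'g)) set \<Rightarrow> 'g \<Rightarrow> 'g \<Rightarrow> real" where
  "path_dist G E u v = real (LEAST n. (u, v) \<in> adjacency G E ^^ n)"

text \<open>Gromov's four-point condition.\<close>

definition Gromov_hyperbolic_on :: "'p set \<Rightarrow> ('p \<Rightarrow> 'p \<Rightarrow> real) \<Rightarrow> bool" where
  "Gromov_hyperbolic_on S d \<longleftrightarrow>
     (\<exists>\<delta>. \<forall>x\<in>S. \<forall>y\<in>S. \<forall>z\<in>S. \<forall>t\<in>S.
        d x y + d z t \<le> max (d x z + d y t) (d x t + d y z) + 2 * \<delta>)"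

definition hyperbolically_embedded :: "('g, 'm) monoid_scheme \<Rightarrow> 'g set \<Rightarrow> bool" where
  "hyperbolically_embedded G H \<longleftrightarrow>
     subgroup H G \<and>
     (\<exists>X \<subseteq> carrier G.
        generate G (X \<union> H) = carrier G \<and>
        Gromov_hyperbolic_on (carrier G) (path_dist G (cayley_edges G X H)) \<and>
        (\<forall>n. finite {h \<in> H. \<exists>m\<le>n.
            (\<one>\<^bsub>G\<^esub>, h) \<in> adjacency G (cayley_edges G X H - cayley_edges_sub H) ^^ m}))"


section \<open>Algebras with a trace\<close>

record 'a tracial_algebra = "(complex, 'a) module" +
  star :: "'a \<Rightarrow> 'a"
  opnorm :: "'a \<Rightarrow> real"
  trc :: "'a \<Rightarrow> complex"

definition norm2 :: "('a, 'm) tracial_algebra_scheme \<Rightarrow> 'a \<Rightarrow> real" where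
  "norm2 M x = sqrt (Re (trc M (star M x \<otimes>\<^bsub>M\<^esub> x)))"

text \<open>
  A unital *-subalgebra of a tracial von Neumann algebra is a von Neumann subalgebra iff its
  operator-norm bounded parts are closed in the 2-norm (which induces the strong operator
  topology on bounded sets).  This form needs no representation on a Hilbert space.
\<close>

definition von_Neumann_subalgebra :: "('a, 'm) tracial_algebra_scheme \<Rightarrow> 'a set \<Rightarrow> bool" where
  "von_Neumann_subalgebra M N \<longleftrightarrow>
     N \<subseteq> carrier M \<and> \<one>\<^bsub>M\<^esub> \<in> N \<and>
     (\<forall>x\<in>N. \<forall>y\<in>N. x \<oplus>\<^bsub>M\<^esub> y \<in> N \<and> x \<otimes>\<^bsub>M\<^esub> y \<in> N) \<and>
     (\<forall>c. \<forall>x\<in>N. c \<odot>\<^bsub>M\<^esub> x \<in> N) \<and>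
     (\<forall>x\<in>N. star M x \<in> N) \<and>
     (\<forall>x y. (\<forall>n::nat. x n \<in> N) \<longrightarrow> (\<exists>C. \<forall>n. opnorm M (x n) \<le> C) \<longrightarrow> y \<in> carrier M \<longrightarrow>
        (\<lambda>n. norm2 M (x n \<ominus>\<^bsub>M\<^esub> y)) \<longlonglongrightarrow> 0 \<longrightarrow> y \<in> N)"

definition vN_join :: "('a, 'm) tracial_algebra_scheme \<Rightarrow> 'a set \<Rightarrow> 'a set \<Rightarrow> 'a set" where
  "vN_join M M1 M2 = \<Inter>{N. von_Neumann_subalgebra M N \<and> M1 \<union> M2 \<subseteq> N}"

text \<open>Positivity as an operator on the GNS space of \<open>(N, \<tau>)\<close>.\<close>

definition positive_in :: "('a, 'm) tracial_algebra_scheme \<Rightarrow> 'a set \<Rightarrow> 'a \<Rightarrow> bool" where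
  "positive_in M N z \<longleftrightarrow>
     z \<in> N \<and> (\<forall>y\<in>N. trc M (star M y \<otimes>\<^bsub>M\<^esub> z \<otimes>\<^bsub>M\<^esub> y) \<in> \<real>\<^sub>\<ge>\<^sub>0)"

definition trace_preserving_cond_exp ::
    "('a, 'm) tracial_algebra_scheme \<Rightarrow> 'a set \<Rightarrow> ('a \<Rightarrow> 'a) \<Rightarrow> bool" where
  "trace_preserving_cond_exp M B E \<longleftrightarrow>
     E \<in> carrier M \<rightarrow> B \<and>
     (\<forall>x\<in>carrier M. \<forall>y\<in>carrier M. E (x \<oplus>\<^bsub>M\<^esub> y) = E x \<oplus>\<^bsub>M\<^esub> E y) \<and>
     (\<forall>c. \<forall>x\<in>carrier M. E (c \<odot>\<^bsub>M\<^esub> x) = c \<odot>\<^bsub>M\<^esub> E x) \<and>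
     (\<forall>x\<in>carrier M. positive_in M B (E (star M x \<otimes>\<^bsub>M\<^esub> x))) \<and>
     (\<forall>b\<in>B. E b = b) \<and>
     (\<forall>a\<in>B. \<forall>b\<in>B. \<forall>x\<in>carrier M. E (a \<otimes>\<^bsub>M\<^esub> x \<otimes>\<^bsub>M\<^esub> b) = a \<otimes>\<^bsub>M\<^esub> E x \<otimes>\<^bsub>M\<^esub> b) \<and>
     (\<forall>x\<in>carrier M. trc M (E x) = trc M x)"

text \<open>
  The trace-preserving conditional expectation is unique, so the existential quantifier
  merely names it.  An alternating product of length \<open>n \<ge> 1\<close> is given by the nonempty list of its
  factors, each tagged with the index (1 or 2) of the algebra it is taken from.
\<close>

definition free_with_amalgamation ::
    "('a, 'm) tracial_algebra_scheme \<Rightarrow> 'a set \<Rightarrow> 'a set \<Rightarrow> 'a set \<Rightarrow> bool" where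
  "free_with_amalgamation M M1 M2 B \<longleftrightarrow>
     (\<exists>E. trace_preserving_cond_exp M B E \<and>
        (\<forall>ws :: (nat \<times> 'a) list.
           ws \<noteq> [] \<longrightarrow> distinct_adj (map fst ws) \<longrightarrow>
           (\<forall>(i, x)\<in>set ws. (i = 1 \<and> x \<in> M1 \<or> i = 2 \<and> x \<in> M2) \<and> E x = \<zero>\<^bsub>M\<^esub>) \<longrightarrow>
           trc M (foldr (\<otimes>\<^bsub>M\<^esub>) (map snd ws) \<one>\<^bsub>M\<^esub>) = 0))"

text \<open>
  For von Neumann subalgebras \<open>M1\<close>, \<open>M2\<close> of \<open>M\<close> with common von Neumann subalgebra \<open>B\<close>: the
  subalgebra \<open>P\<close> of \<open>M\<close> is canonically the amalgamated free product of \<open>M1\<close> and \<open>M2\<close>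
  over \<open>B\<close>, that is, \<open>P\<close> is generated by \<open>M1\<close> and \<open>M2\<close>, which are free with
  amalgamation over \<open>B\<close>.
\<close>

definition is_amalgamated_free_product ::
    "('a, 'm) tracial_algebra_scheme \<Rightarrow> 'a set \<Rightarrow> 'a set \<Rightarrow> 'a set \<Rightarrow> 'a set \<Rightarrow> bool" where
  "is_amalgamated_free_product M P M1 M2 B \<longleftrightarrow>
     B \<subseteq> M1 \<inter> M2 \<and> P = vN_join M M1 M2 \<and> free_with_amalgamation M M1 M2 B"


section \<open>Tracial ultrapowers\<close>

definition free_ultrafilter :: "nat filter \<Rightarrow> bool" where
  "free_ultrafilter \<omega> \<longleftrightarrow>
     \<omega> \<noteq> bot \<and> (\<forall>P. eventually P \<omega> \<or> eventually (\<lambda>n. \<not> P n) \<omega>) \<and> \<omega> \<le> cofinite"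

definition linf :: "('a, 'm) tracial_algebra_scheme \<Rightarrow> (complex, nat \<Rightarrow> 'a) module" where
  "linf M =
     \<lparr>carrier = {x. (\<forall>n. x n \<in> carrier M) \<and> (\<exists>C. \<forall>n. opnorm M (x n) \<le> C)},
      mult = (\<lambda>x y n. x n \<otimes>\<^bsub>M\<^esub> y n), one = (\<lambda>n. \<one>\<^bsub>M\<^esub>),
      zero = (\<lambda>n. \<zero>\<^bsub>M\<^esub>), add = (\<lambda>x y n. x n \<oplus>\<^bsub>M\<^esub> y n),
      smult = (\<lambda>c x n. c \<odot>\<^bsub>M\<^esub> x n)\<rparr>"

definition null_ideal :: "nat filter \<Rightarrow> ('a, 'm) tracial_algebra_scheme \<Rightarrow> (nat \<Rightarrow> 'a) set" where
  "null_ideal \<omega> M = {x \<in> carrier (linf M). ((\<lambda>n. norm2 M (x n)) \<longlongrightarrow> 0) \<omega>}"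

definition ultra_class ::
    "nat filter \<Rightarrow> ('a, 'm) tracial_algebra_scheme \<Rightarrow> (nat \<Rightarrow> 'a) \<Rightarrow> (nat \<Rightarrow> 'a) set" where
  "ultra_class \<omega> M x = null_ideal \<omega> M +>\<^bsub>linf M\<^esub> x"

text \<open>
  The ring structure is that of the library quotient.  The norm is the quotient norm of the
  supremum norm.
\<close>

definition ultrapower ::
    "nat filter \<Rightarrow> ('a, 'm) tracial_algebra_scheme \<Rightarrow> (nat \<Rightarrow> 'a) set tracial_algebra" where
  "ultrapower \<omega> M = (let Q = linf M Quot null_ideal \<omega> M in
     \<lparr>carrier = carrier Q, mult = mult Q, one = one Q, zero = zero Q, add = add Q,
      smult = (\<lambda>c \<xi>. \<Union>x\<in>\<xi>. ultra_class \<omega> M (c \<odot>\<^bsub>linf M\<^esub> x)),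
      star = (\<lambda>\<xi>. \<Union>x\<in>\<xi>. ultra_class \<omega> M (\<lambda>n. star M (x n))),
      opnorm = (\<lambda>\<xi>. INF x\<in>\<xi>. SUP n. opnorm M (x n)),
      trc = (\<lambda>\<xi>. THE t. \<exists>x\<in>\<xi>. ((\<lambda>n. trc M (x n)) \<longlongrightarrow> t) \<omega>)\<rparr>)"

definition ultra_const ::
    "nat filter \<Rightarrow> ('a, 'm) tracial_algebra_scheme \<Rightarrow> 'a set \<Rightarrow> (nat \<Rightarrow> 'a) set set" where
  "ultra_const \<omega> M N = (\<lambda>a. ultra_class \<omega> M (\<lambda>n. a)) ` N"

definition ultra_sub ::
    "nat filter \<Rightarrow> ('a, 'm) tracial_algebra_scheme \<Rightarrow> 'a set \<Rightarrow> (nat \<Rightarrow> 'a) set set" where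
  "ultra_sub \<omega> M N = ultra_class \<omega> M ` {x \<in> carrier (linf M). \<forall>n. x n \<in> N}"


section \<open>Group von Neumann algebras\<close>

definition ell2 :: "'i set \<Rightarrow> ('i \<Rightarrow> complex) set" where
  "ell2 I = {f. (\<forall>i. i \<notin> I \<longrightarrow> f i = 0) \<and> (\<lambda>i. (cmod (f i))\<^sup>2) summable_on I}"

definition ell2_inner :: "'i set \<Rightarrow> ('i \<Rightarrow> complex) \<Rightarrow> ('i \<Rightarrow> complex) \<Rightarrow> complex" where
  "ell2_inner I f g = (\<Sum>\<^sub>\<infinity>i\<in>I. f i * cnj (g i))"

definition ell2_norm :: "'i set \<Rightarrow> ('i \<Rightarrow> complex) \<Rightarrow> real" where
  "ell2_norm I f = sqrt (\<Sum>\<^sub>\<infinity>i\<in>I. (cmod (f i))\<^sup>2)"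

definition delta :: "'i \<Rightarrow> 'i \<Rightarrow> complex" where
  "delta a = (\<lambda>i. if i = a then 1 else 0)"

type_synonym 'i op = "('i \<Rightarrow> complex) \<Rightarrow> ('i \<Rightarrow> complex)"

text \<open>
  Operators on \<open>ell2 I\<close> are extensional functions, so that equality of operators
  is equality in the logic.
\<close>

definition bounded_ops :: "'i set \<Rightarrow> 'i op set" where
  "bounded_ops I = {T \<in> ell2 I \<rightarrow>\<^sub>E ell2 I.
     (\<forall>f\<in>ell2 I. \<forall>g\<in>ell2 I. T (\<lambda>i. f i + g i) = (\<lambda>i. T f i + T g i)) \<and>
     (\<forall>c. \<forall>f\<in>ell2 I. T (\<lambda>i. c * f i) = (\<lambda>i. c * T f i)) \<and>
     (\<exists>C. \<forall>f\<in>ell2 I. ell2_norm I (T f) \<le> C * ell2_norm I f)}"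

definition op_adjoint :: "'i set \<Rightarrow> 'i op \<Rightarrow> 'i op" where
  "op_adjoint I T = (THE S. S \<in> bounded_ops I \<and>
     (\<forall>f\<in>ell2 I. \<forall>g\<in>ell2 I. ell2_inner I (T f) g = ell2_inner I f (S g)))"

definition op_norm :: "'i set \<Rightarrow> 'i op \<Rightarrow> real" where
  "op_norm I T = (SUP f\<in>{f \<in> ell2 I. ell2_norm I f \<le> 1}. ell2_norm I (T f))"

definition commutant :: "'i set \<Rightarrow> 'i op set \<Rightarrow> 'i op set" where
  "commutant I A = {T \<in> bounded_ops I. \<forall>S\<in>A. compose (ell2 I) T S = compose (ell2 I) S T}"

definition left_regular :: "('g, 'm) monoid_scheme \<Rightarrow> 'g \<Rightarrow> 'g op" where
  "left_regular G g = (\<lambda>f\<in>ell2 (carrier G). \<lambda>x.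
     if x \<in> carrier G then f (inv\<^bsub>G\<^esub> g \<otimes>\<^bsub>G\<^esub> x) else 0)"

text \<open>
  The von Neumann algebra generated by the unitaries \<open>left_regular G h\<close>, \<open>h \<in> H\<close> (a set closed
  under adjoints), i.e. their bicommutant.  For a subgroup \<open>H\<close> this is the group von Neumann algebra of
  \<open>H\<close> in its natural embedding into that of \<open>G\<close>.
\<close>

definition group_vN_sub :: "('g, 'm) monoid_scheme \<Rightarrow> 'g set \<Rightarrow> 'g op set" where
  "group_vN_sub G H = commutant (carrier G) (commutant (carrier G) (left_regular G ` H))"

definition group_vN :: "('g, 'm) monoid_scheme \<Rightarrow> 'g op tracial_algebra" where
  "group_vN G = (let I = carrier G in
     \<lparr>carrier = group_vN_sub G I,
      mult = compose (ell2 I), one = (\<lambda>f\<in>ell2 I. f),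
      zero = (\<lambda>f\<in>ell2 I. \<lambda>i. 0), add = (\<lambda>S T. \<lambda>f\<in>ell2 I. \<lambda>i. S f i + T f i),
      smult = (\<lambda>c T. \<lambda>f\<in>ell2 I. \<lambda>i. c * T f i),
      star = op_adjoint I, opnorm = op_norm I,
      trc = (\<lambda>T. ell2_inner I (T (delta \<one>\<^bsub>G\<^esub>)) (delta \<one>\<^bsub>G\<^esub>))\<rparr>)"

end

theory Submission
  imports Defs "HOL-Analysis.Complex_Analysis_Basics"
begin

text \<open>
  On \<open>ell2 (carrier G)\<close>, the elements of the von Neumann algebra of \<open>H\<close> are exactly the bounded operators
  with matrix \<open>c (x y\<^sup>-\<^sup>1)\<close> for some \<open>c\<close> supported in \<open>H\<close>; hence the conditional expectation onto it can be
  taken to be the limit of the coefficients at elements of \<open>H\<close> along the ultrafilter.  An element of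
  \<open>L(H)\<^sup>\<omega>\<close> with expectation \<open>0\<close> has representatives whose coefficients vanish on any prescribed finite subset
  \<open>K\<close> of \<open>H\<close>, and an element of \<open>L(G)\<close> with expectation \<open>0\<close> is a limit in the 2-norm of elements with
  finite support outside \<open>H\<close>.  Since the support of a product is contained in the product of the supports, the
  trace of an alternating product vanishes as soon as no alternating product of elements of a finite
  \<open>F \<subseteq> G - H\<close> and of elements of \<open>H - K\<close> is trivial.  That a suitable \<open>K\<close> exists follows from the finiteness
  of balls in the relative metric on \<open>H\<close>: an alternating product of minimal length lying in \<open>H\<close> bounds a
  polygon of bounded length in which the edge of its first letter from \<open>H\<close> is isolated.
\<close>

section \<open>Products that avoid the subgroup\<close>

text \<open>The sides of the polygon that spell elements of \<open>F\<close> may themselves run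
  along edges of Cay(H,H). They use only finitely many labels \<open>A\<close> there, so these edges
  are put back into the graph, and the finiteness of balls has to be extended to the larger graph.
  Cutting the coefficients of an element of L(G) down to a finite set is a good approximation in the
  2-norm, but it gives no control of the operator norm, so all letters cannot be approximated at
  once. They are replaced one at a time, and the tolerance is chosen after the operator norms of the
  two neighbouring products are known. Letters from the ultrapower of L(H) behave differently: the
  finitely many coefficients removed from them have an absolute sum that bounds an operator norm and
  tends to 0. The limit of the coefficients over \<open>H\<close> belongs to a bounded operator
  because the diagonal blocks of a matrix, here those of the right cosets of \<open>H\<close>, form
  a matrix of no larger norm, and bounds on finite forms survive limits along the
  ultrafilter.\<close>

lemma relpow_mono:
  fixes R S :: "'a rel"
  assumes "R \<subseteq> S" "(x, y) \<in> R ^^ n"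
  shows "(x, y) \<in> S ^^ n"
  using assms(2)
proof (induction n arbitrary: y)
  case (Suc n)
  then obtain z where "(x, z) \<in> R ^^ n" "(z, y) \<in> R" by auto
  with Suc.IH assms(1) show ?case by auto
qed auto

lemma relpow_sym:
  assumes "sym R" "(x, y) \<in> R ^^ n"
  shows "(y, x) \<in> R ^^ n"
  using assms(2)
proof (induction n arbitrary: y)
  case (Suc n)
  then obtain z where "(x, z) \<in> R ^^ n" "(z, y) \<in> R" by auto
  with Suc.IH assms(1) show ?case by (meson relpow_Suc_I2 symD)
qed auto

text \<open>The path is cut at its first \<open>S\<close>-step: what precedes it runs in
  \<open>R\<close> alone, and what follows is strictly shorter, which drives the induction in
  \<open>finite_rel_ball\<close>.\<close>

lemma relpow_Un_cases:
  assumes "(x, y) \<in> (R \<union> S) ^^ n"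
  shows "(x, y) \<in> R ^^ n \<or> (\<exists>k<n. \<exists>p q. (x, p) \<in> R ^^ k \<and> (p, q) \<in> S \<and> (q, y) \<in> (R \<union> S) ^^ (n - Suc k))"
  using assms
proof (induction n arbitrary: y)
  case (Suc n)
  then obtain z where z: "(x, z) \<in> (R \<union> S) ^^ n" "(z, y) \<in> R \<union> S" by auto
  from Suc.IH[OF z(1)] show ?case
  proof
    assume xz: "(x, z) \<in> R ^^ n"
    show ?thesis
    proof (cases "(z, y) \<in> R")
      case True
      with xz show ?thesis by auto
    next
      case False
      with z xz have "(x, z) \<in> R ^^ n \<and> (z, y) \<in> S \<and> (y, y) \<in> (R \<union> S) ^^ (Suc n - Suc n)" by auto
      then show ?thesis by blast
    qed
  next
    assume "\<exists>k<n. \<exists>p q. (x, p) \<in> R ^^ k \<and> (p, q) \<in> S \<and> (q, z) \<in> (R \<union> S) ^^ (n - Suc k)"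
    then obtain k p q where k: "k < n" "(x, p) \<in> R ^^ k" "(p, q) \<in> S" "(q, z) \<in> (R \<union> S) ^^ (n - Suc k)"
      by blast
    from k(4) z(2) have "(q, y) \<in> (R \<union> S) ^^ Suc (n - Suc k)" by auto
    moreover have "Suc (n - Suc k) = Suc n - Suc k" using k(1) by auto
    ultimately show ?thesis using k by (metis less_SucI)
  qed
qed auto

section \<open>Paths in Cayley graphs and their left translates\<close>

lemma sym_adjacency: "sym (adjacency G E)"
  unfolding adjacency_def sym_def by auto

lemma adjacency_mono: "E \<subseteq> E' \<Longrightarrow> adjacency G E \<subseteq> adjacency G E'"
  unfolding adjacency_def by blast

lemma adjacency_Un: "adjacency G (E \<union> E') = adjacency G E \<union> adjacency G E'"
  unfolding adjacency_def by blast

text \<open>Edges leave every vertex of \<open>G\<close>, so the set is invariant under all left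
  translations, unlike \<open>rel_edges\<close>.\<close>

definition word_edges :: "('g, 'm) monoid_scheme \<Rightarrow> 'g set \<Rightarrow> 'g set \<Rightarrow> ('g \<times> ('g + 'g)) set" where
  "word_edges G X A = carrier G \<times> (Sum_Type.Plus X A)"

text \<open>The Cayley graph without Cay(H,H), into which the edges inside \<open>H\<close> with a
  label from \<open>A\<close> are put back. \<open>A = {}\<close> gives the graph of the finiteness
  condition for a hyperbolically embedded subgroup.\<close>

definition rel_edges :: "('g, 'm) monoid_scheme \<Rightarrow> 'g set \<Rightarrow> 'g set \<Rightarrow> 'g set \<Rightarrow> ('g \<times> ('g + 'g)) set" where
  "rel_edges G X H A = (cayley_edges G X H - cayley_edges_sub H) \<union> H \<times> Inr ` A"

definition rel_ball :: "('g, 'm) monoid_scheme \<Rightarrow> 'g set \<Rightarrow> 'g set \<Rightarrow> 'g set \<Rightarrow> nat \<Rightarrow> 'g set" where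
  "rel_ball G X H A n = {h \<in> H. \<exists>m\<le>n. (\<one>\<^bsub>G\<^esub>, h) \<in> adjacency G (rel_edges G X H A) ^^ m}"

context group
begin

lemma foldr_mult_closed: "set xs \<subseteq> carrier G \<Longrightarrow> foldr (\<otimes>) xs \<one> \<in> carrier G"
  by (induction xs) auto

text \<open>Keeping \<open>E'\<close> apart from \<open>E\<close> lets one statement serve for
  translations of \<open>word_edges\<close>, for moving \<open>word_edges\<close> into
  \<open>rel_edges\<close>, and for translations of \<open>rel_edges\<close> by elements of
  \<open>H\<close>.\<close>

lemma adjacency_translate:
  assumes "(u, v) \<in> adjacency G E" "E \<subseteq> carrier G \<times> (Sum_Type.Plus (carrier G) (carrier G))" "g \<in> carrier G"
    and "\<And>w l. (w, l) \<in> E \<Longrightarrow> (g \<otimes> w, l) \<in> E'"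
  shows "(g \<otimes> u, g \<otimes> v) \<in> adjacency G E'"
proof -
  obtain w l where e: "(w, l) \<in> E" "w = u \<and> edge_target G (w, l) = v \<or> w = v \<and> edge_target G (w, l) = u"
    using assms(1) unfolding adjacency_def by auto
  have "w \<in> carrier G" "l \<in> Sum_Type.Plus (carrier G) (carrier G)" using e(1) assms(2) by auto
  then have "edge_target G (g \<otimes> w, l) = g \<otimes> edge_target G (w, l)"
    using assms(3) by (auto simp: edge_target_def m_assoc)
  with e assms(4)[OF e(1)] show ?thesis unfolding adjacency_def by force
qed

lemma adjacency_relpow_translate:
  assumes "(u, v) \<in> adjacency G E ^^ n" "E \<subseteq> carrier G \<times> (Sum_Type.Plus (carrier G) (carrier G))" "g \<in> carrier G"
    and "\<And>w l. (w, l) \<in> E \<Longrightarrow> (g \<otimes> w, l) \<in> E'"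
  shows "(g \<otimes> u, g \<otimes> v) \<in> adjacency G E' ^^ n"
  using assms(1)
proof (induction n arbitrary: v)
  case (Suc n)
  then obtain z where "(u, z) \<in> adjacency G E ^^ n" "(z, v) \<in> adjacency G E" by auto
  with Suc.IH adjacency_translate[OF _ assms(2-4)] show ?case by auto
qed auto

lemma adjacency_word_edge:
  assumes "a \<in> X \<union> A" "g \<in> carrier G"
  shows "(g, g \<otimes> a) \<in> adjacency G (word_edges G X A)"
proof -
  have "(g, if a \<in> X then Inl a else Inr a) \<in> word_edges G X A"
    using assms by (auto simp: word_edges_def)
  then show ?thesis unfolding adjacency_def edge_target_def by (force split: if_splits)
qed

text \<open>A word has finitely many letters, so finitely many labels from \<open>H\<close> suffice;
  an inverse letter is an edge traversed backwards.\<close>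

lemma generate_word_path:
  assumes "X \<subseteq> carrier G" "H \<subseteq> carrier G" "g \<in> generate G (X \<union> H)"
  shows "\<exists>n A. finite A \<and> A \<subseteq> H \<and> (\<one>, g) \<in> adjacency G (word_edges G X A) ^^ n"
  using assms(3)
proof (induction rule: generate.induct)
  case one
  have "(\<one>, \<one>) \<in> adjacency G (word_edges G X {}) ^^ 0" by simp
  then show ?case by blast
next
  case (incl h)
  \<comment> \<open>The intersection keeps the labels inside \<open>H\<close>; it is empty for a
    generator outside \<open>H\<close>, whose edge carries its label from \<open>X\<close>.\<close>
  then have "(\<one>, \<one> \<otimes> h) \<in> adjacency G (word_edges G X ({h} \<inter> H)) ^^ 1"
    unfolding relpow_1 using assms(1,2) by (intro adjacency_word_edge) auto
  moreover have "\<one> \<otimes> h = h" using incl assms(1,2) by auto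
  ultimately show ?case by (intro exI[of _ 1] exI[of _ "{h} \<inter> H"]) auto
next
  case (inv h)
  then have h: "h \<in> carrier G" using assms(1,2) by auto
  have "(inv h, inv h \<otimes> h) \<in> adjacency G (word_edges G X ({h} \<inter> H))"
    using inv h assms(1,2) by (intro adjacency_word_edge) auto
  then have "(\<one>, inv h) \<in> adjacency G (word_edges G X ({h} \<inter> H)) ^^ 1"
    unfolding relpow_1 using h sym_adjacency by (metis l_inv symD)
  then show ?case by (intro exI[of _ 1] exI[of _ "{h} \<inter> H"]) auto
next
  case (eng g h)
  then obtain n A m A' where
    a: "finite A" "A \<subseteq> H" "(\<one>, g) \<in> adjacency G (word_edges G X A) ^^ n" and
    b: "finite A'" "A' \<subseteq> H" "(\<one>, h) \<in> adjacency G (word_edges G X A') ^^ m" by blast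
  have gh: "g \<in> carrier G" "h \<in> carrier G"
    using eng.hyps assms(1,2) generate_in_carrier[of "X \<union> H"] by blast+
  let ?E = "word_edges G X (A \<union> A')"
  have "(\<one>, g) \<in> adjacency G ?E ^^ n"
    by (rule relpow_mono[OF adjacency_mono a(3)]) (auto simp: word_edges_def)
  moreover have "(g \<otimes> \<one>, g \<otimes> h) \<in> adjacency G ?E ^^ m"
    using assms(1,2) b(2) gh
    by (intro adjacency_relpow_translate[OF b(3)]) (auto simp: word_edges_def)
  ultimately have "(\<one>, g \<otimes> h) \<in> adjacency G ?E ^^ (n + m)"
    using gh by (auto simp: relpow_add)
  with a b show ?case by (intro exI[of _ "n + m"] exI[of _ "A \<union> A'"]) auto
qed

lemma finite_word_paths:
  assumes "X \<subseteq> carrier G" "H \<subseteq> carrier G" "generate G (X \<union> H) = carrier G"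
    and "finite F" "F \<subseteq> carrier G"
  shows "\<exists>L A. finite A \<and> A \<subseteq> H \<and> (\<forall>g\<in>F. \<exists>n\<le>L. (\<one>, g) \<in> adjacency G (word_edges G X A) ^^ n)"
  using assms(4,5)
proof (induction F)
  case empty
  then show ?case by auto
next
  case (insert g F)
  then obtain L A where a: "finite A" "A \<subseteq> H"
    "\<forall>g\<in>F. \<exists>n\<le>L. (\<one>, g) \<in> adjacency G (word_edges G X A) ^^ n" by auto
  obtain m A' where b: "finite A'" "A' \<subseteq> H" "(\<one>, g) \<in> adjacency G (word_edges G X A') ^^ m"
    using generate_word_path[OF assms(1,2), of g] insert.prems assms(3) by auto
  have sub: "word_edges G X A \<subseteq> word_edges G X (A \<union> A')" "word_edges G X A' \<subseteq> word_edges G X (A \<union> A')"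
    unfolding word_edges_def by auto
  have "\<exists>n\<le>max L m. (\<one>, k) \<in> adjacency G (word_edges G X (A \<union> A')) ^^ n" if "k \<in> insert g F" for k
  proof (cases "k = g")
    case True
    with relpow_mono[OF adjacency_mono[OF sub(2)] b(3)] show ?thesis by (meson max.cobounded2)
  next
    case False
    with that a(3) obtain n where "n \<le> L" "(\<one>, k) \<in> adjacency G (word_edges G X A) ^^ n" by auto
    with relpow_mono[OF adjacency_mono[OF sub(1)]] show ?thesis by (meson max.coboundedI1)
  qed
  with a b show ?case by (intro exI[of _ "max L m"] exI[of _ "A \<union> A'"]) auto
qed

text \<open>Up to its first extra edge a path lies in the original graph and has arrived in
  \<open>H\<close>, so finitely many starting points are possible for that edge, and it has finitely
  many labels. The rest of the path, translated back to \<open>\<one>\<close>, is shorter and falls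
  under the induction hypothesis.\<close>

lemma finite_rel_ball:
  assumes "subgroup H G" "X \<subseteq> carrier G" "finite A" "A \<subseteq> H"
    and fin: "\<And>n. finite (rel_ball G X H {} n)"
  shows "finite (rel_ball G X H A n)"
proof (induction n rule: less_induct)
  case (less n)
  have HG: "H \<subseteq> carrier G" using assms(1) by (rule subgroup.subset)
  let ?E = "rel_edges G X H A" and ?R = "adjacency G (rel_edges G X H {})"
    and ?S = "adjacency G (H \<times> Inr ` A)"
  have E: "adjacency G ?E = ?R \<union> ?S"
    by (simp add: rel_edges_def adjacency_Un flip: adjacency_Un)
  have Esub: "?E \<subseteq> carrier G \<times> (Sum_Type.Plus (carrier G) (carrier G))"
    using HG assms(2,4) by (auto simp: rel_edges_def cayley_edges_def)
  \<comment> \<open>The possible ends of the first extra edge, traversed forwards or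
    backwards.\<close>
  define Q where "Q = (\<lambda>(p, a). p \<otimes> a) ` (rel_ball G X H {} n \<times> A)
    \<union> (\<lambda>(p, a). p \<otimes> inv a) ` (rel_ball G X H {} n \<times> A)"
  let ?Z = "\<Union>m<n. rel_ball G X H A m"
  have "rel_ball G X H A n \<subseteq> rel_ball G X H {} n \<union> (\<lambda>(q, z). q \<otimes> z) ` (Q \<times> ?Z)"
  proof
    fix h assume "h \<in> rel_ball G X H A n"
    then obtain m where h: "h \<in> H" and m: "m \<le> n" "(\<one>, h) \<in> (?R \<union> ?S) ^^ m"
      unfolding rel_ball_def E by blast
    from relpow_Un_cases[OF m(2)] show "h \<in> rel_ball G X H {} n \<union> (\<lambda>(q, z). q \<otimes> z) ` (Q \<times> ?Z)"
    proof
      assume "(\<one>, h) \<in> ?R ^^ m"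
      then show ?thesis using h m(1) unfolding rel_ball_def by auto
    next
      assume "\<exists>k<m. \<exists>p q. (\<one>, p) \<in> ?R ^^ k \<and> (p, q) \<in> ?S \<and> (q, h) \<in> (?R \<union> ?S) ^^ (m - Suc k)"
      then obtain k p q where k: "k < m" "(\<one>, p) \<in> ?R ^^ k" "(p, q) \<in> ?S"
        "(q, h) \<in> (?R \<union> ?S) ^^ (m - Suc k)" by blast
      obtain a where a: "a \<in> A" "p \<in> H" "q = p \<otimes> a \<or> q = p \<otimes> inv a" "q \<in> H"
      proof -
        obtain w a where wa: "w \<in> H" "a \<in> A" "w = p \<and> w \<otimes> a = q \<or> w = q \<and> w \<otimes> a = p"
          using k(3) unfolding adjacency_def edge_target_def by auto
        have c: "a \<in> H" using wa(2) assms(4) by auto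
        from wa(3) show ?thesis
        proof
          assume "w = p \<and> w \<otimes> a = q"
          then show ?thesis using that[of a] wa c assms(1) by (metis subgroup.m_closed)
        next
          assume *: "w = q \<and> w \<otimes> a = p"
          then have "q = p \<otimes> inv a" using wa c HG by (metis inv_solve_right subgroup.m_closed subgroup.mem_carrier assms(1))
          then show ?thesis using that[of a] wa c * assms(1) by (metis subgroup.m_closed)
        qed
      qed
      have "k \<le> n" using k(1) m(1) by simp
      then have "p \<in> rel_ball G X H {} n" using k(2) a(2) unfolding rel_ball_def by blast
      then have qQ: "q \<in> Q" using a unfolding Q_def by force
      have qc: "q \<in> carrier G" "h \<in> carrier G" using a(4) h HG by auto
      \<comment> \<open>The translating element lies in \<open>H\<close>, so it preserves membership
        of vertices in \<open>H\<close> and with it both the removed and the restored edges.\<close>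
      have "(inv q \<otimes> q, inv q \<otimes> h) \<in> adjacency G ?E ^^ (m - Suc k)"
      proof (rule adjacency_relpow_translate[OF _ Esub])
        show "(q, h) \<in> adjacency G ?E ^^ (m - Suc k)" using k(4) E by simp
        show "inv q \<in> carrier G" using qc by simp
        fix w l assume wl: "(w, l) \<in> ?E"
        then have "w \<in> carrier G" using Esub by auto
        moreover have "inv q \<otimes> w \<in> H \<longleftrightarrow> w \<in> H" if "w \<in> carrier G"
          using that a(4) assms(1) qc
          by (metis inv_solve_left subgroup.m_closed subgroup.m_inv_closed subgroup.mem_carrier)
        ultimately show "(inv q \<otimes> w, l) \<in> ?E"
          using wl qc by (auto simp: rel_edges_def cayley_edges_def cayley_edges_sub_def)
      qed
      then have "inv q \<otimes> h \<in> rel_ball G X H A (m - Suc k)"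
        using qc h a(4) assms(1) unfolding rel_ball_def
        by (auto simp: subgroup.m_closed subgroup.m_inv_closed)
      moreover have "m - Suc k < n" using k(1) m(1) by auto
      ultimately have "inv q \<otimes> h \<in> ?Z" by blast
      moreover have "h = q \<otimes> (inv q \<otimes> h)" using qc by (simp add: m_assoc[symmetric])
      ultimately show ?thesis using qQ by force
    qed
  qed
  moreover have "finite Q" unfolding Q_def using fin assms(3) by auto
  moreover have "finite ?Z" using less by auto
  ultimately show ?case using fin by (meson finite_SigmaI finite_UnI finite_imageI finite_subset)
qed

section \<open>Alternating products of elements of \<open>F\<close> and of \<open>H\<close>\<close>

primrec pairs_prod :: "('a \<times> 'a) list \<Rightarrow> 'a" where
  "pairs_prod [] = \<one>"
| "pairs_prod (p # ps) = fst p \<otimes> snd p \<otimes> pairs_prod ps"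

lemma pairs_prod_closed: "set ps \<subseteq> carrier G \<times> carrier G \<Longrightarrow> pairs_prod ps \<in> carrier G"
  by (induction ps) auto

lemma pairs_prod_snoc:
  assumes "set ps \<subseteq> carrier G \<times> carrier G" "g \<in> carrier G" "h \<in> carrier G"
  shows "pairs_prod (ps @ [(g, h)]) = pairs_prod ps \<otimes> g \<otimes> h"
  using assms by (induction ps) (auto simp: m_assoc pairs_prod_closed)

text \<open>A letter of \<open>F\<close> costs at most \<open>L\<close> edges. A letter of
  \<open>H\<close> costs a single edge, which has not been removed from the graph because the
  condition on the prefixes puts its starting point outside \<open>H\<close>. This accounts for
  \<open>Suc L\<close> per pair.\<close>

lemma pairs_path:
  assumes "subgroup H G" "X \<subseteq> carrier G" "A \<subseteq> H" "F \<subseteq> carrier G" "u \<in> H"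
    and words: "\<And>g. g \<in> F \<Longrightarrow> \<exists>n\<le>L. (\<one>, g) \<in> adjacency G (word_edges G X A) ^^ n"
    and "set ps \<subseteq> F \<times> H"
    and "\<And>qs g h. \<exists>rs. ps = qs @ (g, h) # rs \<Longrightarrow> pairs_prod qs \<otimes> g \<notin> H"
  shows "\<exists>n\<le>length ps * Suc L. (u, u \<otimes> pairs_prod ps) \<in> adjacency G (rel_edges G X H A) ^^ n"
  using assms(7,8)
proof (induction ps rule: rev_induct)
  case Nil
  then show ?case using assms(1,5) by (simp add: subgroup.mem_carrier)
next
  case (snoc p ps)
  obtain g h where p: "p = (g, h)" by (cases p)
  have HG: "H \<subseteq> carrier G" using assms(1) by (rule subgroup.subset)
  have ps: "set ps \<subseteq> F \<times> H" and gh: "g \<in> F" "h \<in> H" using snoc.prems(1) p by auto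
  let ?R = "adjacency G (rel_edges G X H A)"
  have "\<exists>n\<le>length ps * Suc L. (u, u \<otimes> pairs_prod ps) \<in> ?R ^^ n"
  proof (rule snoc.IH[OF ps])
    fix qs g h assume "\<exists>rs. ps = qs @ (g, h) # rs"
    then show "pairs_prod qs \<otimes> g \<notin> H" using snoc.prems(2)[of qs g h] by auto
  qed
  then obtain n where n: "n \<le> length ps * Suc L" "(u, u \<otimes> pairs_prod ps) \<in> ?R ^^ n" by blast
  have c: "u \<in> carrier G" "g \<in> carrier G" "h \<in> carrier G" "pairs_prod ps \<in> carrier G"
    using assms(4,5) HG gh ps by (auto intro!: pairs_prod_closed)
  define v where "v = u \<otimes> pairs_prod ps"
  have v: "v \<in> carrier G" using c v_def by auto
  obtain m where m: "m \<le> L" "(\<one>, g) \<in> adjacency G (word_edges G X A) ^^ m" using words gh by blast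
  have "(v \<otimes> \<one>, v \<otimes> g) \<in> ?R ^^ m"
    by (rule adjacency_relpow_translate[OF m(2)])
      (use assms(2,3) HG v in \<open>auto simp: word_edges_def rel_edges_def cayley_edges_def cayley_edges_sub_def\<close>)
  then have "(u, v \<otimes> g) \<in> ?R ^^ (n + m)" using n v by (auto simp: relpow_add v_def)
  moreover have "(v \<otimes> g, v \<otimes> g \<otimes> h) \<in> ?R"
  proof -
    have "pairs_prod ps \<otimes> g \<notin> H" using snoc.prems(2)[of ps g h] p by auto
    then have "v \<otimes> g \<notin> H" using assms(1,5) c unfolding v_def
      by (metis m_assoc m_closed inv_solve_left subgroup.m_closed subgroup.m_inv_closed subgroup.mem_carrier)
    then show ?thesis using v c gh
      unfolding adjacency_def edge_target_def rel_edges_def cayley_edges_def cayley_edges_sub_def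
      by (auto intro!: bexI[of _ "(v \<otimes> g, Inr h)"])
  qed
  ultimately have "(u, v \<otimes> g \<otimes> h) \<in> ?R ^^ Suc (n + m)" by auto
  moreover have "v \<otimes> g \<otimes> h = u \<otimes> pairs_prod (ps @ [p])"
    using c ps gh p assms(4) HG unfolding v_def by (subst p, subst pairs_prod_snoc) (auto simp: m_assoc)
  moreover have "Suc (n + m) \<le> length (ps @ [p]) * Suc L" using n m by auto
  ultimately show ?case by metis
qed

text \<open>
  If the product \<open>g\<^sub>1 h\<^sub>1 \<cdots> g\<^sub>n h\<^sub>n g\<close> lies in \<open>H\<close> and shorter ones do not, the edge labelled \<open>h\<^sub>1\<close>
  of the resulting polygon is joined, outside its coset of \<open>H\<close>, by the other sides, up to the finitely
  many labels from \<open>A\<close>; hence \<open>h\<^sub>1\<close> lies in a finite ball.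
\<close>

lemma pairs_prod_notin:
  assumes "subgroup H G" "X \<subseteq> carrier G" "generate G (X \<union> H) = carrier G"
    and fin: "\<And>n. finite (rel_ball G X H {} n)"
    and F: "finite F" "F \<subseteq> carrier G - H"
  shows "\<exists>K. finite K \<and> K \<subseteq> H \<and>
    (\<forall>ps g. length ps \<le> N \<longrightarrow> set ps \<subseteq> F \<times> (H - K) \<longrightarrow> g \<in> F \<longrightarrow> pairs_prod ps \<otimes> g \<notin> H)"
proof (induction N)
  case 0
  show ?case using F(2) by (intro exI[of _ "{}"]) auto
next
  case (Suc N)
  then obtain K where K: "finite K" "K \<subseteq> H" and
    IH: "\<And>ps g. length ps \<le> N \<Longrightarrow> set ps \<subseteq> F \<times> (H - K) \<Longrightarrow> g \<in> F \<Longrightarrow> pairs_prod ps \<otimes> g \<notin> H" by blast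
  have HG: "H \<subseteq> carrier G" using assms(1) by (rule subgroup.subset)
  interpret H: subgroup H G by fact
  have FG: "F \<subseteq> carrier G" using F by auto
  obtain L A where A: "finite A" "A \<subseteq> H" and
    words: "\<And>g. g \<in> F \<Longrightarrow> \<exists>n\<le>L. (\<one>, g) \<in> adjacency G (word_edges G X A) ^^ n"
    using finite_word_paths[OF assms(2) HG assms(3) F(1) FG] by blast
  let ?R = "adjacency G (rel_edges G X H A)"
  \<comment> \<open>The polygon is placed so that its edge labelled \<open>h1\<close> runs from
    \<open>\<one>\<close> to \<open>h1\<close>. The way back consists of at most \<open>N\<close>
    further pairs (\<open>N * Suc L\<close>), the last letter \<open>g\<close> (\<open>L\<close>),
    the closing edge (1) and the first letter \<open>g1\<close> (\<open>L\<close>).\<close>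
  define B where "B = rel_ball G X H A (N * Suc L + 2 * L + 1)"
  have "pairs_prod ps \<otimes> g \<notin> H"
    if ps: "length ps \<le> Suc N" "set ps \<subseteq> F \<times> (H - (K \<union> B))" and g: "g \<in> F" for ps g
  proof (cases ps)
    case Nil
    then show ?thesis using g F by auto
  next
    case (Cons p qs)
    obtain g1 h1 where p: "p = (g1, h1)" by (cases p)
    \<comment> \<open>Only the first letter from \<open>H\<close> has to avoid \<open>B\<close>;
      that the later ones avoid \<open>K\<close> is what the induction hypothesis asks for.\<close>
    have gh: "g1 \<in> F" "h1 \<in> H" "h1 \<notin> B" using ps(2) Cons p by auto
    have qs: "set qs \<subseteq> F \<times> H" "set qs \<subseteq> F \<times> (H - K)" "length qs \<le> N" using ps Cons by auto
    have c: "g1 \<in> carrier G" "h1 \<in> carrier G" "g \<in> carrier G" "pairs_prod qs \<in> carrier G"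
      using gh g FG HG qs by (auto intro!: pairs_prod_closed)
    show ?thesis
    proof
      assume inH: "pairs_prod ps \<otimes> g \<in> H"
      define h where "h = pairs_prod ps \<otimes> g"
      have h: "h \<in> H" "h \<in> carrier G" using inH HG h_def by auto
      have h_eq: "h = g1 \<otimes> (h1 \<otimes> pairs_prod qs \<otimes> g)" unfolding h_def Cons p using c by (simp add: m_assoc)
      \<comment> \<open>Prefixes of \<open>qs\<close> are short enough for the induction hypothesis,
        so the edges for its letters from \<open>H\<close> start outside \<open>H\<close>.\<close>
      have "\<exists>n\<le>length qs * Suc L. (h1, h1 \<otimes> pairs_prod qs) \<in> ?R ^^ n"
      proof (rule pairs_path[OF assms(1,2) A(2) FG gh(2) words qs(1)])
        fix rs g h assume "\<exists>ts. qs = rs @ (g, h) # ts"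
        then obtain ts where "qs = rs @ (g, h) # ts" by blast
        with qs show "pairs_prod rs \<otimes> g \<notin> H" by (intro IH) auto
      qed
      then obtain n1 where n1: "n1 \<le> length qs * Suc L" "(h1, h1 \<otimes> pairs_prod qs) \<in> ?R ^^ n1" by blast
      have word: "\<exists>n\<le>L. (v, v \<otimes> g) \<in> ?R ^^ n" if v: "v \<in> carrier G" and "g \<in> F" for v g
      proof -
        obtain n where n: "n \<le> L" "(\<one>, g) \<in> adjacency G (word_edges G X A) ^^ n" using words \<open>g \<in> F\<close> by blast
        have "(v \<otimes> \<one>, v \<otimes> g) \<in> ?R ^^ n"
          by (rule adjacency_relpow_translate[OF n(2)])
            (use assms(2) A(2) HG v in \<open>auto simp: word_edges_def rel_edges_def cayley_edges_def cayley_edges_sub_def\<close>)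
        then show ?thesis using n v by auto
      qed
      obtain n2 where n2: "n2 \<le> L" "(h1 \<otimes> pairs_prod qs, h1 \<otimes> pairs_prod qs \<otimes> g) \<in> ?R ^^ n2"
        using word[OF _ g] c by blast
      have e: "h1 \<otimes> pairs_prod qs \<otimes> g = inv g1 \<otimes> h"
        unfolding h_eq using c by (simp add: m_assoc[symmetric])
      have "inv g1 \<otimes> h \<notin> H"
      proof
        assume "inv g1 \<otimes> h \<in> H"
        then have "inv g1 \<in> H" using h c by (metis inv_closed inv_solve_right H.m_closed H.m_inv_closed H.mem_carrier)
        then have "g1 \<in> H" using H.m_inv_closed[of "inv g1"] c by simp
        then show False using gh F by auto
      qed
      \<comment> \<open>The closing edge has a label in \<open>H\<close> but starts outside
        \<open>H\<close>, so it survives the removal of Cay(H,H).\<close>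
      then have n3: "(inv g1 \<otimes> h, inv g1) \<in> ?R"
        unfolding adjacency_def edge_target_def rel_edges_def cayley_edges_def cayley_edges_sub_def
        using c h by (auto intro!: bexI[of _ "(inv g1 \<otimes> h, Inr (inv h))"] simp: m_assoc)
      obtain n4 where n4: "n4 \<le> L" "(inv g1, inv g1 \<otimes> g1) \<in> ?R ^^ n4"
        using word[OF _ gh(1), of "inv g1"] c by blast
      have "(h1, \<one>) \<in> ?R ^^ (n1 + (n2 + (1 + n4)))"
        using n1(2) n2(2) n3 n4(2) c unfolding e by (auto simp only: relpow_add relpow_1 l_inv)
      then have "(\<one>, h1) \<in> ?R ^^ (n1 + (n2 + (1 + n4)))" using relpow_sym sym_adjacency by metis
      moreover have "n1 + (n2 + (1 + n4)) \<le> N * Suc L + 2 * L + 1"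
        using n1(1) n2(1) n4(1) mult_right_mono[OF qs(3), of "Suc L"] by linarith
      ultimately have "h1 \<in> B" unfolding B_def rel_ball_def using gh(2) by blast
      then show False using gh(3) by blast
    qed
  qed
  moreover have "finite B" "B \<subseteq> H"
    unfolding B_def using finite_rel_ball[OF assms(1,2) A fin] by (auto simp: rel_ball_def)
  ultimately show ?case using K by (intro exI[of _ "K \<union> B"]) blast
qed

text \<open>Letters are stripped two at a time. The parity of the length decides whether a letter of
  \<open>F\<close> is left over at the end; \<open>ps \<noteq> []\<close> in the other case
  guarantees a last pair whose second entry can be cancelled.\<close>

lemma alternating_decomp:
  assumes "F \<subseteq> carrier G" "K \<subseteq> carrier G"
    and "ws \<noteq> []" "distinct_adj (map fst ws)" "fst (hd ws) = 1"
    and "\<forall>(i, x)\<in>set ws. i = (1::nat) \<and> x \<in> F \<or> i = 2 \<and> x \<in> K"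
  shows "\<exists>ps. length ps \<le> length ws \<and> set ps \<subseteq> F \<times> K \<and>
    (ps \<noteq> [] \<and> foldr (\<otimes>) (map snd ws) \<one> = pairs_prod ps \<or>
     (\<exists>g\<in>F. foldr (\<otimes>) (map snd ws) \<one> = pairs_prod ps \<otimes> g))"
  using assms(3-)
proof (induction "length ws" arbitrary: ws rule: less_induct)
  case less
  obtain g ws1 where ws: "ws = (1, g) # ws1" using less.prems by (cases ws) auto
  have g: "g \<in> F" "g \<in> carrier G" using less.prems ws assms(1) by auto
  show ?case
  proof (cases ws1)
    case Nil
    then show ?thesis using ws g by (intro exI[of _ "[]"]) (auto intro!: bexI[of _ g])
  next
    case (Cons w ws2)
    then obtain h where w: "w = (2, h)" "h \<in> K" "h \<in> carrier G"
      using less.prems ws assms(2) by (cases w) auto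
    show ?thesis
    proof (cases ws2)
      case Nil
      then show ?thesis using ws g w Cons by (intro exI[of _ "[(g, h)]"]) auto
    next
      case (Cons v ws3)
      then have v: "fst v = 1" using less.prems ws w \<open>ws1 = w # ws2\<close> by (cases v) auto
      have lt: "length ws2 < length ws" using ws \<open>ws1 = w # ws2\<close> by auto
      have "distinct_adj (map fst ws2)" "\<forall>(i, x)\<in>set ws2. i = (1::nat) \<and> x \<in> F \<or> i = 2 \<and> x \<in> K"
        using less.prems ws \<open>ws1 = w # ws2\<close> Cons by (auto simp: distinct_adj_Cons)
      from less.hyps[OF lt _ this(1) _ this(2)] obtain ps where
        ps: "length ps \<le> length ws2" "set ps \<subseteq> F \<times> K" and
        e: "ps \<noteq> [] \<and> foldr (\<otimes>) (map snd ws2) \<one> = pairs_prod ps \<or>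
          (\<exists>g\<in>F. foldr (\<otimes>) (map snd ws2) \<one> = pairs_prod ps \<otimes> g)"
        using Cons v by auto
      have "pairs_prod ps \<in> carrier G" using ps assms(1,2) by (auto intro!: pairs_prod_closed)
      then have "pairs_prod ((g, h) # ps) = g \<otimes> (h \<otimes> pairs_prod ps)"
        "\<And>k. k \<in> F \<Longrightarrow> pairs_prod ((g, h) # ps) \<otimes> k = g \<otimes> (h \<otimes> (pairs_prod ps \<otimes> k))"
        using g w assms(1) by (auto simp: m_assoc subset_iff)
      moreover have "foldr (\<otimes>) (map snd ws) \<one> = g \<otimes> (h \<otimes> foldr (\<otimes>) (map snd ws2) \<one>)"
        unfolding ws \<open>ws1 = w # ws2\<close> using w by simp
      ultimately have "ps \<noteq> [] \<and> foldr (\<otimes>) (map snd ws) \<one> = pairs_prod ((g, h) # ps) \<or>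
          (\<exists>k\<in>F. foldr (\<otimes>) (map snd ws) \<one> = pairs_prod ((g, h) # ps) \<otimes> k)"
        using e by metis
      then show ?thesis using ps g w lt by (intro exI[of _ "(g, h) # ps"]) auto
    qed
  qed
qed

text \<open>A word starting in \<open>F\<close> has its product outside \<open>H\<close>. A longer
  word starting in \<open>H\<close> is a letter of \<open>H\<close> times such a product, and if it
  were trivial the remaining product would be an inverse in \<open>H\<close>.\<close>

lemma alternating_prod_neq_one:
  assumes "hyperbolically_embedded G H" "finite F" "F \<subseteq> carrier G - H"
  shows "\<exists>K. finite K \<and> K \<subseteq> H \<and> (\<forall>ws. ws \<noteq> [] \<longrightarrow> length ws \<le> N \<longrightarrow> distinct_adj (map fst ws) \<longrightarrow>
    (\<forall>(i, x)\<in>set ws. i = (1::nat) \<and> x \<in> F \<or> i = 2 \<and> x \<in> H - K) \<longrightarrow> foldr (\<otimes>) (map snd ws) \<one> \<noteq> \<one>)"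
proof -
  obtain X where H: "subgroup H G" and X: "X \<subseteq> carrier G" "generate G (X \<union> H) = carrier G"
    and fin: "\<And>n. finite (rel_ball G X H {} n)"
    using assms(1) unfolding hyperbolically_embedded_def rel_ball_def rel_edges_def by auto
  interpret H: subgroup H G by fact
  have HG: "H \<subseteq> carrier G" by (rule H.subset)
  obtain K where K: "finite K" "K \<subseteq> H" and
    T: "\<And>ps g. length ps \<le> N \<Longrightarrow> set ps \<subseteq> F \<times> (H - K) \<Longrightarrow> g \<in> F \<Longrightarrow> pairs_prod ps \<otimes> g \<notin> H"
    using pairs_prod_notin[OF H X fin assms(2,3), of N] by blast
  have FG: "F \<subseteq> carrier G" and HKG: "H - K \<subseteq> carrier G" using assms(3) HG by auto
  have start1: "foldr (\<otimes>) (map snd ws) \<one> \<notin> H"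
    if ws: "ws \<noteq> []" "length ws \<le> N" "distinct_adj (map fst ws)" "fst (hd ws) = 1"
      "\<forall>(i, x)\<in>set ws. i = (1::nat) \<and> x \<in> F \<or> i = 2 \<and> x \<in> H - K" for ws
  proof -
    obtain ps where ps: "length ps \<le> length ws" "set ps \<subseteq> F \<times> (H - K)" and
      e: "ps \<noteq> [] \<and> foldr (\<otimes>) (map snd ws) \<one> = pairs_prod ps \<or>
        (\<exists>g\<in>F. foldr (\<otimes>) (map snd ws) \<one> = pairs_prod ps \<otimes> g)"
      using alternating_decomp[OF FG HKG ws(1,3,4,5)] by blast
    from e show ?thesis
    proof
      assume *: "ps \<noteq> [] \<and> foldr (\<otimes>) (map snd ws) \<one> = pairs_prod ps"
      then obtain qs g h where qs: "ps = qs @ [(g, h)]" by (metis rev_exhaust surj_pair)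
      then have c: "set qs \<subseteq> F \<times> (H - K)" "g \<in> F" "h \<in> H" using ps by auto
      then have "pairs_prod qs \<otimes> g \<notin> H" using T[of qs g] ps ws(2) qs by auto
      moreover have cc: "set qs \<subseteq> carrier G \<times> carrier G" "g \<in> carrier G" "h \<in> carrier G"
        using c FG HG by auto
      \<comment> \<open>Multiplying by the last letter, an element of \<open>H\<close>, does not
        change membership in \<open>H\<close>.\<close>
      ultimately have "pairs_prod qs \<otimes> g \<otimes> h \<notin> H"
        using c(3) by (metis H.m_closed H.m_inv_closed inv_solve_right m_closed pairs_prod_closed)
      then show ?thesis using * qs pairs_prod_snoc[OF cc] by simp
    next
      assume "\<exists>g\<in>F. foldr (\<otimes>) (map snd ws) \<one> = pairs_prod ps \<otimes> g"
      then show ?thesis using T ps ws(2) by (metis le_trans)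
    qed
  qed
  \<comment> \<open>Adding \<open>\<one>\<close> to \<open>K\<close> takes care of the words
    consisting of a single letter from \<open>H\<close>.\<close>
  have "foldr (\<otimes>) (map snd ws) \<one> \<noteq> \<one>"
    if ws: "ws \<noteq> []" "length ws \<le> N" "distinct_adj (map fst ws)"
      "\<forall>(i, x)\<in>set ws. i = (1::nat) \<and> x \<in> F \<or> i = 2 \<and> x \<in> H - insert \<one> K" for ws
  proof -
    have l: "\<forall>(i, x)\<in>set ws. i = (1::nat) \<and> x \<in> F \<or> i = 2 \<and> x \<in> H - K" using ws(4) by auto
    obtain w us where w: "ws = w # us" using ws(1) by (cases ws) auto
    show ?thesis
    proof (cases "fst w = 1")
      case True
      then show ?thesis using start1[OF ws(1-3) _ l] w H.one_closed by auto
    next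
      case False
      then obtain h where h: "w = (2, h)" "h \<in> H" "h \<noteq> \<one>" using ws(4) w by (cases w) auto
      show ?thesis
      proof (cases us)
        case Nil
        then show ?thesis using h w H.mem_carrier by auto
      next
        case (Cons v vs)
        then have "fst (hd us) = 1" "distinct_adj (map fst us)" using ws w h by auto
        moreover have lu: "\<forall>(i, x)\<in>set us. i = (1::nat) \<and> x \<in> F \<or> i = 2 \<and> x \<in> H - K" using l w by auto
        ultimately have n: "foldr (\<otimes>) (map snd us) \<one> \<notin> H" using start1[of us] ws(2) w Cons by auto
        have "set (map snd us) \<subseteq> carrier G"
          using lu FG HKG by fastforce
        then have "foldr (\<otimes>) (map snd us) \<one> \<in> carrier G" by (rule foldr_mult_closed)
        with n show ?thesis using h w
          by simp (metis H.m_inv_closed H.mem_carrier inv_equality inv_inv)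
      qed
    qed
  qed
  then show ?thesis using K H.one_closed by (intro exI[of _ "insert \<one> K"]) blast
qed

end

section \<open>Square-summable families\<close>

abbreviation truncated :: "'i set \<Rightarrow> ('i \<Rightarrow> complex) \<Rightarrow> 'i \<Rightarrow> complex" where
  "truncated A f \<equiv> (\<lambda>i. if i \<in> A then f i else 0)"

abbreviation fin_norm :: "'i set \<Rightarrow> ('i \<Rightarrow> complex) \<Rightarrow> real" where
  "fin_norm A f \<equiv> L2_set (\<lambda>i. cmod (f i)) A"

lemma ell2_outside: "f \<in> ell2 I \<Longrightarrow> i \<notin> I \<Longrightarrow> f i = 0"
  by (simp add: ell2_def)

lemma ell2_norm_nonneg [simp]: "ell2_norm I f \<ge> 0"
  by (simp add: ell2_norm_def infsum_nonneg)

lemma ell2_norm_sq: "(ell2_norm I f)\<^sup>2 = (\<Sum>\<^sub>\<infinity>i\<in>I. (cmod (f i))\<^sup>2)"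
  by (simp add: ell2_norm_def infsum_nonneg)

lemma fin_norm_le_ell2_norm:
  assumes "f \<in> ell2 I" "finite F" "F \<subseteq> I"
  shows "fin_norm F f \<le> ell2_norm I f"
  unfolding ell2_norm_def L2_set_def
  using assms by (intro real_sqrt_le_mono finite_sum_le_infsum) (auto simp: ell2_def)

lemma cmod_le_ell2_norm: "f \<in> ell2 I \<Longrightarrow> cmod (f i) \<le> ell2_norm I f"
  using fin_norm_le_ell2_norm[of f I "{i}"] by (cases "i \<in> I") (auto simp: ell2_outside)

text \<open>Both conclusions come from the same bound on finite subsets, so summability never needs
  an argument of its own and norm inequalities reduce to those of finite sums.\<close>

lemma ell2_boundI:
  assumes "\<And>i. i \<notin> I \<Longrightarrow> f i = 0" "\<And>F. finite F \<Longrightarrow> F \<subseteq> I \<Longrightarrow> fin_norm F f \<le> C"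
  shows "f \<in> ell2 I" "ell2_norm I f \<le> C"
proof -
  have C: "C \<ge> 0" using assms(2)[of "{}"] by simp
  have s: "(\<Sum>i\<in>F. (cmod (f i))\<^sup>2) \<le> C\<^sup>2" if "finite F" "F \<subseteq> I" for F
    using assms(2)[OF that] unfolding L2_set_def by (rule sqrt_le_D)
  have sm: "(\<lambda>i. (cmod (f i))\<^sup>2) summable_on I"
    by (rule nonneg_bdd_above_summable_on) (auto intro!: bdd_aboveI[of _ "C\<^sup>2"] s)
  then show "f \<in> ell2 I" using assms(1) by (simp add: ell2_def)
  have "(\<Sum>\<^sub>\<infinity>i\<in>I. (cmod (f i))\<^sup>2) \<le> C\<^sup>2" using sm s by (rule infsum_le_finite_sums)
  then show "ell2_norm I f \<le> C" unfolding ell2_norm_def using C by (simp add: real_le_lsqrt)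
qed

lemma
  assumes "f \<in> ell2 I" "g \<in> ell2 I"
  shows ell2_add: "(\<lambda>i. f i + g i) \<in> ell2 I"
    and ell2_norm_triangle: "ell2_norm I (\<lambda>i. f i + g i) \<le> ell2_norm I f + ell2_norm I g"
proof -
  have b: "fin_norm F (\<lambda>i. f i + g i) \<le> ell2_norm I f + ell2_norm I g" if "finite F" "F \<subseteq> I" for F
  proof -
    have "fin_norm F (\<lambda>i. f i + g i) \<le> L2_set (\<lambda>i. cmod (f i) + cmod (g i)) F"
      by (intro L2_set_mono norm_triangle_ineq) auto
    also have "\<dots> \<le> fin_norm F f + fin_norm F g" by (rule L2_set_triangle_ineq)
    also have "\<dots> \<le> ell2_norm I f + ell2_norm I g"
      using fin_norm_le_ell2_norm[OF assms(1) that] fin_norm_le_ell2_norm[OF assms(2) that] by simp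
    finally show ?thesis .
  qed
  have z: "f i + g i = 0" if "i \<notin> I" for i using that assms by (simp add: ell2_outside)
  show "(\<lambda>i. f i + g i) \<in> ell2 I" "ell2_norm I (\<lambda>i. f i + g i) \<le> ell2_norm I f + ell2_norm I g"
    using ell2_boundI[OF z b] by auto
qed

lemma ell2_norm_scale: "ell2_norm I (\<lambda>i. c * f i) = cmod c * ell2_norm I f"
  by (simp add: ell2_norm_def norm_mult power_mult_distrib infsum_cmult_right' real_sqrt_mult)

lemma ell2_scale: "f \<in> ell2 I \<Longrightarrow> (\<lambda>i. c * f i) \<in> ell2 I"
  by (auto simp: ell2_def norm_mult power_mult_distrib intro: summable_on_cmult_right)

lemma ell2_zero [simp]: "(\<lambda>i. 0) \<in> ell2 I"
  by (simp add: ell2_def)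

lemma ell2_norm_zero [simp]: "ell2_norm I (\<lambda>i. 0) = 0"
  by (simp add: ell2_norm_def)

lemma ell2_diff: "f \<in> ell2 I \<Longrightarrow> g \<in> ell2 I \<Longrightarrow> (\<lambda>i. f i - g i) \<in> ell2 I"
  using ell2_add[OF _ ell2_scale[of g I "-1"], of f] by simp

lemma ell2_norm_eq_0D: "f \<in> ell2 I \<Longrightarrow> ell2_norm I f = 0 \<Longrightarrow> f = (\<lambda>i. 0)"
  using cmod_le_ell2_norm by fastforce

lemma
  assumes "f \<in> ell2 I"
  shows truncate_ell2: "truncated J f \<in> ell2 I"
    and truncate_norm_le: "ell2_norm I (truncated J f) \<le> ell2_norm I f"
proof -
  have b: "fin_norm F (truncated J f) \<le> ell2_norm I f" if "finite F" "F \<subseteq> I" for F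
    by (rule order_trans[OF L2_set_mono fin_norm_le_ell2_norm[OF assms that]]) auto
  have z: "truncated J f i = 0" if "i \<notin> I" for i using that assms by (simp add: ell2_outside)
  show "truncated J f \<in> ell2 I" "ell2_norm I (truncated J f) \<le> ell2_norm I f"
    using ell2_boundI[OF z b] by auto
qed

lemma
  assumes "finite A" "A \<subseteq> I"
  shows truncate_finite_ell2: "truncated A f \<in> ell2 I"
    and truncate_finite_norm: "ell2_norm I (truncated A f) = fin_norm A f"
proof -
  have "((\<lambda>i. (cmod (truncated A f i))\<^sup>2) has_sum (\<Sum>i\<in>A. (cmod (f i))\<^sup>2)) I"
    by (rule has_sum_cong_neutral[THEN iffD1, OF _ _ _ has_sum_finite[OF assms(1)]]) (use assms in auto)
  then show "truncated A f \<in> ell2 I" "ell2_norm I (truncated A f) = fin_norm A f"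
    using assms(2) by (auto simp: ell2_def ell2_norm_def L2_set_def infsumI dest: has_sum_imp_summable)
qed

lemma delta_eq_truncate: "delta a = truncated {a} (\<lambda>i. 1)"
  by (auto simp: delta_def)

lemma delta_ell2: "a \<in> I \<Longrightarrow> delta a \<in> ell2 I"
  unfolding delta_eq_truncate by (rule truncate_finite_ell2) auto

lemma ell2_norm_delta: "a \<in> I \<Longrightarrow> ell2_norm I (delta a) = 1"
  unfolding delta_eq_truncate by (subst truncate_finite_norm) auto

text \<open>The estimate for all finite \<open>A\<close> above \<open>F\<close>, and not just for
  one set, is what convergence along the filter of finite subsets requires.\<close>

lemma ell2_approx:
  assumes "f \<in> ell2 I" "e > 0"
  shows "\<exists>F. finite F \<and> F \<subseteq> I \<and>
    (\<forall>A. finite A \<longrightarrow> F \<subseteq> A \<longrightarrow> A \<subseteq> I \<longrightarrow> ell2_norm I (\<lambda>i. f i - truncated A f i) < e)"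
proof -
  let ?s = "\<lambda>i. (cmod (f i))\<^sup>2"
  have sm: "?s summable_on I" using assms(1) by (simp add: ell2_def)
  then have "((sum ?s) \<longlongrightarrow> infsum ?s I) (finite_subsets_at_top I)"
    using has_sum_def has_sum_infsum by blast
  then have "eventually (\<lambda>A. dist (sum ?s A) (infsum ?s I) < e\<^sup>2) (finite_subsets_at_top I)"
    using assms(2) by (simp add: tendsto_iff)
  then obtain F where "finite F \<and> F \<subseteq> I \<and>
      (\<forall>A. finite A \<and> F \<subseteq> A \<and> A \<subseteq> I \<longrightarrow> dist (sum ?s A) (infsum ?s I) < e\<^sup>2)"
    unfolding eventually_finite_subsets_at_top by (rule exE)
  then have F: "finite F" "F \<subseteq> I"
    and d: "\<And>A. finite A \<Longrightarrow> F \<subseteq> A \<Longrightarrow> A \<subseteq> I \<Longrightarrow> dist (sum ?s A) (infsum ?s I) < e\<^sup>2"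
    by simp_all
  have "ell2_norm I (\<lambda>i. f i - truncated A f i) < e" if A: "finite A" "F \<subseteq> A" "A \<subseteq> I" for A
  proof -
    have "infsum ?s I = infsum ?s (I - A) + sum ?s A"
      using A sm by (subst infsum_Diff) (auto simp: summable_on_finite)
    moreover have "infsum (\<lambda>i. (cmod (f i - truncated A f i))\<^sup>2) I = infsum ?s (I - A)"
      by (rule infsum_cong_neutral) auto
    ultimately have "(ell2_norm I (\<lambda>i. f i - truncated A f i))\<^sup>2 < e\<^sup>2"
      using d[OF A] by (simp add: ell2_norm_sq dist_real_def)
    then show ?thesis using assms(2) by (simp add: power2_less_imp_less)
  qed
  with F show ?thesis by blast
qed

section \<open>The inner product on ell2\<close>

lemma
  assumes "f \<in> ell2 I" "g \<in> ell2 I"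
  shows ell2_inner_summable: "(\<lambda>i. f i * cnj (g i)) summable_on I"
    and ell2_Cauchy_Schwarz: "cmod (ell2_inner I f g) \<le> ell2_norm I f * ell2_norm I g"
proof -
  have b: "(\<Sum>i\<in>F. cmod (f i * cnj (g i))) \<le> ell2_norm I f * ell2_norm I g" if "finite F" "F \<subseteq> I" for F
  proof -
    have "(\<Sum>i\<in>F. cmod (f i * cnj (g i))) \<le> fin_norm F f * fin_norm F g"
      using L2_set_mult_ineq[of "\<lambda>i. cmod (f i)" "\<lambda>i. cmod (g i)" F] by (simp add: norm_mult)
    also have "\<dots> \<le> ell2_norm I f * ell2_norm I g"
      using fin_norm_le_ell2_norm[OF assms(1) that] fin_norm_le_ell2_norm[OF assms(2) that]
      by (intro mult_mono) auto
    finally show ?thesis .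
  qed
  have sm: "(\<lambda>i. cmod (f i * cnj (g i))) summable_on I"
    by (rule nonneg_bdd_above_summable_on) (auto intro!: bdd_aboveI b)
  then show "(\<lambda>i. f i * cnj (g i)) summable_on I" by (rule abs_summable_summable)
  have "cmod (ell2_inner I f g) \<le> (\<Sum>\<^sub>\<infinity>i\<in>I. cmod (f i * cnj (g i)))"
    unfolding ell2_inner_def using sm by (rule norm_infsum_bound)
  also have "\<dots> \<le> ell2_norm I f * ell2_norm I g" using sm b by (rule infsum_le_finite_sums)
  finally show "cmod (ell2_inner I f g) \<le> ell2_norm I f * ell2_norm I g" .
qed

lemma ell2_inner_self:
  assumes "f \<in> ell2 I"
  shows "ell2_inner I f f = of_real ((ell2_norm I f)\<^sup>2)"
proof -
  have "ell2_inner I f f = (\<Sum>\<^sub>\<infinity>i\<in>I. complex_of_real ((cmod (f i))\<^sup>2))"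
    unfolding ell2_inner_def by (simp only: complex_norm_square)
  also have "\<dots> = of_real ((ell2_norm I f)\<^sup>2)"
    unfolding ell2_norm_sq by (rule infsumI, rule has_sum_of_real) (use assms in \<open>simp add: ell2_def\<close>)
  finally show ?thesis .
qed

lemma ell2_inner_add:
  assumes "f \<in> ell2 I" "f' \<in> ell2 I" "g \<in> ell2 I"
  shows "ell2_inner I (\<lambda>i. f i + f' i) g = ell2_inner I f g + ell2_inner I f' g"
  unfolding ell2_inner_def using assms
  by (subst infsum_add[symmetric]) (auto simp: ring_distribs ell2_inner_summable)

lemma ell2_inner_scale: "ell2_inner I (\<lambda>i. c * f i) g = c * ell2_inner I f g"
  unfolding ell2_inner_def by (simp add: infsum_cmult_right' mult.assoc)

lemma ell2_inner_cnj: "cnj (ell2_inner I f g) = ell2_inner I g f"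
  unfolding ell2_inner_def by (simp flip: infsum_cnj add: mult.commute)

lemma ell2_inner_truncate:
  assumes "finite A" "A \<subseteq> I"
  shows "ell2_inner I f (truncated A g) = (\<Sum>i\<in>A. f i * cnj (g i))"
proof -
  have "ell2_inner I f (truncated A g) = (\<Sum>\<^sub>\<infinity>i\<in>A. f i * cnj (g i))"
    unfolding ell2_inner_def using assms by (intro infsum_cong_neutral) auto
  then show ?thesis using assms by simp
qed

lemma ell2_inner_delta: "a \<in> I \<Longrightarrow> ell2_inner I f (delta a) = f a"
  unfolding delta_eq_truncate by (subst ell2_inner_truncate) auto

section \<open>Bounded linear functionals on ell2\<close>

definition functional_bound :: "'i set \<Rightarrow> (('i \<Rightarrow> complex) \<Rightarrow> complex) \<Rightarrow> real \<Rightarrow> bool" where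
  "functional_bound I \<phi> C \<longleftrightarrow>
     (\<forall>f\<in>ell2 I. \<forall>g\<in>ell2 I. \<phi> (\<lambda>i. f i + g i) = \<phi> f + \<phi> g) \<and>
     (\<forall>c. \<forall>f\<in>ell2 I. \<phi> (\<lambda>i. c * f i) = c * \<phi> f) \<and>
     (\<forall>f\<in>ell2 I. cmod (\<phi> f) \<le> C * ell2_norm I f)"

lemma functional_bound_mono:
  assumes "functional_bound I \<phi> C" "C \<le> D"
  shows "functional_bound I \<phi> D"
  using assms mult_right_mono[OF assms(2) ell2_norm_nonneg] unfolding functional_bound_def
  by (meson order_trans)

lemma functional_diff:
  assumes "functional_bound I \<phi> C" "f \<in> ell2 I" "g \<in> ell2 I"
  shows "\<phi> (\<lambda>i. f i - g i) = \<phi> f - \<phi> g"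
proof -
  have "\<phi> (\<lambda>i. f i + (-1) * g i) = \<phi> f + (-1) * \<phi> g"
    using assms ell2_scale[OF assms(3), of "-1"] unfolding functional_bound_def by metis
  then show ?thesis by simp
qed

lemma functional_truncate:
  assumes "functional_bound I \<phi> C" "finite A" "A \<subseteq> I"
  shows "\<phi> (truncated A f) = (\<Sum>i\<in>A. f i * \<phi> (delta i))"
  using assms(2,3)
proof (induction A)
  case empty
  have "\<And>c f. f \<in> ell2 I \<Longrightarrow> \<phi> (\<lambda>i. c * f i) = c * \<phi> f"
    using assms(1) unfolding functional_bound_def by blast
  from this[OF ell2_zero, of 0] show ?case by simp
next
  case (insert a A)
  have e: "truncated (insert a A) f = (\<lambda>i. truncated A f i + f a * delta a i)"
    using insert by (auto simp: delta_def)
  have "\<phi> (truncated (insert a A) f) = \<phi> (truncated A f) + f a * \<phi> (delta a)"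
    unfolding e using assms(1) insert.prems insert.hyps
      truncate_finite_ell2[of A I f] ell2_scale[OF delta_ell2, of a I "f a"] delta_ell2[of a I]
    unfolding functional_bound_def by simp
  then show ?case using insert by simp
qed

lemma functional_approx:
  assumes "functional_bound I \<phi> C" "f \<in> ell2 I" "e > 0"
  shows "\<exists>F. finite F \<and> F \<subseteq> I \<and> (\<forall>A. finite A \<longrightarrow> F \<subseteq> A \<longrightarrow> A \<subseteq> I \<longrightarrow>
    cmod (\<phi> f - (\<Sum>i\<in>A. f i * \<phi> (delta i))) < e)"
proof -
  \<comment> \<open>Nothing is assumed about the sign of \<open>C\<close>;
    \<open>\<bar>C\<bar> + 1\<close> is a positive bound.\<close>
  have "e / (\<bar>C\<bar> + 1) > 0" using assms(3) by auto
  then obtain F where F: "finite F" "F \<subseteq> I" and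
    d: "\<And>A. finite A \<Longrightarrow> F \<subseteq> A \<Longrightarrow> A \<subseteq> I \<Longrightarrow> ell2_norm I (\<lambda>i. f i - truncated A f i) < e / (\<bar>C\<bar> + 1)"
    using ell2_approx[OF assms(2)] by meson
  have "cmod (\<phi> f - (\<Sum>i\<in>A. f i * \<phi> (delta i))) < e" if A: "finite A" "F \<subseteq> A" "A \<subseteq> I" for A
  proof -
    have t: "truncated A f \<in> ell2 I" by (rule truncate_ell2[OF assms(2)])
    have "cmod (\<phi> f - \<phi> (truncated A f)) \<le> C * ell2_norm I (\<lambda>i. f i - truncated A f i)"
      using functional_diff[OF assms(1,2) t] ell2_diff[OF assms(2) t] assms(1)
      unfolding functional_bound_def by metis
    also have "\<dots> \<le> (\<bar>C\<bar> + 1) * ell2_norm I (\<lambda>i. f i - truncated A f i)"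
      by (intro mult_right_mono) auto
    also have "\<dots> < e" using d[OF A] by (simp add: field_simps)
    finally show ?thesis using functional_truncate[OF assms(1) A(1,3)] by simp
  qed
  with F show ?thesis by blast
qed

text \<open>Truncations converge in norm and the functional is continuous, so it is determined by
  its values on the basis vectors \<open>delta i\<close>.\<close>

lemma functional_has_sum:
  assumes "functional_bound I \<phi> C" "f \<in> ell2 I"
  shows "((\<lambda>i. f i * \<phi> (delta i)) has_sum \<phi> f) I"
  unfolding has_sum_def
proof (rule tendstoI)
  fix e :: real assume "e > 0"
  from functional_approx[OF assms this] obtain F where
    "finite F" "F \<subseteq> I" "\<And>A. finite A \<Longrightarrow> F \<subseteq> A \<Longrightarrow> A \<subseteq> I \<Longrightarrow>
      dist (\<phi> f) (\<Sum>i\<in>A. f i * \<phi> (delta i)) < e"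
    unfolding dist_norm by metis
  then show "\<forall>\<^sub>F A in finite_subsets_at_top I. dist (\<Sum>i\<in>A. f i * \<phi> (delta i)) (\<phi> f) < e"
    unfolding eventually_finite_subsets_at_top by (intro exI[of _ F]) (simp add: dist_commute)
qed

lemma functional_eqI:
  assumes "functional_bound I \<phi> C" "functional_bound I \<psi> D" "f \<in> ell2 I"
    and "\<And>i. i \<in> I \<Longrightarrow> \<phi> (delta i) = \<psi> (delta i)"
  shows "\<phi> f = \<psi> f"
proof (rule has_sum_unique)
  show "((\<lambda>i. f i * \<phi> (delta i)) has_sum \<phi> f) I" using functional_has_sum assms by blast
  show "((\<lambda>i. f i * \<phi> (delta i)) has_sum \<psi> f) I"
    by (rule has_sum_cong[THEN iffD1, OF _ functional_has_sum[OF assms(2,3)]]) (simp add: assms(4))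
qed

text \<open>A three-epsilon argument: a uniform bound reduces convergence at \<open>f\<close> to
  convergence at a finite truncation. Only indices in the support of \<open>f\<close> matter, which
  is decisive later, when limits of coefficients are prescribed on \<open>H\<close> alone.\<close>

lemma functional_tendsto:
  assumes "\<And>n. functional_bound I (\<phi> n) C" "functional_bound I \<psi> D" "f \<in> ell2 I"
    and lim: "\<And>i. i \<in> I \<Longrightarrow> f i \<noteq> 0 \<Longrightarrow> ((\<lambda>n. \<phi> n (delta i)) \<longlongrightarrow> \<psi> (delta i)) \<omega>"
  shows "((\<lambda>n. \<phi> n f) \<longlongrightarrow> \<psi> f) \<omega>"
proof (rule tendstoI)
  fix e :: real assume e: "e > 0"
  define C' where "C' = \<bar>C\<bar> + \<bar>D\<bar> + 1"
  have C': "C' > 0" "C \<le> C'" "D \<le> C'" unfolding C'_def by auto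
  have "e / (3 * C') > 0" using e C' by simp
  then obtain A where A: "finite A" "A \<subseteq> I" and d: "ell2_norm I (\<lambda>i. f i - truncated A f i) < e / (3 * C')"
    using ell2_approx[OF assms(3)] by blast
  have t: "truncated A f \<in> ell2 I" by (rule truncate_ell2[OF assms(3)])
  have near: "cmod (\<theta> f - \<theta> (truncated A f)) < e / 3" if "functional_bound I \<theta> K" "K \<le> C'" for \<theta> K
  proof -
    have "cmod (\<theta> f - \<theta> (truncated A f)) \<le> K * ell2_norm I (\<lambda>i. f i - truncated A f i)"
      using functional_diff[OF that(1) assms(3) t] ell2_diff[OF assms(3) t] that(1)
      unfolding functional_bound_def by metis
    also have "\<dots> \<le> C' * ell2_norm I (\<lambda>i. f i - truncated A f i)"
      using that by (intro mult_right_mono) auto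
    also have "\<dots> < e / 3" using d C' by (simp add: field_simps)
    finally show ?thesis .
  qed
  have "((\<lambda>n. \<phi> n (truncated A f)) \<longlongrightarrow> \<psi> (truncated A f)) \<omega>"
    unfolding functional_truncate[OF assms(1) A] functional_truncate[OF assms(2) A]
  proof (rule tendsto_sum)
    fix i assume "i \<in> A"
    then show "((\<lambda>n. f i * \<phi> n (delta i)) \<longlongrightarrow> f i * \<psi> (delta i)) \<omega>"
      using lim[of i] A by (cases "f i = 0") (auto intro!: tendsto_intros)
  qed
  then have "\<forall>\<^sub>F n in \<omega>. dist (\<phi> n (truncated A f)) (\<psi> (truncated A f)) < e / 3"
    by (rule tendstoD) (use e in simp)
  then show "\<forall>\<^sub>F n in \<omega>. dist (\<phi> n f) (\<psi> f) < e"
  proof eventually_elim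
    case (elim n)
    have "cmod (\<phi> n f - \<psi> f) \<le> cmod (\<phi> n f - \<phi> n (truncated A f))
        + cmod (\<phi> n (truncated A f) - \<psi> (truncated A f)) + cmod (\<psi> f - \<psi> (truncated A f))"
      using norm_triangle_ineq4[of "(\<phi> n f - \<phi> n (truncated A f)) + (\<phi> n (truncated A f) - \<psi> (truncated A f))"
          "\<psi> f - \<psi> (truncated A f)"]
        norm_triangle_ineq[of "\<phi> n f - \<phi> n (truncated A f)" "\<phi> n (truncated A f) - \<psi> (truncated A f)"]
      by simp
    then show ?case
      using elim near[OF assms(1) C'(2), of n] near[OF assms(2) C'(3)] unfolding dist_norm by linarith
  qed
qed

lemma functional_inner:
  "g \<in> ell2 I \<Longrightarrow> functional_bound I (\<lambda>f. ell2_inner I f g) (ell2_norm I g)"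
  unfolding functional_bound_def
  using ell2_inner_add ell2_inner_scale ell2_Cauchy_Schwarz by (metis mult.commute)

section \<open>Bounded operators\<close>

lemma bounded_opsD:
  assumes "T \<in> bounded_ops I"
  shows "f \<in> ell2 I \<Longrightarrow> T f \<in> ell2 I"
    and "f \<in> ell2 I \<Longrightarrow> g \<in> ell2 I \<Longrightarrow> T (\<lambda>i. f i + g i) = (\<lambda>i. T f i + T g i)"
    and "f \<in> ell2 I \<Longrightarrow> T (\<lambda>i. c * f i) = (\<lambda>i. c * T f i)"
    and "f \<notin> ell2 I \<Longrightarrow> T f = undefined"
  using assms unfolding bounded_ops_def PiE_def extensional_def by auto

lemma bounded_opsI:
  assumes "T \<in> extensional (ell2 I)" "\<And>f. f \<in> ell2 I \<Longrightarrow> T f \<in> ell2 I"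
    and "\<And>f g. f \<in> ell2 I \<Longrightarrow> g \<in> ell2 I \<Longrightarrow> T (\<lambda>i. f i + g i) = (\<lambda>i. T f i + T g i)"
    and "\<And>f c. f \<in> ell2 I \<Longrightarrow> T (\<lambda>i. c * f i) = (\<lambda>i. c * T f i)"
    and "\<And>f. f \<in> ell2 I \<Longrightarrow> ell2_norm I (T f) \<le> C * ell2_norm I f"
  shows "T \<in> bounded_ops I"
  using assms unfolding bounded_ops_def PiE_def Pi_def by blast

lemma op_norm_le:
  assumes "C \<ge> 0" "\<And>f. f \<in> ell2 I \<Longrightarrow> ell2_norm I (T f) \<le> C * ell2_norm I f"
  shows "op_norm I T \<le> C"
  unfolding op_norm_def
proof (rule cSUP_least)
  show "{f \<in> ell2 I. ell2_norm I f \<le> 1} \<noteq> {}" using ell2_zero ell2_norm_zero by fastforce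
  fix f assume f: "f \<in> {f \<in> ell2 I. ell2_norm I f \<le> 1}"
  then have "ell2_norm I (T f) \<le> C * ell2_norm I f" using assms by auto
  also have "\<dots> \<le> C * 1" using f assms by (intro mult_left_mono) auto
  finally show "ell2_norm I (T f) \<le> C" by simp
qed

lemma op_norm_upper:
  assumes "T \<in> bounded_ops I" "f \<in> ell2 I" "ell2_norm I f \<le> 1"
  shows "ell2_norm I (T f) \<le> op_norm I T"
  unfolding op_norm_def
proof (rule cSUP_upper)
  show "f \<in> {f \<in> ell2 I. ell2_norm I f \<le> 1}" using assms by simp
  obtain C where C: "\<And>f. f \<in> ell2 I \<Longrightarrow> ell2_norm I (T f) \<le> C * ell2_norm I f"
    using assms(1) unfolding bounded_ops_def by blast
  have "ell2_norm I (T f) \<le> \<bar>C\<bar>" if "f \<in> ell2 I" "ell2_norm I f \<le> 1" for f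
  proof -
    have "ell2_norm I (T f) \<le> \<bar>C\<bar> * ell2_norm I f"
      using C[OF that(1)] by (meson abs_ge_self ell2_norm_nonneg mult_right_mono order_trans)
    also have "\<dots> \<le> \<bar>C\<bar> * 1" using that by (intro mult_left_mono) auto
    finally show ?thesis by simp
  qed
  then show "bdd_above ((\<lambda>f. ell2_norm I (T f)) ` {f \<in> ell2 I. ell2_norm I f \<le> 1})"
    by (auto intro!: bdd_aboveI[of _ "\<bar>C\<bar>"])
qed

lemma op_norm_nonneg: "T \<in> bounded_ops I \<Longrightarrow> op_norm I T \<ge> 0"
  using op_norm_upper[of T I "\<lambda>i. 0"] by (simp add: order_trans[OF ell2_norm_nonneg])

lemma op_norm_bound:
  assumes "T \<in> bounded_ops I" "f \<in> ell2 I"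
  shows "ell2_norm I (T f) \<le> op_norm I T * ell2_norm I f"
proof (cases "ell2_norm I f = 0")
  case True
  have "ell2_norm I (T (\<lambda>i. 0 * f i)) = cmod 0 * ell2_norm I (T f)"
    unfolding bounded_opsD(3)[OF assms] ell2_norm_scale ..
  then show ?thesis using ell2_norm_eq_0D[OF assms(2) True] True by simp
next
  case False
  define r where "r = ell2_norm I f"
  have r: "r > 0" using False ell2_norm_nonneg[of I f] unfolding r_def by linarith
  let ?g = "\<lambda>i. complex_of_real (1 / r) * f i"
  have "ell2_norm I ?g = 1" unfolding ell2_norm_scale using r by (simp add: norm_divide r_def)
  then have "ell2_norm I (T ?g) \<le> op_norm I T" using assms by (intro op_norm_upper ell2_scale) auto
  moreover have "ell2_norm I (T ?g) = ell2_norm I (T f) / r"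
    unfolding bounded_opsD(3)[OF assms] ell2_norm_scale using r by (simp add: norm_divide)
  ultimately have "ell2_norm I (T f) / r \<le> op_norm I T" by simp
  then show ?thesis using r by (simp add: r_def[symmetric] divide_le_eq)
qed

lemma functional_op_coord:
  assumes "T \<in> bounded_ops I"
  shows "functional_bound I (\<lambda>f. T f x) (op_norm I T)"
  unfolding functional_bound_def
proof (intro conjI ballI allI)
  fix f assume f: "f \<in> ell2 I"
  have "cmod (T f x) \<le> ell2_norm I (T f)" by (rule cmod_le_ell2_norm[OF bounded_opsD(1)[OF assms f]])
  also have "\<dots> \<le> op_norm I T * ell2_norm I f" using assms f by (rule op_norm_bound)
  finally show "cmod (T f x) \<le> op_norm I T * ell2_norm I f" .
qed (simp_all add: bounded_opsD(2,3)[OF assms])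

lemma functional_op_inner:
  assumes "T \<in> bounded_ops I" "g \<in> ell2 I"
  shows "functional_bound I (\<lambda>f. ell2_inner I (T f) g) (op_norm I T * ell2_norm I g)"
  unfolding functional_bound_def
proof (intro conjI ballI allI)
  fix f assume f: "f \<in> ell2 I"
  have "cmod (ell2_inner I (T f) g) \<le> ell2_norm I (T f) * ell2_norm I g"
    by (rule ell2_Cauchy_Schwarz[OF bounded_opsD(1)[OF assms(1) f] assms(2)])
  also have "\<dots> \<le> (op_norm I T * ell2_norm I f) * ell2_norm I g"
    using op_norm_bound[OF assms(1) f] by (intro mult_right_mono) auto
  finally show "cmod (ell2_inner I (T f) g) \<le> op_norm I T * ell2_norm I g * ell2_norm I f"
    by (simp add: ac_simps)
qed (simp_all add: bounded_opsD(1-3)[OF assms(1)] ell2_inner_add ell2_inner_scale assms(2))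

lemma op_has_sum:
  "T \<in> bounded_ops I \<Longrightarrow> f \<in> ell2 I \<Longrightarrow> ((\<lambda>y. f y * T (delta y) x) has_sum T f x) I"
  using functional_has_sum[OF functional_op_coord] by fast

text \<open>Each coordinate of \<open>T f\<close> is a bounded functional of \<open>f\<close>, hence
  fixed by the entries; off \<open>ell2 I\<close> both operators take the value
  \<open>undefined\<close>.\<close>

lemma op_eqI:
  assumes "T \<in> bounded_ops I" "S \<in> bounded_ops I"
    and "\<And>x y. x \<in> I \<Longrightarrow> y \<in> I \<Longrightarrow> T (delta y) x = S (delta y) x"
  shows "T = S"
proof
  fix f show "T f = S f"
  proof (cases "f \<in> ell2 I")
    case True
    show ?thesis
    proof
      fix x show "T f x = S f x"
      proof (cases "x \<in> I")
        case x: True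
        show ?thesis
          using functional_eqI[OF functional_op_coord[OF assms(1)] functional_op_coord[OF assms(2)] True] assms(3) x
          by blast
      next
        case False
        then show ?thesis using True assms bounded_opsD(1) ell2_outside by metis
      qed
    qed
  next
    case False
    then show ?thesis using assms bounded_opsD(4) by metis
  qed
qed

lemma op_form:
  assumes "T \<in> bounded_ops I" "finite A" "A \<subseteq> I"
  shows "ell2_inner I (T (truncated A f)) (truncated A g) = (\<Sum>x\<in>A. \<Sum>y\<in>A. T (delta y) x * f y * cnj (g x))"
  unfolding ell2_inner_truncate[OF assms(2,3)]
    functional_truncate[OF functional_op_coord[OF assms(1)] assms(2,3)]
  unfolding sum_distrib_right by (simp add: mult.commute)

lemma op_form_bound:
  assumes "T \<in> bounded_ops I" "finite A" "A \<subseteq> I"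
  shows "cmod (\<Sum>x\<in>A. \<Sum>y\<in>A. T (delta y) x * f y * cnj (g x)) \<le> op_norm I T * fin_norm A f * fin_norm A g"
proof -
  have t: "truncated A f \<in> ell2 I" "truncated A g \<in> ell2 I" using truncate_finite_ell2[OF assms(2,3)] by auto
  have "cmod (ell2_inner I (T (truncated A f)) (truncated A g))
      \<le> op_norm I T * ell2_norm I (truncated A g) * ell2_norm I (truncated A f)"
    using functional_op_inner[OF assms(1) t(2)] t(1) unfolding functional_bound_def by blast
  then show ?thesis unfolding op_form[OF assms] truncate_finite_norm[OF assms(2,3)] by (simp add: ac_simps)
qed

lemma op_ext:
  "T \<in> bounded_ops I \<Longrightarrow> S \<in> bounded_ops I \<Longrightarrow> (\<And>f. f \<in> ell2 I \<Longrightarrow> T f = S f) \<Longrightarrow> T = S"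
  by (rule op_eqI) (auto simp: delta_ell2)

text \<open>The level sets of \<open>D\<close> split \<open>f\<close> and \<open>g\<close> into
  orthogonal pieces. Each diagonal block is bounded by the norm of \<open>T\<close>, and the
  Cauchy-Schwarz inequality over the blocks reassembles the norms. With \<open>D\<close> the right
  coset of \<open>H\<close>, this is the contractivity of the conditional expectation onto
  L(H).\<close>

lemma block_diagonal_form_bound:
  assumes "T \<in> bounded_ops I" "finite A" "A \<subseteq> I"
  shows "cmod (\<Sum>x\<in>A. \<Sum>y\<in>A. (if D x = D y then T (delta y) x else 0) * f y * cnj (g x))
    \<le> op_norm I T * fin_norm A f * fin_norm A g"
proof -
  define B where "B d = {x. x \<in> A \<and> D x = d}" for d
  have B: "finite (B d)" "B d \<subseteq> I" for d using assms(2,3) by (auto simp: B_def)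
  \<comment> \<open>Pythagoras for the pieces of \<open>h\<close> on the blocks.\<close>
  have L2: "L2_set (\<lambda>d. fin_norm (B d) h) (D ` A) = fin_norm A h" for h
    unfolding L2_set_def B_def using assms(2)
    by (simp add: sum_nonneg sum.image_gen[of A "\<lambda>i. (cmod (h i))\<^sup>2" D, symmetric])
  have "(\<Sum>x\<in>A. \<Sum>y\<in>A. (if D x = D y then T (delta y) x else 0) * f y * cnj (g x))
      = (\<Sum>d\<in>D ` A. \<Sum>x\<in>B d. \<Sum>y\<in>A. (if D x = D y then T (delta y) x else 0) * f y * cnj (g x))"
    unfolding B_def by (rule sum.image_gen[OF assms(2)])
  also have "\<dots> = (\<Sum>d\<in>D ` A. \<Sum>x\<in>B d. \<Sum>y\<in>B d. T (delta y) x * f y * cnj (g x))"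
    using assms(2) by (intro sum.cong refl sum.mono_neutral_cong_right) (auto simp: B_def)
  finally have "cmod (\<Sum>x\<in>A. \<Sum>y\<in>A. (if D x = D y then T (delta y) x else 0) * f y * cnj (g x))
      \<le> (\<Sum>d\<in>D ` A. cmod (\<Sum>x\<in>B d. \<Sum>y\<in>B d. T (delta y) x * f y * cnj (g x)))"
    by (simp add: norm_sum)
  also have "\<dots> \<le> (\<Sum>d\<in>D ` A. op_norm I T * (fin_norm (B d) f * fin_norm (B d) g))"
    using op_form_bound[OF assms(1) B] by (intro sum_mono) (simp add: mult.assoc)
  also have "\<dots> = op_norm I T * (\<Sum>d\<in>D ` A. \<bar>fin_norm (B d) f\<bar> * \<bar>fin_norm (B d) g\<bar>)"
    by (simp add: sum_distrib_left L2_set_nonneg)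
  also have "\<dots> \<le> op_norm I T * (fin_norm A f * fin_norm A g)"
    using L2_set_mult_ineq[of "\<lambda>d. fin_norm (B d) f" "\<lambda>d. fin_norm (B d) g" "D ` A"] assms(1)
    unfolding L2 by (intro mult_left_mono op_norm_nonneg)
  finally show ?thesis by (simp add: mult.assoc)
qed

text \<open>A matrix whose finite sesquilinear forms are uniformly bounded defines an operator: its
  conjugated rows are square-summable, and the operator takes inner products with them. Operators
  known only through their entries, such as adjoints and weak limits, are obtained in this
  way.\<close>

lemma bounded_form_rep:
  assumes C: "C \<ge> 0"
    and form: "\<And>A f g. finite A \<Longrightarrow> A \<subseteq> I \<Longrightarrow>
      cmod (\<Sum>x\<in>A. \<Sum>y\<in>A. a x y * f y * cnj (g x)) \<le> C * fin_norm A f * fin_norm A g"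
  shows "\<exists>T\<in>bounded_ops I. op_norm I T \<le> C \<and> (\<forall>x\<in>I. \<forall>y\<in>I. T (delta y) x = a x y)"
proof -
  define r where "r x = truncated I (\<lambda>y. cnj (a x y))" for x
  have r: "r x \<in> ell2 I" if x: "x \<in> I" for x
  proof (rule ell2_boundI(1))
    show "r x i = 0" if "i \<notin> I" for i using that by (simp add: r_def)
    fix F assume F: "finite F" "F \<subseteq> I"
    have L: "fin_norm F (r x) = fin_norm F (a x)" using F by (intro L2_set_cong) (auto simp: r_def)
    \<comment> \<open>Testing the form on the conjugated row, cut to \<open>F\<close>, against
      \<open>delta x\<close> bounds the square of the norm of the row by \<open>C\<close> times that
      norm.\<close>
    have "(\<Sum>z\<in>insert x F. \<Sum>y\<in>insert x F. a z y * truncated F (\<lambda>y. cnj (a x y)) y * cnj (delta x z))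
        = (\<Sum>y\<in>insert x F. a x y * truncated F (\<lambda>y. cnj (a x y)) y)"
    proof -
      have "(\<Sum>z\<in>insert x F. \<Sum>y\<in>insert x F. a z y * truncated F (\<lambda>y. cnj (a x y)) y * cnj (delta x z))
        = (\<Sum>z\<in>insert x F. if z = x then \<Sum>y\<in>insert x F. a x y * truncated F (\<lambda>y. cnj (a x y)) y else 0)"
        by (intro sum.cong) (auto simp: delta_def)
      then show ?thesis using F by (simp only: sum.delta' sum.delta finite_insert) simp
    qed
    also have "\<dots> = (\<Sum>y\<in>F. a x y * cnj (a x y))"
      using F by (intro sum.mono_neutral_cong_right) auto
    also have "\<dots> = of_real ((fin_norm F (a x))\<^sup>2)"
      by (simp add: L2_set_def sum_nonneg flip: complex_norm_square)
    finally have "(fin_norm F (a x))\<^sup>2 \<le>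
        C * fin_norm (insert x F) (truncated F (\<lambda>y. cnj (a x y))) * fin_norm (insert x F) (delta x)"
      using form[of "insert x F" "truncated F (\<lambda>y. cnj (a x y))" "delta x"] F x
      by (simp add: norm_power L2_set_nonneg)
    moreover have "fin_norm (insert x F) (delta x) = 1"
      using F unfolding L2_set_def delta_def by (simp add: if_distrib[of cmod] if_distrib[of "\<lambda>t. t\<^sup>2"] cong: if_cong)
    moreover have "fin_norm (insert x F) (truncated F (\<lambda>y. cnj (a x y))) = fin_norm F (a x)"
      unfolding L2_set_def using F by (intro arg_cong[of _ _ sqrt] sum.mono_neutral_cong_right) auto
    ultimately have "fin_norm F (a x) * fin_norm F (a x) \<le> C * fin_norm F (a x)"
      by (simp add: power2_eq_square)
    then have "fin_norm F (a x) \<le> C"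
      using C by (cases "fin_norm F (a x) = 0") (auto simp: mult_le_cancel_right L2_set_nonneg order_less_le)
    then show "fin_norm F (r x) \<le> C" using L by simp
  qed
  define T where "T = (\<lambda>f\<in>ell2 I. \<lambda>x. if x \<in> I then ell2_inner I f (r x) else 0)"
  have T: "T f x = ell2_inner I f (r x)" if "f \<in> ell2 I" "x \<in> I" for f x using that by (simp add: T_def)
  have bd: "fin_norm F (T f) \<le> C * ell2_norm I f" if f: "f \<in> ell2 I" and F: "finite F" "F \<subseteq> I" for f F
  proof -
    define g where "g = T f"
    \<comment> \<open>The pairing with \<open>T f\<close> restricted to \<open>F\<close>. At
      \<open>f\<close> itself it is the square of the norm of that restriction, while the form
      bounds it by \<open>C\<close> times the two norms; one factor then cancels.\<close>
    define \<phi> where "\<phi> h = (\<Sum>x\<in>F. ell2_inner I h (r x) * cnj (g x))" for h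
    have \<phi>: "functional_bound I \<phi> (\<Sum>x\<in>F. ell2_norm I (r x) * cmod (g x))"
      unfolding functional_bound_def
    proof (intro conjI ballI allI)
      fix h assume h: "h \<in> ell2 I"
      have "cmod (\<phi> h) \<le> (\<Sum>x\<in>F. cmod (ell2_inner I h (r x) * cnj (g x)))"
        unfolding \<phi>_def by (rule norm_sum)
      also have "\<dots> \<le> (\<Sum>x\<in>F. ell2_norm I (r x) * cmod (g x) * ell2_norm I h)"
      proof (rule sum_mono)
        fix x assume "x \<in> F"
        then have "cmod (ell2_inner I h (r x)) \<le> ell2_norm I h * ell2_norm I (r x)"
          using ell2_Cauchy_Schwarz[OF h r] F by auto
        then have "cmod (ell2_inner I h (r x)) * cmod (g x) \<le> ell2_norm I h * ell2_norm I (r x) * cmod (g x)"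
          by (intro mult_right_mono) auto
        then show "cmod (ell2_inner I h (r x) * cnj (g x)) \<le> ell2_norm I (r x) * cmod (g x) * ell2_norm I h"
          by (simp add: norm_mult ac_simps)
      qed
      finally show "cmod (\<phi> h) \<le> (\<Sum>x\<in>F. ell2_norm I (r x) * cmod (g x)) * ell2_norm I h"
        by (simp add: sum_distrib_right)
    next
      fix h h' assume h: "h \<in> ell2 I" "h' \<in> ell2 I"
      have "ell2_inner I (\<lambda>i. h i + h' i) (r x) = ell2_inner I h (r x) + ell2_inner I h' (r x)" if "x \<in> F" for x
        using ell2_inner_add[OF h r] that F by auto
      then show "\<phi> (\<lambda>i. h i + h' i) = \<phi> h + \<phi> h'"
        by (simp add: \<phi>_def sum.distrib ring_distribs)
    qed (simp add: \<phi>_def ell2_inner_scale sum_distrib_left mult.assoc)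
    have "((\<lambda>y. f y * \<phi> (delta y)) has_sum \<phi> f) I" by (rule functional_has_sum[OF \<phi> f])
    then have lim: "((\<lambda>B. cmod (\<Sum>y\<in>B. f y * \<phi> (delta y))) \<longlongrightarrow> cmod (\<phi> f)) (finite_subsets_at_top I)"
      unfolding has_sum_def by (rule tendsto_norm)
    have part: "cmod (\<Sum>y\<in>B. f y * \<phi> (delta y)) \<le> C * ell2_norm I f * fin_norm F g"
      if B: "finite B" "B \<subseteq> I" for B
    proof -
      \<comment> \<open>The form is bounded over one common index set, so both vectors are extended
        by zero to the union.\<close>
      let ?A = "F \<union> B"
      have A: "finite ?A" "?A \<subseteq> I" using F B by auto
      have d: "ell2_inner I (delta y) (r x) = a x y" if "x \<in> F" "y \<in> B" for x y
        using that F B by (subst ell2_inner_cnj[symmetric], subst ell2_inner_delta) (auto simp: r_def)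
      have "(\<Sum>y\<in>B. f y * \<phi> (delta y)) = (\<Sum>x\<in>F. \<Sum>y\<in>B. a x y * f y * cnj (g x))"
        unfolding \<phi>_def sum_distrib_left by (subst sum.swap) (auto intro!: sum.cong simp: d)
      also have "\<dots> = (\<Sum>x\<in>?A. \<Sum>y\<in>?A. a x y * truncated B f y * cnj (truncated F g x))"
      proof (rule sum.mono_neutral_cong_left)
        fix x assume "x \<in> F"
        then show "(\<Sum>y\<in>B. a x y * f y * cnj (g x)) = (\<Sum>y\<in>?A. a x y * truncated B f y * cnj (truncated F g x))"
          using A by (intro sum.mono_neutral_cong_left) auto
      qed (use A in auto)
      finally have "cmod (\<Sum>y\<in>B. f y * \<phi> (delta y)) \<le> C * fin_norm ?A (truncated B f) * fin_norm ?A (truncated F g)"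
        using form[OF A] by simp
      also have "\<dots> = C * fin_norm B f * fin_norm F g"
      proof -
        have "fin_norm ?A (truncated B f) = fin_norm B f" "fin_norm ?A (truncated F g) = fin_norm F g"
          unfolding L2_set_def using A by (auto intro!: arg_cong[of _ _ sqrt] sum.mono_neutral_cong_right)
        then show ?thesis by simp
      qed
      also have "\<dots> \<le> C * ell2_norm I f * fin_norm F g"
        using C fin_norm_le_ell2_norm[OF f B] by (intro mult_right_mono mult_left_mono) (auto simp: L2_set_nonneg)
      finally show ?thesis .
    qed
    have "cmod (\<phi> f) \<le> C * ell2_norm I f * fin_norm F g"
      by (rule tendsto_upperbound[OF lim])
        (auto intro!: part simp: eventually_finite_subsets_at_top)
    moreover have "\<phi> f = of_real ((fin_norm F g)\<^sup>2)"
    proof -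
      have "\<phi> f = (\<Sum>x\<in>F. g x * cnj (g x))"
        unfolding \<phi>_def using F by (intro sum.cong) (auto simp: g_def T f)
      then show ?thesis by (simp add: L2_set_def sum_nonneg flip: complex_norm_square)
    qed
    ultimately have "fin_norm F g * fin_norm F g \<le> C * ell2_norm I f * fin_norm F g"
      by (simp add: power2_eq_square norm_mult L2_set_nonneg)
    then have "fin_norm F g \<le> C * ell2_norm I f"
      using C by (cases "fin_norm F g = 0") (auto simp: mult_le_cancel_right L2_set_nonneg order_less_le)
    then show ?thesis unfolding g_def .
  qed
  have out: "T f i = 0" if "f \<in> ell2 I" "i \<notin> I" for f i using that by (simp add: T_def)
  have bnd: "T f \<in> ell2 I" "ell2_norm I (T f) \<le> C * ell2_norm I f" if "f \<in> ell2 I" for f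
    using ell2_boundI[OF out[OF that] bd[OF that]] by auto
  have "T \<in> bounded_ops I"
  proof (rule bounded_opsI[OF _ bnd(1) _ _ bnd(2)])
    show "T \<in> extensional (ell2 I)" by (simp add: T_def)
    show "T (\<lambda>i. f i + g i) = (\<lambda>i. T f i + T g i)" if "f \<in> ell2 I" "g \<in> ell2 I" for f g
      using that ell2_add[OF that] by (auto simp: T_def fun_eq_iff ell2_inner_add r)
    show "T (\<lambda>i. c * f i) = (\<lambda>i. c * T f i)" if "f \<in> ell2 I" for f c
      using that ell2_scale[OF that] by (auto simp: T_def fun_eq_iff ell2_inner_scale)
  qed
  moreover have "op_norm I T \<le> C" by (rule op_norm_le[OF C bnd(2)])
  moreover have "T (delta y) x = a x y" if "x \<in> I" "y \<in> I" for x y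
    using that by (subst T, simp add: delta_ell2, simp, subst ell2_inner_cnj[symmetric], subst ell2_inner_delta)
      (auto simp: r_def)
  ultimately show ?thesis by blast
qed

text \<open>The conjugate transpose has the conjugate form with the two vectors exchanged, so it
  satisfies the same bound.\<close>

lemma adjoint_exists:
  assumes "T \<in> bounded_ops I"
  shows "\<exists>S\<in>bounded_ops I. op_norm I S \<le> op_norm I T \<and> (\<forall>x\<in>I. \<forall>y\<in>I. S (delta y) x = cnj (T (delta x) y))"
proof (rule bounded_form_rep)
  show "op_norm I T \<ge> 0" by (rule op_norm_nonneg[OF assms])
  fix A f g assume A: "finite A" "A \<subseteq> I"
  have "(\<Sum>x\<in>A. \<Sum>y\<in>A. cnj (T (delta x) y) * f y * cnj (g x))
      = cnj (\<Sum>y\<in>A. \<Sum>x\<in>A. T (delta x) y * g x * cnj (f y))"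
    by (subst sum.swap) (simp add: mult.commute mult.left_commute)
  then show "cmod (\<Sum>x\<in>A. \<Sum>y\<in>A. cnj (T (delta x) y) * f y * cnj (g x)) \<le> op_norm I T * fin_norm A f * fin_norm A g"
    using op_form_bound[OF assms A, of g f] by (simp only: complex_mod_cnj ac_simps)
qed

text \<open>Both sides are bounded functionals of \<open>f\<close>, which reduces \<open>f\<close>
  to a basis vector; a second reduction, now for \<open>g\<close>, leaves the relation between the
  entries.\<close>

lemma adjoint_inner:
  assumes T: "T \<in> bounded_ops I" and S: "S \<in> bounded_ops I"
    and m: "\<And>x y. x \<in> I \<Longrightarrow> y \<in> I \<Longrightarrow> S (delta y) x = cnj (T (delta x) y)"
    and f: "f \<in> ell2 I" and g: "g \<in> ell2 I"
  shows "ell2_inner I (T f) g = ell2_inner I f (S g)"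
proof (rule functional_eqI[OF functional_op_inner[OF T g] functional_inner f])
  show "S g \<in> ell2 I" by (rule bounded_opsD(1)[OF S g])
  fix i assume i: "i \<in> I"
  have "S g i = ell2_inner I g (T (delta i))"
  proof (rule functional_eqI[OF functional_op_coord[OF S] functional_inner g])
    show "T (delta i) \<in> ell2 I" by (rule bounded_opsD(1)[OF T delta_ell2[OF i]])
    fix j assume j: "j \<in> I"
    show "S (delta j) i = ell2_inner I (delta j) (T (delta i))"
      by (subst ell2_inner_cnj[symmetric]) (use i j in \<open>simp add: ell2_inner_delta m\<close>)
  qed
  then have "cnj (S g i) = ell2_inner I (T (delta i)) g" by (simp add: ell2_inner_cnj)
  moreover have "ell2_inner I (delta i) (S g) = cnj (S g i)"
    by (subst ell2_inner_cnj[symmetric]) (use i in \<open>simp add: ell2_inner_delta\<close>)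
  ultimately show "ell2_inner I (T (delta i)) g = ell2_inner I (delta i) (S g)" by simp
qed

text \<open>\<open>op_adjoint\<close> is a definite description. The conjugate transpose is a
  witness, and inner products of basis vectors determine all entries of any other.\<close>

lemma
  assumes "T \<in> bounded_ops I"
  shows op_adjoint_bounded: "op_adjoint I T \<in> bounded_ops I"
    and op_adjoint_inner: "f \<in> ell2 I \<Longrightarrow> g \<in> ell2 I \<Longrightarrow> ell2_inner I (T f) g = ell2_inner I f (op_adjoint I T g)"
    and op_adjoint_entry: "x \<in> I \<Longrightarrow> y \<in> I \<Longrightarrow> op_adjoint I T (delta y) x = cnj (T (delta x) y)"
    and op_adjoint_norm: "op_norm I (op_adjoint I T) \<le> op_norm I T"
proof -
  obtain S where S: "S \<in> bounded_ops I" "op_norm I S \<le> op_norm I T"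
    "\<And>x y. x \<in> I \<Longrightarrow> y \<in> I \<Longrightarrow> S (delta y) x = cnj (T (delta x) y)"
    using adjoint_exists[OF assms] by blast
  have inner: "ell2_inner I (T f) g = ell2_inner I f (S g)" if "f \<in> ell2 I" "g \<in> ell2 I" for f g
    by (rule adjoint_inner[OF assms S(1,3) that])
  have "op_adjoint I T = S"
    unfolding op_adjoint_def
  proof (rule the_equality)
    show "S \<in> bounded_ops I \<and> (\<forall>f\<in>ell2 I. \<forall>g\<in>ell2 I. ell2_inner I (T f) g = ell2_inner I f (S g))"
      using S inner by blast
    fix S' assume S': "S' \<in> bounded_ops I \<and> (\<forall>f\<in>ell2 I. \<forall>g\<in>ell2 I. ell2_inner I (T f) g = ell2_inner I f (S' g))"
    show "S' = S"
    proof (rule op_eqI)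
      fix x y assume xy: "x \<in> I" "y \<in> I"
      then have "ell2_inner I (delta x) (S' (delta y)) = ell2_inner I (delta x) (S (delta y))"
        using S' inner by (metis delta_ell2)
      then have "cnj (ell2_inner I (delta x) (S' (delta y))) = cnj (ell2_inner I (delta x) (S (delta y)))"
        by simp
      then show "S' (delta y) x = S (delta y) x"
        using xy by (simp add: ell2_inner_cnj ell2_inner_delta)
    qed (use S S' in auto)
  qed
  then show "op_adjoint I T \<in> bounded_ops I" "op_norm I (op_adjoint I T) \<le> op_norm I T"
    "f \<in> ell2 I \<Longrightarrow> g \<in> ell2 I \<Longrightarrow> ell2_inner I (T f) g = ell2_inner I f (op_adjoint I T g)"
    "x \<in> I \<Longrightarrow> y \<in> I \<Longrightarrow> op_adjoint I T (delta y) x = cnj (T (delta x) y)"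
    by (simp_all only: S inner)
qed

section \<open>Sums, products and translations of bounded operators\<close>

lemma
  assumes "T \<in> bounded_ops I" "S \<in> bounded_ops I"
  shows compose_bounded: "compose (ell2 I) T S \<in> bounded_ops I"
    and compose_op_norm: "op_norm I (compose (ell2 I) T S) \<le> op_norm I T * op_norm I S"
proof -
  have b: "ell2_norm I (compose (ell2 I) T S f) \<le> op_norm I T * op_norm I S * ell2_norm I f" if f: "f \<in> ell2 I" for f
  proof -
    have "ell2_norm I (T (S f)) \<le> op_norm I T * ell2_norm I (S f)"
      by (rule op_norm_bound[OF assms(1) bounded_opsD(1)[OF assms(2) f]])
    also have "\<dots> \<le> op_norm I T * (op_norm I S * ell2_norm I f)"
      using assms f by (intro mult_left_mono op_norm_bound op_norm_nonneg)
    finally show ?thesis using f by (simp add: compose_def mult.assoc)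
  qed
  show "compose (ell2 I) T S \<in> bounded_ops I"
    by (rule bounded_opsI[OF _ _ _ _ b])
      (use bounded_opsD(1-3)[OF assms(1)] bounded_opsD(1-3)[OF assms(2)] in \<open>auto simp: compose_def extensional_def ell2_add ell2_scale\<close>)
  show "op_norm I (compose (ell2 I) T S) \<le> op_norm I T * op_norm I S"
    using assms by (intro op_norm_le[OF _ b]) (auto intro!: op_norm_nonneg mult_nonneg_nonneg)
qed

lemma
  assumes "T \<in> bounded_ops I" "S \<in> bounded_ops I"
  shows add_bounded: "(\<lambda>f\<in>ell2 I. \<lambda>i. T f i + S f i) \<in> bounded_ops I"
    and add_op_norm: "op_norm I (\<lambda>f\<in>ell2 I. \<lambda>i. T f i + S f i) \<le> op_norm I T + op_norm I S"
proof -
  have b: "ell2_norm I ((\<lambda>f\<in>ell2 I. \<lambda>i. T f i + S f i) f) \<le> (op_norm I T + op_norm I S) * ell2_norm I f"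
    if f: "f \<in> ell2 I" for f
    using ell2_norm_triangle[OF bounded_opsD(1)[OF assms(1) f] bounded_opsD(1)[OF assms(2) f]]
      op_norm_bound[OF assms(1) f] op_norm_bound[OF assms(2) f] f by (simp add: ring_distribs)
  show "(\<lambda>f\<in>ell2 I. \<lambda>i. T f i + S f i) \<in> bounded_ops I"
    by (rule bounded_opsI[OF _ _ _ _ b])
      (use bounded_opsD(1-3)[OF assms(1)] bounded_opsD(1-3)[OF assms(2)] in
        \<open>auto simp: extensional_def ell2_add ell2_scale ring_distribs fun_eq_iff\<close>)
  show "op_norm I (\<lambda>f\<in>ell2 I. \<lambda>i. T f i + S f i) \<le> op_norm I T + op_norm I S"
    using assms by (intro op_norm_le[OF _ b]) (auto intro: op_norm_nonneg add_nonneg_nonneg)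
qed

lemma
  assumes "T \<in> bounded_ops I"
  shows smult_bounded: "(\<lambda>f\<in>ell2 I. \<lambda>i. c * T f i) \<in> bounded_ops I"
    and smult_op_norm: "op_norm I (\<lambda>f\<in>ell2 I. \<lambda>i. c * T f i) \<le> cmod c * op_norm I T"
proof -
  have b: "ell2_norm I ((\<lambda>f\<in>ell2 I. \<lambda>i. c * T f i) f) \<le> (cmod c * op_norm I T) * ell2_norm I f"
    if f: "f \<in> ell2 I" for f
    using op_norm_bound[OF assms(1) f] f by (simp add: ell2_norm_scale mult_left_mono mult.assoc)
  show "(\<lambda>f\<in>ell2 I. \<lambda>i. c * T f i) \<in> bounded_ops I"
    by (rule bounded_opsI[OF _ _ _ _ b])
      (use bounded_opsD(1-3)[OF assms(1)] in \<open>auto simp: extensional_def ell2_add ell2_scale ring_distribs fun_eq_iff\<close>)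
  show "op_norm I (\<lambda>f\<in>ell2 I. \<lambda>i. c * T f i) \<le> cmod c * op_norm I T"
    using assms by (intro op_norm_le[OF _ b]) (auto intro!: op_norm_nonneg mult_nonneg_nonneg)
qed

lemma zero_bounded: "(\<lambda>f\<in>ell2 I. \<lambda>i. 0) \<in> bounded_ops I"
  by (rule bounded_opsI[where C = 0]) (auto simp: ell2_add ell2_scale)

lemma one_bounded: "(\<lambda>f\<in>ell2 I. f) \<in> bounded_ops I"
  by (rule bounded_opsI[where C = 1]) (auto simp: ell2_add ell2_scale)

text \<open>Serves both the left translations and the right translations that commute with
  them.\<close>

lemma reindex_bounded:
  assumes "bij_betw p I I"
  shows "(\<lambda>f\<in>ell2 I. \<lambda>x. if x \<in> I then f (p x) else 0) \<in> bounded_ops I"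
    and "op_norm I (\<lambda>f\<in>ell2 I. \<lambda>x. if x \<in> I then f (p x) else 0) \<le> 1"
proof -
  have b: "(\<lambda>x. if x \<in> I then f (p x) else 0) \<in> ell2 I"
    "ell2_norm I (\<lambda>x. if x \<in> I then f (p x) else 0) \<le> ell2_norm I f" if f: "f \<in> ell2 I" for f
  proof -
    have "fin_norm F (\<lambda>x. if x \<in> I then f (p x) else 0) \<le> ell2_norm I f" if F: "finite F" "F \<subseteq> I" for F
    proof -
      have inj: "inj_on p F" using assms F(2) by (auto simp: bij_betw_def intro: inj_on_subset)
      have "fin_norm F (\<lambda>x. if x \<in> I then f (p x) else 0) = fin_norm (p ` F) f"
        unfolding L2_set_def sum.reindex[OF inj] using F by (intro arg_cong[of _ _ sqrt] sum.cong) auto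
      also have "\<dots> \<le> ell2_norm I f"
        using assms F by (intro fin_norm_le_ell2_norm f) (auto simp: bij_betw_def)
      finally show ?thesis .
    qed
    from ell2_boundI[OF _ this] show "(\<lambda>x. if x \<in> I then f (p x) else 0) \<in> ell2 I"
      "ell2_norm I (\<lambda>x. if x \<in> I then f (p x) else 0) \<le> ell2_norm I f" by auto
  qed
  show "(\<lambda>f\<in>ell2 I. \<lambda>x. if x \<in> I then f (p x) else 0) \<in> bounded_ops I"
    by (rule bounded_opsI[where C = 1])
      (use b in \<open>auto simp: extensional_def ell2_add ell2_scale fun_eq_iff\<close>)
  show "op_norm I (\<lambda>f\<in>ell2 I. \<lambda>x. if x \<in> I then f (p x) else 0) \<le> 1"
    using b by (intro op_norm_le) auto
qed

lemma truncation_bounded: "(\<lambda>f\<in>ell2 I. truncated J f) \<in> bounded_ops I"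
  by (rule bounded_opsI[where C = 1])
    (auto simp: extensional_def ell2_add ell2_scale truncate_ell2 truncate_norm_le fun_eq_iff)

section \<open>Commutants\<close>

lemma commutant_iff:
  assumes "A \<subseteq> bounded_ops I"
  shows "T \<in> commutant I A \<longleftrightarrow> T \<in> bounded_ops I \<and> (\<forall>S\<in>A. \<forall>f\<in>ell2 I. T (S f) = S (T f))"
proof -
  have "compose (ell2 I) T S = compose (ell2 I) S T \<longleftrightarrow> (\<forall>f\<in>ell2 I. T (S f) = S (T f))" for S
    by (auto simp: compose_def restrict_def fun_eq_iff)
  then show ?thesis by (auto simp: commutant_def)
qed

lemma commutant_subset: "commutant I A \<subseteq> bounded_ops I"
  by (auto simp: commutant_def)

lemma
  assumes "A \<subseteq> bounded_ops I"
  shows commutant_one: "(\<lambda>f\<in>ell2 I. f) \<in> commutant I A"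
    and commutant_zero: "(\<lambda>f\<in>ell2 I. \<lambda>i. 0) \<in> commutant I A"
    and commutant_mult: "T \<in> commutant I A \<Longrightarrow> S \<in> commutant I A \<Longrightarrow> compose (ell2 I) T S \<in> commutant I A"
    and commutant_add: "T \<in> commutant I A \<Longrightarrow> S \<in> commutant I A \<Longrightarrow>
      (\<lambda>f\<in>ell2 I. \<lambda>i. T f i + S f i) \<in> commutant I A"
    and commutant_smult: "T \<in> commutant I A \<Longrightarrow> (\<lambda>f\<in>ell2 I. \<lambda>i. c * T f i) \<in> commutant I A"
proof -
  have A: "S f \<in> ell2 I" "S (\<lambda>i. f i + g i) = (\<lambda>i. S f i + S g i)" "S (\<lambda>i. c * f i) = (\<lambda>i. c * S f i)"
    if "S \<in> A" "f \<in> ell2 I" "g \<in> ell2 I" for S f g c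
    using that assms bounded_opsD(1-3)[of S I] by auto
  have z: "S (\<lambda>i. 0) = (\<lambda>i. 0)" if "S \<in> A" for S
    using A(3)[OF that ell2_zero ell2_zero, of 0] by simp
  show "(\<lambda>f\<in>ell2 I. f) \<in> commutant I A"
    using A by (auto simp: commutant_iff[OF assms] one_bounded)
  show "(\<lambda>f\<in>ell2 I. \<lambda>i. 0) \<in> commutant I A"
    using A z by (auto simp: commutant_iff[OF assms] zero_bounded)
  assume T: "T \<in> commutant I A"
  then have T': "T \<in> bounded_ops I" "\<And>S f. S \<in> A \<Longrightarrow> f \<in> ell2 I \<Longrightarrow> T (S f) = S (T f)"
    by (auto simp: commutant_iff[OF assms])
  show "(\<lambda>f\<in>ell2 I. \<lambda>i. c * T f i) \<in> commutant I A"
    using A T' bounded_opsD(1)[OF T'(1)] by (auto simp: commutant_iff[OF assms] smult_bounded)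
  assume S: "S \<in> commutant I A"
  then have S': "S \<in> bounded_ops I" "\<And>R f. R \<in> A \<Longrightarrow> f \<in> ell2 I \<Longrightarrow> S (R f) = R (S f)"
    by (auto simp: commutant_iff[OF assms])
  show "compose (ell2 I) T S \<in> commutant I A"
    using A T' S' bounded_opsD(1)[OF S'(1)]
    by (auto simp: commutant_iff[OF assms] compose_bounded compose_eq)
  show "(\<lambda>f\<in>ell2 I. \<lambda>i. T f i + S f i) \<in> commutant I A"
    using A T' S' bounded_opsD(1)[OF S'(1)] bounded_opsD(1)[OF T'(1)]
    by (auto simp: commutant_iff[OF assms] add_bounded)
qed

section \<open>Group von Neumann algebras\<close>

context group
begin

abbreviation I :: "'a set" where "I \<equiv> carrier G"
abbreviation LG :: "'a op tracial_algebra" where "LG \<equiv> group_vN G"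
abbreviation L :: "'a set \<Rightarrow> 'a op set" where "L \<equiv> group_vN_sub G"
text \<open>The Fourier coefficients of \<open>T\<close>, that is, its column at
  \<open>\<one>\<close>. They determine an element of L(G) (\<open>vN_eqI\<close>), and their ell2
  norm is its 2-norm (\<open>norm2_LG\<close>).\<close>

abbreviation coef :: "'a op \<Rightarrow> 'a \<Rightarrow> complex" where "coef T \<equiv> T (delta \<one>)"

lemma group_vN_simps:
  "carrier LG = L I" "mult LG = compose (ell2 I)" "one LG = (\<lambda>f\<in>ell2 I. f)"
  "zero LG = (\<lambda>f\<in>ell2 I. \<lambda>i. 0)" "add LG = (\<lambda>S T. \<lambda>f\<in>ell2 I. \<lambda>i. S f i + T f i)"
  "smult LG = (\<lambda>c T. \<lambda>f\<in>ell2 I. \<lambda>i. c * T f i)" "star LG = op_adjoint I" "opnorm LG = op_norm I"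
  "trc LG = (\<lambda>T. ell2_inner I (T (delta \<one>)) (delta \<one>))"
  by (simp_all add: group_vN_def Let_def)

lemma delta_one_ell2 [simp]: "delta \<one> \<in> ell2 I"
  by (simp add: delta_ell2)

lemma bij_betw_left_mult: "g \<in> I \<Longrightarrow> bij_betw (\<lambda>x. g \<otimes> x) I I"
  by (rule bij_betw_byWitness[of _ "\<lambda>x. inv g \<otimes> x"]) (auto simp: m_assoc[symmetric])

lemma bij_betw_right_mult: "g \<in> I \<Longrightarrow> bij_betw (\<lambda>x. x \<otimes> g) I I"
  by (rule bij_betw_byWitness[of _ "\<lambda>x. x \<otimes> inv g"]) (auto simp: m_assoc)

lemma left_regular_bounded: "g \<in> I \<Longrightarrow> left_regular G g \<in> bounded_ops I"
  and left_regular_norm: "g \<in> I \<Longrightarrow> op_norm I (left_regular G g) \<le> 1"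
  unfolding left_regular_def using reindex_bounded[OF bij_betw_left_mult[of "inv g"]] by auto

lemma left_regular_delta:
  assumes "g \<in> I" "y \<in> I"
  shows "left_regular G g (delta y) = delta (g \<otimes> y)"
proof
  fix x
  show "left_regular G g (delta y) x = delta (g \<otimes> y) x"
    using assms delta_ell2[of y I]
    by (auto simp: left_regular_def delta_def inv_solve_left inv_solve_left')
qed

lemma left_regular_apply: "f \<in> ell2 I \<Longrightarrow> x \<in> I \<Longrightarrow> left_regular G g f x = f (inv g \<otimes> x)"
  by (simp add: left_regular_def)

lemma regular_subset: "H \<subseteq> I \<Longrightarrow> left_regular G ` H \<subseteq> bounded_ops I"
  using left_regular_bounded by auto

text \<open>Turns the condition on entries that the index \<open>x y^-1\<close> lies in
  \<open>H\<close> into a block structure, as \<open>block_diagonal_form_bound\<close>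
  requires.\<close>

lemma coset_iff:
  assumes "subgroup H G" "x \<in> I" "y \<in> I"
  shows "x \<otimes> inv y \<in> H \<longleftrightarrow> H #> x = H #> y"
proof
  assume h: "x \<otimes> inv y \<in> H"
  have "x = x \<otimes> inv y \<otimes> y" using assms by (simp add: m_assoc)
  then have "x \<in> H #> y" using h unfolding r_coset_def by blast
  then show "H #> x = H #> y" using repr_independence[OF _ assms(3,1)] by simp
next
  assume "H #> x = H #> y"
  then have "x \<in> H #> y" using rcos_self[OF assms(2,1)] by simp
  then obtain h where h: "h \<in> H" "x = h \<otimes> y" unfolding r_coset_def by blast
  then have "h \<in> I" using assms(1) subgroup.mem_carrier by metis
  then have "x \<otimes> inv y = h" using h assms by (simp add: m_assoc)
  then show "x \<otimes> inv y \<in> H" using h by simp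
qed

text \<open>The entry of \<open>T\<close> at \<open>(x, y)\<close> is \<open>T (delta y) x\<close>.\<close>

lemma group_vN_sub_iff:
  assumes H: "subgroup H G"
  shows "T \<in> L H \<longleftrightarrow> T \<in> bounded_ops I \<and>
    (\<forall>x\<in>I. \<forall>y\<in>I. T (delta y) x = coef T (x \<otimes> inv y)) \<and> (\<forall>x\<in>I - H. coef T x = 0)"
proof -
  interpret H: subgroup H G by fact
  have HI: "H \<subseteq> I" by (rule H.subset)
  let ?C = "commutant I (left_regular G ` H)"
  note C_iff = commutant_iff[OF regular_subset[OF HI]]
  have "?C \<subseteq> bounded_ops I" by (rule commutant_subset)
  note L_iff = commutant_iff[OF this, folded group_vN_sub_def]
  show ?thesis
  proof
    assume T: "T \<in> L H"
    then have Tb: "T \<in> bounded_ops I" and com: "\<And>S f. S \<in> ?C \<Longrightarrow> f \<in> ell2 I \<Longrightarrow> T (S f) = S (T f)"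
      unfolding L_iff by auto
    have ent: "T (delta y) x = coef T (x \<otimes> inv y)" if xy: "x \<in> I" "y \<in> I" for x y
    proof -
      \<comment> \<open>A right translation commutes with the left regular representation and moves
        \<open>delta \<one>\<close> to \<open>delta y\<close>, so commuting with it expresses the
        column at \<open>y\<close> through the column at \<open>\<one>\<close>.\<close>
      define R where "R = (\<lambda>f\<in>ell2 I. \<lambda>x. if x \<in> I then f (x \<otimes> inv y) else 0)"
      have "R \<in> ?C"
        unfolding C_iff
      proof (intro conjI ballI)
        show Rb: "R \<in> bounded_ops I"
          unfolding R_def using xy by (intro reindex_bounded bij_betw_right_mult) auto
        fix S f assume "S \<in> left_regular G ` H" and f: "f \<in> ell2 I"
        then obtain h where h: "h \<in> H" "h \<in> I" and S: "S = left_regular G h" using HI by auto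
        have "S f \<in> ell2 I" unfolding S by (rule bounded_opsD(1)[OF left_regular_bounded[OF h(2)] f])
        moreover have "R f \<in> ell2 I" by (rule bounded_opsD(1)[OF Rb f])
        ultimately show "R (S f) = S (R f)"
          unfolding S using xy h f by (auto simp: R_def left_regular_def m_assoc fun_eq_iff)
      qed
      then have "T (R (delta \<one>)) = R (coef T)" using com by simp
      moreover have "R (delta \<one>) = delta y"
        using xy by (simp add: R_def) (auto simp: fun_eq_iff delta_def inv_solve_right')
      moreover have "coef T \<in> ell2 I" by (rule bounded_opsD(1)[OF Tb delta_one_ell2])
      ultimately show ?thesis using xy by (simp add: R_def)
    qed
    have supp: "coef T x = 0" if "x \<in> I - H" for x
    proof -
      \<comment> \<open>The projection onto the functions supported in \<open>H\<close> commutes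
        with left translations by \<open>H\<close> and fixes \<open>delta \<one>\<close>; hence
        \<open>T\<close> maps \<open>delta \<one>\<close> into its range.\<close>
      define P where "P = (\<lambda>f\<in>ell2 I. truncated H f)"
      have "P \<in> ?C"
        unfolding C_iff
      proof (intro conjI ballI)
        show Pb: "P \<in> bounded_ops I" unfolding P_def by (rule truncation_bounded)
        fix S f assume "S \<in> left_regular G ` H" and f: "f \<in> ell2 I"
        then obtain h where h: "h \<in> H" "h \<in> I" and S: "S = left_regular G h" using HI by auto
        have "S f \<in> ell2 I" unfolding S by (rule bounded_opsD(1)[OF left_regular_bounded[OF h(2)] f])
        moreover have "P f \<in> ell2 I" by (rule bounded_opsD(1)[OF Pb f])
        moreover have "inv h \<otimes> z \<in> H \<longleftrightarrow> z \<in> H" if "z \<in> I" for z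
          using H.m_closed[OF h(1), of "inv h \<otimes> z"] H.m_closed[OF H.m_inv_closed[OF h(1)], of z] that h(2)
          by (auto simp: m_assoc[symmetric])
        moreover have "z \<in> H \<Longrightarrow> z \<in> I" for z using HI by auto
        ultimately show "P (S f) = S (P f)"
          unfolding S using f by (auto simp: P_def left_regular_def fun_eq_iff)
      qed
      then have "T (P (delta \<one>)) = P (coef T)" using com by simp
      moreover have "P (delta \<one>) = delta \<one>"
        by (simp add: P_def) (auto simp: fun_eq_iff delta_def)
      moreover have "coef T \<in> ell2 I" by (rule bounded_opsD(1)[OF Tb delta_one_ell2])
      ultimately have "coef T = truncated H (coef T)" by (simp add: P_def)
      from fun_cong[OF this, of x] show ?thesis using that by simp
    qed
    show "T \<in> bounded_ops I \<and> (\<forall>x\<in>I. \<forall>y\<in>I. T (delta y) x = coef T (x \<otimes> inv y)) \<and> (\<forall>x\<in>I - H. coef T x = 0)"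
      using Tb ent supp by blast
  next
    assume "T \<in> bounded_ops I \<and> (\<forall>x\<in>I. \<forall>y\<in>I. T (delta y) x = coef T (x \<otimes> inv y)) \<and> (\<forall>x\<in>I - H. coef T x = 0)"
    then have Tb: "T \<in> bounded_ops I" and ent: "\<And>x y. x \<in> I \<Longrightarrow> y \<in> I \<Longrightarrow> T (delta y) x = coef T (x \<otimes> inv y)"
      and supp: "\<And>x. x \<in> I \<Longrightarrow> x \<notin> H \<Longrightarrow> coef T x = 0" by blast+
    show "T \<in> L H"
      unfolding L_iff
    proof (intro conjI ballI Tb)
      fix S f assume "S \<in> ?C" and f: "f \<in> ell2 I"
      then have Sb: "S \<in> bounded_ops I" and com: "\<And>R f. R \<in> left_regular G ` H \<Longrightarrow> f \<in> ell2 I \<Longrightarrow> S (R f) = R (S f)"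
        unfolding C_iff by auto
      have inv_S: "S (delta (h \<otimes> y)) x = S (delta y) (inv h \<otimes> x)" if "h \<in> H" "x \<in> I" "y \<in> I" for h x y
      proof -
        have h: "h \<in> I" using that HI by auto
        have "S (delta (h \<otimes> y)) = left_regular G h (S (delta y))"
          using com[of "left_regular G h" "delta y"] left_regular_delta[OF h that(3)] that by (simp add: delta_ell2)
        moreover have "S (delta y) \<in> ell2 I" by (rule bounded_opsD(1)[OF Sb delta_ell2[OF that(3)]])
        ultimately show ?thesis using that by (simp add: left_regular_apply)
      qed
      \<comment> \<open>Commuting with a given \<open>S\<close> in the commutant is checked on
        entries, where both products are sums over \<open>z\<close>.\<close>
      have "compose (ell2 I) T S = compose (ell2 I) S T"
      proof (rule op_eqI[OF compose_bounded[OF Tb Sb] compose_bounded[OF Sb Tb]])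
        fix x y assume xy: "x \<in> I" "y \<in> I"
        have d: "delta y \<in> ell2 I" using xy by (simp add: delta_ell2)
        have 1: "((\<lambda>z. S (delta y) z * T (delta z) x) has_sum T (S (delta y)) x) I"
          by (rule op_has_sum[OF Tb bounded_opsD(1)[OF Sb d]])
        have 2: "((\<lambda>z. T (delta y) z * S (delta z) x) has_sum S (T (delta y)) x) I"
          by (rule op_has_sum[OF Sb bounded_opsD(1)[OF Tb d]])
        \<comment> \<open>The substitution that matches the two sums term by term: the entries of
          \<open>T\<close> agree because \<open>?p z \<otimes> inv y = x \<otimes> inv z\<close>. If
          this element lies in \<open>H\<close>, the left invariance of \<open>S\<close> equates the
          other factors; otherwise both terms vanish.\<close>
        let ?p = "\<lambda>z. x \<otimes> inv z \<otimes> y"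
        have p: "bij_betw ?p I I"
        proof (rule bij_betw_byWitness[of _ "\<lambda>w. y \<otimes> inv w \<otimes> x"])
          show "\<forall>a\<in>I. y \<otimes> inv (x \<otimes> inv a \<otimes> y) \<otimes> x = a"
            using xy by (auto simp: inv_mult_group m_assoc[symmetric]) (simp add: m_assoc)
          show "\<forall>a\<in>I. x \<otimes> inv (y \<otimes> inv a \<otimes> x) \<otimes> y = a"
            using xy by (auto simp: inv_mult_group m_assoc[symmetric]) (simp add: m_assoc)
        qed (use xy in auto)
        have "((\<lambda>z. T (delta y) (?p z) * S (delta (?p z)) x) has_sum S (T (delta y)) x) I"
          using 2 by (subst has_sum_reindex_bij_betw[OF p])
        moreover have "T (delta y) (?p z) * S (delta (?p z)) x = S (delta y) z * T (delta z) x" if z: "z \<in> I" for z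
        proof -
          have e: "?p z \<otimes> inv y = x \<otimes> inv z" "inv (x \<otimes> inv z) \<otimes> x = z"
            using xy z by (auto simp: m_assoc inv_mult_group)
          have t: "T (delta y) (?p z) = coef T (x \<otimes> inv z)" "T (delta z) x = coef T (x \<otimes> inv z)"
            using ent[of "?p z" y] ent[of x z] xy z e by auto
          show ?thesis
          proof (cases "x \<otimes> inv z \<in> H")
            case True
            then show ?thesis using inv_S[OF True xy] t e by simp
          next
            case False
            then show ?thesis using supp[of "x \<otimes> inv z"] t xy z by simp
          qed
        qed
        ultimately have "((\<lambda>z. S (delta y) z * T (delta z) x) has_sum S (T (delta y)) x) I"
          by (simp cong: has_sum_cong)
        with 1 have "T (S (delta y)) x = S (T (delta y)) x" by (rule has_sum_unique)
        then show "compose (ell2 I) T S (delta y) x = compose (ell2 I) S T (delta y) x"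
          using d by (simp add: compose_eq)
      qed
      then show "T (S f) = S (T f)" using f by (metis compose_eq)
    qed
  qed
qed

section \<open>Operations, trace and 2-norm of L(G)\<close>

lemma vN_bounded: "T \<in> L H \<Longrightarrow> T \<in> bounded_ops I"
  unfolding group_vN_sub_def using commutant_subset by blast

lemma vN_entry: "subgroup H G \<Longrightarrow> T \<in> L H \<Longrightarrow> x \<in> I \<Longrightarrow> y \<in> I \<Longrightarrow> T (delta y) x = coef T (x \<otimes> inv y)"
  using group_vN_sub_iff by blast

lemma vN_support: "subgroup H G \<Longrightarrow> T \<in> L H \<Longrightarrow> x \<notin> H \<Longrightarrow> coef T x = 0"
  using group_vN_sub_iff[of H T] ell2_outside[OF bounded_opsD(1)[OF vN_bounded delta_one_ell2]] by blast

lemma vN_mono: "subgroup H G \<Longrightarrow> L H \<subseteq> L I"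
  using group_vN_sub_iff[of H] group_vN_sub_iff[OF subgroup_self] by blast

lemma coef_ell2: "T \<in> L H \<Longrightarrow> coef T \<in> ell2 I"
  using bounded_opsD(1)[OF vN_bounded delta_one_ell2] .

lemma vN_eqI:
  assumes "T \<in> L I" "S \<in> L I" "\<And>x. x \<in> I \<Longrightarrow> coef T x = coef S x"
  shows "T = S"
proof (rule op_eqI[OF vN_bounded[OF assms(1)] vN_bounded[OF assms(2)]])
  fix x y assume "x \<in> I" "y \<in> I"
  then show "T (delta y) x = S (delta y) x"
    using vN_entry[OF subgroup_self assms(1), of x y] vN_entry[OF subgroup_self assms(2), of x y]
      assms(3)[of "x \<otimes> inv y"] by (metis inv_closed m_closed)
qed

lemma
  assumes "H \<subseteq> I"
  shows vN_one: "\<one>\<^bsub>LG\<^esub> \<in> L H" and vN_zero: "\<zero>\<^bsub>LG\<^esub> \<in> L H"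
    and vN_mult: "T \<in> L H \<Longrightarrow> S \<in> L H \<Longrightarrow> T \<otimes>\<^bsub>LG\<^esub> S \<in> L H"
    and vN_add: "T \<in> L H \<Longrightarrow> S \<in> L H \<Longrightarrow> T \<oplus>\<^bsub>LG\<^esub> S \<in> L H"
    and vN_smult: "T \<in> L H \<Longrightarrow> c \<odot>\<^bsub>LG\<^esub> T \<in> L H"
  unfolding group_vN_simps group_vN_sub_def
  using commutant_one[OF commutant_subset] commutant_zero[OF commutant_subset]
    commutant_mult[OF commutant_subset] commutant_add[OF commutant_subset]
    commutant_smult[OF commutant_subset] by auto

text \<open>Read off from the matrix: conjugate transposition replaces the coefficient at
  \<open>x y^-1\<close> by the conjugate of the one at its inverse, and \<open>H\<close> is closed
  under inverses.\<close>

lemma vN_star: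
  assumes H: "subgroup H G" and T: "T \<in> L H"
  shows "star LG T \<in> L H"
proof -
  interpret H: subgroup H G by fact
  have Tb: "T \<in> bounded_ops I" using T by (rule vN_bounded)
  have c: "op_adjoint I T (delta y) x = cnj (coef T (y \<otimes> inv x))" if "x \<in> I" "y \<in> I" for x y
    using op_adjoint_entry[OF Tb that] vN_entry[OF H T that(2,1)] by simp
  show ?thesis
    unfolding group_vN_simps group_vN_sub_iff[OF H]
  proof (intro conjI ballI)
    show "op_adjoint I T \<in> bounded_ops I" by (rule op_adjoint_bounded[OF Tb])
    fix x y assume "x \<in> I" "y \<in> I"
    then show "op_adjoint I T (delta y) x = coef (op_adjoint I T) (x \<otimes> inv y)"
      by (simp add: c inv_mult_group)
  next
    fix x assume x: "x \<in> I - H"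
    then have "inv x \<notin> H" using H.m_inv_closed by fastforce
    then show "coef (op_adjoint I T) x = 0" using x vN_support[OF H T] by (simp add: c)
  qed
qed

lemma coef_star: "T \<in> L H \<Longrightarrow> x \<in> I \<Longrightarrow> subgroup H G \<Longrightarrow> coef (star LG T) x = cnj (coef T (inv x))"
  unfolding group_vN_simps using op_adjoint_entry[OF vN_bounded, of T H x \<one>] vN_entry[of H T \<one> x] by simp

lemma vN_apply:
  assumes "f \<in> ell2 I"
  shows "(T \<otimes>\<^bsub>LG\<^esub> S) f = T (S f)" "(T \<oplus>\<^bsub>LG\<^esub> S) f = (\<lambda>x. T f x + S f x)"
    "(c \<odot>\<^bsub>LG\<^esub> T) f = (\<lambda>x. c * T f x)" "\<one>\<^bsub>LG\<^esub> f = f" "\<zero>\<^bsub>LG\<^esub> f = (\<lambda>x. 0)"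
  using assms by (simp_all add: group_vN_simps compose_eq)

lemma LG_eqI: "T \<in> L I \<Longrightarrow> S \<in> L I \<Longrightarrow> (\<And>f. f \<in> ell2 I \<Longrightarrow> T f = S f) \<Longrightarrow> T = S"
  using op_ext vN_bounded by blast

lemma ring_LG: "ring LG"
proof -
  note cl = vN_one[OF order_refl] vN_zero[OF order_refl] vN_mult[OF order_refl] vN_add[OF order_refl] vN_smult[OF order_refl]
  have ap: "f \<in> ell2 I \<Longrightarrow> T f \<in> ell2 I" if "T \<in> L I" for T f using bounded_opsD(1)[OF vN_bounded[OF that]] .
  have add: "T (\<lambda>x. f x + g x) = (\<lambda>x. T f x + T g x)" if "T \<in> L I" "f \<in> ell2 I" "g \<in> ell2 I" for T f g
    using bounded_opsD(2)[OF vN_bounded[OF that(1)]] that by auto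
  show ?thesis
  proof (rule ringI)
    show "abelian_group LG"
    proof (rule abelian_groupI)
      fix T assume T: "T \<in> carrier LG"
      show "\<exists>S\<in>carrier LG. S \<oplus>\<^bsub>LG\<^esub> T = \<zero>\<^bsub>LG\<^esub>"
        using T by (intro bexI[of _ "(-1) \<odot>\<^bsub>LG\<^esub> T"] LG_eqI) (auto simp: group_vN_simps(1) cl vN_apply)
    qed (auto simp: group_vN_simps(1) cl intro!: LG_eqI simp: vN_apply ac_simps)
    show "monoid LG"
      by (rule monoidI) (auto simp: group_vN_simps(1) cl intro!: LG_eqI simp: vN_apply ap)
  qed (auto simp: group_vN_simps(1) cl intro!: LG_eqI simp: vN_apply ap add)
qed

lemma trc_star_mult:
  assumes "T \<in> L I"
  shows "trc LG (star LG T \<otimes>\<^bsub>LG\<^esub> T) = of_real ((ell2_norm I (coef T))\<^sup>2)"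
proof -
  have c: "coef T \<in> ell2 I" using assms by (rule coef_ell2)
  have "trc LG (star LG T \<otimes>\<^bsub>LG\<^esub> T) = cnj (ell2_inner I (delta \<one>) (op_adjoint I T (coef T)))"
    by (simp add: group_vN_simps compose_eq ell2_inner_cnj)
  also have "\<dots> = ell2_inner I (coef T) (coef T)"
    unfolding op_adjoint_inner[OF vN_bounded[OF assms] delta_one_ell2 c, symmetric] by (rule ell2_inner_cnj)
  finally show ?thesis using c by (simp add: ell2_inner_self)
qed

lemma norm2_LG: "T \<in> L I \<Longrightarrow> norm2 LG T = ell2_norm I (coef T)"
  unfolding norm2_def trc_star_mult by simp

lemma trc_LG: "trc LG T = coef T \<one>"
  by (simp add: group_vN_simps ell2_inner_delta)

lemma opnorm_LG: "opnorm LG = op_norm I"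
  by (simp add: group_vN_simps)

lemma cmod_coef_le_norm2: "T \<in> L I \<Longrightarrow> cmod (coef T x) \<le> norm2 LG T"
  by (simp add: norm2_LG cmod_le_ell2_norm[OF coef_ell2])

lemma cmod_coef_le_opnorm: "T \<in> L H \<Longrightarrow> cmod (coef T x) \<le> op_norm I T"
  using cmod_le_ell2_norm[OF coef_ell2, of T H x] op_norm_bound[OF vN_bounded delta_one_ell2, of T H]
  by (simp add: ell2_norm_delta)

lemma norm2_nonneg: "T \<in> L I \<Longrightarrow> norm2 LG T \<ge> 0"
  by (simp add: norm2_LG)

lemma norm2_add: "T \<in> L I \<Longrightarrow> S \<in> L I \<Longrightarrow> norm2 LG (T \<oplus>\<^bsub>LG\<^esub> S) \<le> norm2 LG T + norm2 LG S"
  by (simp add: norm2_LG vN_add vN_apply ell2_norm_triangle coef_ell2)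

lemma norm2_smult: "T \<in> L I \<Longrightarrow> norm2 LG (c \<odot>\<^bsub>LG\<^esub> T) = cmod c * norm2 LG T"
  by (simp add: norm2_LG vN_smult vN_apply ell2_norm_scale)

lemma norm2_zero: "norm2 LG \<zero>\<^bsub>LG\<^esub> = 0"
  by (simp add: norm2_LG vN_zero vN_apply)

lemma norm2_mult_left:
  assumes "T \<in> L I" "S \<in> L I"
  shows "norm2 LG (T \<otimes>\<^bsub>LG\<^esub> S) \<le> opnorm LG T * norm2 LG S"
  using op_norm_bound[OF vN_bounded[OF assms(1)] coef_ell2[OF assms(2)]] assms
  by (simp add: norm2_LG vN_mult vN_apply opnorm_LG)

text \<open>This carries the trace property: up to conjugation, the adjoint permutes the
  coefficients by inversion.\<close>

lemma norm2_star:
  assumes "T \<in> L I"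
  shows "norm2 LG (star LG T) = norm2 LG T"
proof -
  have p: "bij_betw (\<lambda>x. inv x) I I" by (rule bij_betw_byWitness[of _ "\<lambda>x. inv x"]) auto
  have "(\<Sum>\<^sub>\<infinity>x\<in>I. (cmod (coef (star LG T) x))\<^sup>2) = (\<Sum>\<^sub>\<infinity>x\<in>I. (cmod (coef T (inv x)))\<^sup>2)"
    using assms by (intro infsum_cong) (simp add: coef_star[OF _ _ subgroup_self])
  also have "\<dots> = (\<Sum>\<^sub>\<infinity>x\<in>I. (cmod (coef T x))\<^sup>2)" by (rule infsum_reindex_bij_betw[OF p])
  finally show ?thesis using assms by (simp add: norm2_LG vN_star subgroup_self ell2_norm_def)
qed

lemma star_mult:
  assumes "T \<in> L I" "S \<in> L I"
  shows "star LG (T \<otimes>\<^bsub>LG\<^esub> S) = star LG S \<otimes>\<^bsub>LG\<^esub> star LG T"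
proof -
  note b = vN_bounded[OF assms(1)] vN_bounded[OF assms(2)]
  note bc = compose_bounded[OF b]
  note a = op_adjoint_bounded[OF b(1)] op_adjoint_bounded[OF b(2)]
  show ?thesis
    unfolding group_vN_simps
  proof (rule op_eqI[OF op_adjoint_bounded[OF bc] compose_bounded[OF a(2,1)]])
    fix x y assume xy: "x \<in> I" "y \<in> I"
    have d: "delta x \<in> ell2 I" "delta y \<in> ell2 I" using xy by (auto simp: delta_ell2)
    have "T (S (delta x)) y = ell2_inner I (T (S (delta x))) (delta y)" using xy by (simp add: ell2_inner_delta)
    also have "\<dots> = ell2_inner I (delta x) (op_adjoint I S (op_adjoint I T (delta y)))"
      using op_adjoint_inner[OF b(1) bounded_opsD(1)[OF b(2) d(1)] d(2)]
        op_adjoint_inner[OF b(2) d(1) bounded_opsD(1)[OF a(1) d(2)]] by simp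
    finally have "cnj (T (S (delta x)) y) = op_adjoint I S (op_adjoint I T (delta y)) x"
      using xy by (simp add: ell2_inner_cnj ell2_inner_delta)
    then show "op_adjoint I (compose (ell2 I) T S) (delta y) x
        = compose (ell2 I) (op_adjoint I S) (op_adjoint I T) (delta y) x"
      unfolding op_adjoint_entry[OF bc xy] using d by (simp add: compose_eq)
  qed
qed

lemma opnorm_star: "T \<in> L I \<Longrightarrow> opnorm LG (star LG T) \<le> opnorm LG T"
  by (simp add: group_vN_simps op_adjoint_norm vN_bounded)

lemma opnorm_nonneg: "T \<in> L H \<Longrightarrow> opnorm LG T \<ge> 0"
  by (simp add: group_vN_simps op_norm_nonneg vN_bounded)

text \<open>The adjoint preserves the 2-norm and turns right multiplication into left
  multiplication. Together with \<open>norm2_mult_left\<close> this makes the null sequences a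
  two-sided ideal.\<close>

lemma norm2_mult_right:
  assumes "T \<in> L I" "S \<in> L I"
  shows "norm2 LG (T \<otimes>\<^bsub>LG\<^esub> S) \<le> opnorm LG S * norm2 LG T"
proof -
  have st: "star LG T \<in> L I" "star LG S \<in> L I" using assms by (auto simp: vN_star subgroup_self)
  have "norm2 LG (T \<otimes>\<^bsub>LG\<^esub> S) = norm2 LG (star LG S \<otimes>\<^bsub>LG\<^esub> star LG T)"
    using norm2_star[OF vN_mult[OF order_refl assms]] star_mult[OF assms] by simp
  also have "\<dots> \<le> opnorm LG (star LG S) * norm2 LG (star LG T)" by (rule norm2_mult_left[OF st(2,1)])
  also have "\<dots> \<le> opnorm LG S * norm2 LG (star LG T)"
    using opnorm_star[OF assms(2)] norm2_nonneg[OF st(1)] by (rule mult_right_mono)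
  finally show ?thesis using norm2_star[OF assms(1)] by simp
qed

lemma opnorm_mult: "T \<in> L I \<Longrightarrow> S \<in> L I \<Longrightarrow> opnorm LG (T \<otimes>\<^bsub>LG\<^esub> S) \<le> opnorm LG T * opnorm LG S"
  by (simp add: group_vN_simps compose_op_norm vN_bounded)

lemma opnorm_add: "T \<in> L I \<Longrightarrow> S \<in> L I \<Longrightarrow> opnorm LG (T \<oplus>\<^bsub>LG\<^esub> S) \<le> opnorm LG T + opnorm LG S"
  by (simp add: group_vN_simps add_op_norm vN_bounded)

lemma opnorm_smult: "T \<in> L I \<Longrightarrow> opnorm LG (c \<odot>\<^bsub>LG\<^esub> T) \<le> cmod c * opnorm LG T"
  by (simp add: group_vN_simps smult_op_norm vN_bounded)

section \<open>Supports of products and elements of finite support\<close>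

lemma coef_mult_support:
  assumes "T \<in> L I" "S \<in> L I" "coef (T \<otimes>\<^bsub>LG\<^esub> S) x \<noteq> 0"
  shows "\<exists>y\<in>I. \<exists>z\<in>I. x = y \<otimes> z \<and> coef T y \<noteq> 0 \<and> coef S z \<noteq> 0"
proof -
  have "coef (T \<otimes>\<^bsub>LG\<^esub> S) \<in> ell2 I" using assms by (intro coef_ell2[of _ I] vN_mult order_refl)
  then have x: "x \<in> I" using assms(3) ell2_outside by metis
  have "((\<lambda>z. coef S z * T (delta z) x) has_sum coef (T \<otimes>\<^bsub>LG\<^esub> S) x) I"
    using op_has_sum[OF vN_bounded[OF assms(1)] coef_ell2[OF assms(2)]] by (simp add: vN_apply)
  moreover have "((\<lambda>z. coef S z * T (delta z) x) has_sum 0) I" if "\<not> (\<exists>z\<in>I. coef S z * T (delta z) x \<noteq> 0)"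
    using that by (intro has_sum_0) blast
  ultimately have "\<exists>z\<in>I. coef S z * T (delta z) x \<noteq> 0"
    using assms(3) has_sum_unique by blast
  then obtain z where z: "z \<in> I" "coef S z \<noteq> 0" "T (delta z) x \<noteq> 0" by auto
  then show ?thesis
    using vN_entry[OF subgroup_self assms(1) x z(1)] x
    by (intro bexI[of _ "x \<otimes> inv z"] bexI[of _ z]) (auto simp: m_assoc)
qed

text \<open>The factors \<open>ys\<close> are matched with the operators by position, so that each
  can inherit the tag of its operator in an alternating word.\<close>

lemma coef_foldr_support:
  assumes "set Ts \<subseteq> L I" "coef (foldr (\<otimes>\<^bsub>LG\<^esub>) Ts \<one>\<^bsub>LG\<^esub>) x \<noteq> 0"
  shows "\<exists>ys. length ys = length Ts \<and> set ys \<subseteq> I \<and> x = foldr (\<otimes>) ys \<one> \<and> (\<forall>i<length Ts. coef (Ts ! i) (ys ! i) \<noteq> 0)"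
  using assms
proof (induction Ts arbitrary: x)
  case Nil
  then have "delta \<one> x \<noteq> 0" by (simp add: vN_apply)
  then have "x = \<one>" by (simp add: delta_def split: if_splits)
  then show ?case by simp
next
  case (Cons T Ts)
  have "foldr (\<otimes>\<^bsub>LG\<^esub>) Ts \<one>\<^bsub>LG\<^esub> \<in> L I"
    using Cons.prems(1) by (induction Ts) (auto simp: vN_one vN_mult)
  with Cons.prems obtain y z where yz: "y \<in> I" "z \<in> I" "x = y \<otimes> z" "coef T y \<noteq> 0"
    "coef (foldr (\<otimes>\<^bsub>LG\<^esub>) Ts \<one>\<^bsub>LG\<^esub>) z \<noteq> 0"
    using coef_mult_support[of T "foldr (\<otimes>\<^bsub>LG\<^esub>) Ts \<one>\<^bsub>LG\<^esub>" x] by auto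
  from Cons.IH[OF _ yz(5)] Cons.prems obtain ys where
    "length ys = length Ts" "set ys \<subseteq> I" "z = foldr (\<otimes>) ys \<one>" "\<forall>i<length Ts. coef (Ts ! i) (ys ! i) \<noteq> 0" by auto
  then show ?case using yz by (intro exI[of _ "y # ys"]) (auto simp: less_Suc_eq_0_disj)
qed

lemma left_regular_vN:
  assumes "subgroup H G" "h \<in> H"
  shows "left_regular G h \<in> L H"
proof -
  interpret H: subgroup H G by fact
  have h: "h \<in> I" using assms(2) by (rule H.mem_carrier)
  show ?thesis
    unfolding group_vN_sub_iff[OF assms(1)] left_regular_delta[OF h one_closed]
    using h assms(2) left_regular_bounded[OF h] left_regular_delta[OF h]
    by (simp, auto simp: delta_def inv_solve_right')
qed

text \<open>The element is a linear combination of left translations, which are contractions. The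
  bound on its norm serves \<open>letter2_remove\<close>, where it gives boundedness of a sequence
  as well as its convergence to 0.\<close>

lemma finite_support_exists:
  assumes H: "subgroup H G" and A: "finite A" "A \<subseteq> H"
  shows "\<exists>T\<in>L H. coef T = truncated A c \<and> opnorm LG T \<le> (\<Sum>a\<in>A. cmod (c a))"
  using A
proof (induction A)
  case empty
  have "op_norm I (\<lambda>f\<in>ell2 I. \<lambda>i. 0) \<le> 0" by (rule op_norm_le) auto
  then show ?case
    using vN_zero[OF subgroup.subset[OF H]] by (intro bexI[of _ "\<zero>\<^bsub>LG\<^esub>"]) (simp_all add: vN_apply, simp add: group_vN_simps del: restrict_apply)
next
  case (insert a A)
  have HI: "H \<subseteq> I" using H by (rule subgroup.subset)
  from insert obtain T where T: "T \<in> L H" "coef T = truncated A c" "opnorm LG T \<le> (\<Sum>a\<in>A. cmod (c a))" by auto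
  have a: "a \<in> I" "left_regular G a \<in> L H" using insert.prems HI left_regular_vN[OF H] by auto
  define S where "S = (c a \<odot>\<^bsub>LG\<^esub> left_regular G a)"
  have S: "S \<in> L H" unfolding S_def using a by (intro vN_smult HI)
  have LI: "T \<in> L I" "S \<in> L I" "left_regular G a \<in> L I" using T(1) S a(2) vN_mono[OF H] by auto
  have "opnorm LG S \<le> cmod (c a) * opnorm LG (left_regular G a)" unfolding S_def by (rule opnorm_smult[OF LI(3)])
  also have "\<dots> \<le> cmod (c a) * 1" using left_regular_norm[OF a(1)] by (intro mult_left_mono) (auto simp: opnorm_LG)
  finally have "opnorm LG (T \<oplus>\<^bsub>LG\<^esub> S) \<le> (\<Sum>a\<in>insert a A. cmod (c a))"
    using opnorm_add[OF LI(1,2)] T(3) insert.hyps by simp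
  moreover have "coef (T \<oplus>\<^bsub>LG\<^esub> S) = truncated (insert a A) c"
    using insert.hyps a(1)
    by (simp add: vN_apply T(2) S_def left_regular_delta) (auto simp: delta_def fun_eq_iff)
  ultimately show ?case using vN_add[OF HI T(1) S] by blast
qed

text \<open>Weak limit and conditional expectation in one step. The prospective entries are zero off
  the blocks of right cosets, and each finite form is the limit of the block-diagonal parts of the
  forms of \<open>X n\<close>, all bounded by \<open>C\<close>; \<open>bounded_form_rep\<close>
  supplies the operator.\<close>

lemma weak_limit_exists:
  assumes H: "subgroup H G" and "\<omega> \<noteq> bot" and X: "\<And>n. X n \<in> L I" "\<And>n. opnorm LG (X n) \<le> C"
    and lim: "\<And>h. h \<in> H \<Longrightarrow> ((\<lambda>n. coef (X n) h) \<longlongrightarrow> c h) \<omega>"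
  shows "\<exists>T\<in>L H. \<forall>h\<in>H. coef T h = c h"
proof -
  interpret H: subgroup H G by fact
  define a where "a x y = (if H #> x = H #> y then c (x \<otimes> inv y) else 0)" for x y
  have C: "C \<ge> 0" using opnorm_nonneg[OF X(1)[of undefined]] X(2)[of undefined] by linarith
  have "\<exists>T\<in>bounded_ops I. op_norm I T \<le> C \<and> (\<forall>x\<in>I. \<forall>y\<in>I. T (delta y) x = a x y)"
  proof (rule bounded_form_rep[OF C])
    fix A f g assume A: "finite A" "A \<subseteq> I"
    let ?F = "\<lambda>n. \<Sum>x\<in>A. \<Sum>y\<in>A. (if H #> x = H #> y then X n (delta y) x else 0) * f y * cnj (g x)"
    have "(?F \<longlongrightarrow> (\<Sum>x\<in>A. \<Sum>y\<in>A. a x y * f y * cnj (g x))) \<omega>"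
    proof (intro tendsto_sum tendsto_mult tendsto_const)
      fix x y assume "x \<in> A" "y \<in> A"
      then have xy: "x \<in> I" "y \<in> I" using A by auto
      show "((\<lambda>n. if H #> x = H #> y then X n (delta y) x else 0) \<longlongrightarrow> a x y) \<omega>"
      proof (cases "H #> x = H #> y")
        case True
        then show ?thesis
          using lim[of "x \<otimes> inv y"] coset_iff[OF H xy] vN_entry[OF subgroup_self X(1) xy] by (simp add: a_def)
      qed (simp add: a_def)
    qed
    then have l: "((\<lambda>n. cmod (?F n)) \<longlongrightarrow> cmod (\<Sum>x\<in>A. \<Sum>y\<in>A. a x y * f y * cnj (g x))) \<omega>" by (rule tendsto_norm)
    show "cmod (\<Sum>x\<in>A. \<Sum>y\<in>A. a x y * f y * cnj (g x)) \<le> C * fin_norm A f * fin_norm A g"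
    proof (rule tendsto_upperbound[OF l always_eventually assms(2)], rule allI)
      fix n
      have "cmod (?F n) \<le> op_norm I (X n) * fin_norm A f * fin_norm A g"
        by (rule block_diagonal_form_bound[OF vN_bounded[OF X(1)] A])
      also have "\<dots> \<le> C * fin_norm A f * fin_norm A g"
        using X(2)[of n] by (intro mult_right_mono) (auto simp: L2_set_nonneg opnorm_LG)
      finally show "cmod (?F n) \<le> C * fin_norm A f * fin_norm A g" .
    qed
  qed
  then obtain T where T: "T \<in> bounded_ops I" "\<And>x y. x \<in> I \<Longrightarrow> y \<in> I \<Longrightarrow> T (delta y) x = a x y" by blast
  have c: "coef T x = (if x \<in> H then c x else 0)" if "x \<in> I" for x
    using T(2)[OF that one_closed] coset_iff[OF H that one_closed] that by (simp add: a_def)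
  have "T \<in> L H"
    unfolding group_vN_sub_iff[OF H]
    using T c by (auto simp: a_def coset_iff[OF H, symmetric])
  then show ?thesis using c by (auto intro!: bexI[of _ T])
qed

text \<open>The coefficient at \<open>h\<close> is the inner product of \<open>X n f\<close> with
  \<open>g\<close>, where \<open>f = b (delta \<one>)\<close> and \<open>g = a* (delta h)\<close>.
  Both vectors are supported in \<open>H\<close>, so only entries of \<open>X n\<close> with index
  in \<open>H\<close> enter, and two applications of \<open>functional_tendsto\<close> pass to the
  limit.\<close>

lemma weak_limit_bimodule:
  assumes H: "subgroup H G" and X: "\<And>n. X n \<in> L I" "\<And>n. opnorm LG (X n) \<le> C" and T: "T \<in> L H"
    and lim: "\<And>h. h \<in> H \<Longrightarrow> ((\<lambda>n. coef (X n) h) \<longlongrightarrow> coef T h) \<omega>"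
    and a: "a \<in> L H" and b: "b \<in> L H" and h: "h \<in> H"
  shows "((\<lambda>n. coef (a \<otimes>\<^bsub>LG\<^esub> X n \<otimes>\<^bsub>LG\<^esub> b) h) \<longlongrightarrow> coef (a \<otimes>\<^bsub>LG\<^esub> T \<otimes>\<^bsub>LG\<^esub> b) h) \<omega>"
proof -
  interpret H: subgroup H G by fact
  note Xb = vN_bounded[OF X(1)] and Tb = vN_bounded[OF T] and ab = vN_bounded[OF a]
  note ent = vN_entry[OF subgroup_self X(1)]
  define f where "f = coef b"
  have f: "f \<in> ell2 I" unfolding f_def using b by (rule coef_ell2)
  have fH: "i \<in> H" if "f i \<noteq> 0" for i using that vN_support[OF H b] unfolding f_def by blast
  define g where "g = op_adjoint I a (delta h)"
  have hI: "h \<in> I" "delta h \<in> ell2 I" using h by (auto simp: delta_ell2)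
  have g: "g \<in> ell2 I" unfolding g_def by (rule bounded_opsD(1)[OF op_adjoint_bounded[OF ab] hI(2)])
  have gH: "i \<in> H" if i: "i \<in> I" "g i \<noteq> 0" for i
  proof -
    have "coef a (h \<otimes> inv i) \<noteq> 0"
      using i hI op_adjoint_entry[OF ab i(1) hI(1)] vN_entry[OF H a hI(1) i(1)] unfolding g_def by auto
    then have "h \<otimes> inv i \<in> H" using vN_support[OF H a] by blast
    then have "inv (inv h \<otimes> (h \<otimes> inv i)) \<in> H" using h by blast
    then show ?thesis using i hI by (simp add: m_assoc[symmetric])
  qed
  have coord: "((\<lambda>n. X n f k) \<longlongrightarrow> T f k) \<omega>" if k: "k \<in> H" for k
  proof (rule functional_tendsto[OF functional_bound_mono[OF functional_op_coord[OF Xb]] functional_op_coord[OF Tb] f])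
    show "op_norm I (X n) \<le> C" for n using X(2) by (simp add: opnorm_LG)
    fix i assume i: "i \<in> I" "f i \<noteq> 0"
    then have "k \<otimes> inv i \<in> H" using fH k by auto
    then show "((\<lambda>n. X n (delta i) k) \<longlongrightarrow> T (delta i) k) \<omega>"
      using lim[of "k \<otimes> inv i"] ent[of k i] vN_entry[OF H T, of k i] k i by simp
  qed
  \<comment> \<open>Now \<open>g\<close> is the variable, placed in the slot in which the inner
    product is linear; the functionals depend on \<open>n\<close> through the vectors
    \<open>X n f\<close>, whose norms are uniformly bounded.\<close>
  have inner: "((\<lambda>n. ell2_inner I g (X n f)) \<longlongrightarrow> ell2_inner I g (T f)) \<omega>"
  proof (rule functional_tendsto[OF functional_bound_mono[OF functional_inner] functional_inner g])
    show "X n f \<in> ell2 I" for n by (rule bounded_opsD(1)[OF Xb f])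
    show "T f \<in> ell2 I" by (rule bounded_opsD(1)[OF Tb f])
    show "ell2_norm I (X n f) \<le> C * ell2_norm I f" for n
      using op_norm_bound[OF Xb f, of n] X(2)[of n] mult_right_mono[of _ C "ell2_norm I f"]
      unfolding opnorm_LG by (meson ell2_norm_nonneg order_trans)
    fix i assume i: "i \<in> I" "g i \<noteq> 0"
    then have "((\<lambda>n. cnj (X n f i)) \<longlongrightarrow> cnj (T f i)) \<omega>" by (intro tendsto_cnj coord gH)
    moreover have "ell2_inner I (delta i) u = cnj (u i)" for u
      by (subst ell2_inner_cnj[symmetric]) (use i in \<open>simp add: ell2_inner_delta\<close>)
    ultimately show "((\<lambda>n. ell2_inner I (delta i) (X n f)) \<longlongrightarrow> ell2_inner I (delta i) (T f)) \<omega>" by simp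
  qed
  have e: "coef (a \<otimes>\<^bsub>LG\<^esub> Y \<otimes>\<^bsub>LG\<^esub> b) h = cnj (ell2_inner I g (Y f))" if "Y \<in> bounded_ops I" for Y
  proof -
    have Yf: "Y f \<in> ell2 I" by (rule bounded_opsD(1)[OF that f])
    have "coef (a \<otimes>\<^bsub>LG\<^esub> Y \<otimes>\<^bsub>LG\<^esub> b) h = a (Y f) h" by (simp add: vN_apply f f_def[symmetric])
    also have "\<dots> = ell2_inner I (a (Y f)) (delta h)" using hI by (simp add: ell2_inner_delta)
    also have "\<dots> = ell2_inner I (Y f) g" unfolding g_def by (rule op_adjoint_inner[OF ab Yf hI(2)])
    finally show ?thesis by (simp add: ell2_inner_cnj)
  qed
  show ?thesis unfolding e[OF Xb] e[OF Tb] by (rule tendsto_cnj[OF inner])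
qed

end

section \<open>The ultrapower and its conditional expectation\<close>

text \<open>The image filter lives on a compact set, so it has a cluster point, and an ultrafilter
  converges to each of its cluster points.\<close>

lemma free_ultrafilter_convergent:
  fixes f :: "nat \<Rightarrow> 'b::heine_borel"
  assumes "free_ultrafilter \<omega>" "bounded (range f)"
  shows "\<exists>l. (f \<longlongrightarrow> l) \<omega>"
proof -
  have "filtermap f \<omega> \<noteq> bot" using assms(1) by (simp add: free_ultrafilter_def filtermap_bot_iff)
  moreover have "eventually (\<lambda>x. x \<in> closure (range f)) (filtermap f \<omega>)"
    unfolding eventually_filtermap using closure_subset[of "range f"] by (intro always_eventually) auto
  moreover have "compact (closure (range f))" using assms(2) by (simp add: compact_closure)
  ultimately obtain l where l: "inf (nhds l) (filtermap f \<omega>) \<noteq> bot"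
    unfolding compact_filter by blast
  have "eventually P (filtermap f \<omega>)" if P: "eventually P (nhds l)" for P
  proof (rule ccontr)
    assume "\<not> eventually P (filtermap f \<omega>)"
    then have "eventually (\<lambda>x. \<not> P x) (filtermap f \<omega>)"
      using assms(1) unfolding free_ultrafilter_def eventually_filtermap by blast
    with P have "eventually (\<lambda>x. False) (inf (nhds l) (filtermap f \<omega>))"
      unfolding eventually_inf by blast
    then show False using l by (simp add: eventually_False)
  qed
  then show ?thesis unfolding filterlim_def le_filter_def by blast
qed

lemma tendsto_null_le:
  fixes f g :: "nat \<Rightarrow> real"
  assumes "(f \<longlongrightarrow> 0) \<omega>" "\<And>n. 0 \<le> g n" "\<And>n. g n \<le> f n"
  shows "(g \<longlongrightarrow> 0) \<omega>"
  by (rule tendsto_sandwich[OF always_eventually always_eventually tendsto_const assms(1)]) (use assms in auto)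

text \<open>Scalar multiplication and adjoint of the ultrapower are unions over representatives; if
  all representatives yield the same class, the union is that class.\<close>

lemma UN_const_eq: "A \<noteq> {} \<Longrightarrow> (\<And>y. y \<in> A \<Longrightarrow> f y = c) \<Longrightarrow> (\<Union>y\<in>A. f y) = c"
  by auto

section \<open>Bounded sequences and the null ideal\<close>

locale group_ultrapower = group G for G (structure) +
  fixes H :: "'a set" and \<omega> :: "nat filter"
  assumes H: "subgroup H G" and uf: "free_ultrafilter \<omega>"
begin

abbreviation R where "R \<equiv> linf LG"
abbreviation N where "N \<equiv> null_ideal \<omega> LG"
abbreviation M where "M \<equiv> ultrapower \<omega> LG"
abbreviation cls where "cls \<equiv> ultra_class \<omega> LG"
abbreviation B where "B \<equiv> ultra_const \<omega> LG (L H)"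

text \<open>Equality of classes, expressed on representatives. The difference is written with the
  scalar \<open>-1\<close>, which evaluates directly on vectors, unlike the additive inverse of the
  ring.\<close>

definition near :: "(nat \<Rightarrow> 'a op) \<Rightarrow> (nat \<Rightarrow> 'a op) \<Rightarrow> bool" where
  "near x y \<longleftrightarrow> ((\<lambda>n. norm2 LG (x n \<oplus>\<^bsub>LG\<^esub> (-1) \<odot>\<^bsub>LG\<^esub> y n)) \<longlongrightarrow> 0) \<omega>"

lemma HI: "H \<subseteq> I"
  using H by (rule subgroup.subset)

lemma LH_LI: "T \<in> L H \<Longrightarrow> T \<in> L I"
  using vN_mono[OF H] by auto

lemma omega_neq_bot: "\<omega> \<noteq> bot"
  using uf by (simp add: free_ultrafilter_def)

lemma linf_simps:
  "mult R = (\<lambda>x y n. x n \<otimes>\<^bsub>LG\<^esub> y n)" "one R = (\<lambda>n. \<one>\<^bsub>LG\<^esub>)" "zero R = (\<lambda>n. \<zero>\<^bsub>LG\<^esub>)"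
  "add R = (\<lambda>x y n. x n \<oplus>\<^bsub>LG\<^esub> y n)" "smult R = (\<lambda>c x n. c \<odot>\<^bsub>LG\<^esub> x n)"
  by (simp_all add: linf_def)

lemma linf_carrier: "x \<in> carrier R \<longleftrightarrow> (\<forall>n. x n \<in> L I) \<and> (\<exists>C. \<forall>n. opnorm LG (x n) \<le> C)"
  by (simp add: linf_def group_vN_simps(1))

lemma linf_mem: "x \<in> carrier R \<Longrightarrow> x n \<in> L I"
  by (simp add: linf_carrier)

lemma linf_const: "T \<in> L I \<Longrightarrow> (\<lambda>n. T) \<in> carrier R"
  by (auto simp: linf_carrier)

lemma linf_bound:
  assumes "x \<in> carrier R"
  shows "\<exists>C\<ge>0. \<forall>n. opnorm LG (x n) \<le> C"
  using assms opnorm_nonneg[OF linf_mem[OF assms]] unfolding linf_carrier by (meson order_trans)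

lemma
  assumes "x \<in> carrier R" "y \<in> carrier R"
  shows linf_mult: "(\<lambda>n. x n \<otimes>\<^bsub>LG\<^esub> y n) \<in> carrier R" and linf_add: "(\<lambda>n. x n \<oplus>\<^bsub>LG\<^esub> y n) \<in> carrier R"
proof -
  note xy = linf_mem[OF assms(1)] linf_mem[OF assms(2)]
  obtain C where C: "C \<ge> 0" "\<And>n. opnorm LG (x n) \<le> C" using linf_bound[OF assms(1)] by blast
  obtain D where D: "D \<ge> 0" "\<And>n. opnorm LG (y n) \<le> D" using linf_bound[OF assms(2)] by blast
  have "opnorm LG (x n \<otimes>\<^bsub>LG\<^esub> y n) \<le> C * D" for n
    using opnorm_mult[OF xy(1)[of n] xy(2)[of n]]
      mult_mono[OF C(2)[of n] D(2)[of n] C(1) opnorm_nonneg[OF xy(2)[of n]]] by linarith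
  then show "(\<lambda>n. x n \<otimes>\<^bsub>LG\<^esub> y n) \<in> carrier R" using xy by (auto simp: linf_carrier vN_mult)
  have "opnorm LG (x n \<oplus>\<^bsub>LG\<^esub> y n) \<le> C + D" for n
    using opnorm_add[OF xy(1)[of n] xy(2)[of n]] C(2)[of n] D(2)[of n] by linarith
  then show "(\<lambda>n. x n \<oplus>\<^bsub>LG\<^esub> y n) \<in> carrier R" using xy by (auto simp: linf_carrier vN_add)
qed

lemma linf_smult:
  assumes "x \<in> carrier R"
  shows "(\<lambda>n. c \<odot>\<^bsub>LG\<^esub> x n) \<in> carrier R"
proof -
  obtain C where C: "C \<ge> 0" "\<And>n. opnorm LG (x n) \<le> C" using linf_bound[OF assms] by blast
  have "opnorm LG (c \<odot>\<^bsub>LG\<^esub> x n) \<le> cmod c * C" for n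
    using opnorm_smult[OF linf_mem[OF assms], of c n] mult_left_mono[OF C(2)[of n], of "cmod c"] by simp
  then show ?thesis using linf_mem[OF assms] by (auto simp: linf_carrier vN_smult)
qed

lemma linf_star:
  assumes "x \<in> carrier R"
  shows "(\<lambda>n. star LG (x n)) \<in> carrier R"
proof -
  obtain C where C: "C \<ge> 0" "\<And>n. opnorm LG (x n) \<le> C" using linf_bound[OF assms] by blast
  have "opnorm LG (star LG (x n)) \<le> C" for n
    using opnorm_star[OF linf_mem[OF assms], of n] C(2)[of n] by linarith
  then show ?thesis using linf_mem[OF assms] by (auto simp: linf_carrier vN_star subgroup_self)
qed

lemma ring_linf: "ring R"
proof -
  interpret LG: ring LG by (rule ring_LG)
  have mem: "x n \<in> carrier LG" if "x \<in> carrier R" for x n using that by (simp add: linf_carrier group_vN_simps(1))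
  have neg: "(-1) \<odot>\<^bsub>LG\<^esub> T \<oplus>\<^bsub>LG\<^esub> T = \<zero>\<^bsub>LG\<^esub>" if "T \<in> L I" for T
    using that by (intro LG_eqI) (auto simp: vN_add vN_smult vN_zero vN_apply)
  show ?thesis
  proof (rule ringI)
    show "abelian_group R"
    proof (rule abelian_groupI)
      fix x assume x: "x \<in> carrier R"
      show "\<exists>y\<in>carrier R. y \<oplus>\<^bsub>R\<^esub> x = \<zero>\<^bsub>R\<^esub>"
        by (rule bexI[OF _ linf_smult[OF x, of "-1"]]) (use x in \<open>simp add: linf_simps neg linf_mem\<close>)
    qed (auto simp: linf_simps linf_add linf_const vN_zero mem LG.a_ac)
    show "monoid R"
      by (rule monoidI) (auto simp: linf_simps linf_mult linf_const vN_one mem LG.m_assoc)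
  qed (auto simp: linf_simps mem LG.l_distr LG.r_distr)
qed

lemma linf_minus:
  assumes "x \<in> carrier R"
  shows "\<ominus>\<^bsub>R\<^esub> x = (\<lambda>n. (-1) \<odot>\<^bsub>LG\<^esub> x n)"
proof -
  interpret R: ring R by (rule ring_linf)
  have "(\<lambda>n. (-1) \<odot>\<^bsub>LG\<^esub> x n) \<oplus>\<^bsub>R\<^esub> x = \<zero>\<^bsub>R\<^esub>"
    unfolding linf_simps
    by (rule ext, rule LG_eqI) (use linf_mem[OF assms] in \<open>auto simp: vN_add vN_smult vN_zero vN_apply\<close>)
  then show ?thesis using R.minus_equality[OF _ assms linf_smult[OF assms]] by simp
qed

lemma null_iff: "x \<in> N \<longleftrightarrow> x \<in> carrier R \<and> ((\<lambda>n. norm2 LG (x n)) \<longlongrightarrow> 0) \<omega>"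
  by (simp add: null_ideal_def)

lemma null_mult:
  assumes "a \<in> N" "x \<in> carrier R"
  shows "x \<otimes>\<^bsub>R\<^esub> a \<in> N" "a \<otimes>\<^bsub>R\<^esub> x \<in> N"
proof -
  have a: "a \<in> carrier R" "((\<lambda>n. norm2 LG (a n)) \<longlongrightarrow> 0) \<omega>" using assms by (auto simp: null_iff)
  note m = linf_mem[OF a(1)] linf_mem[OF assms(2)]
  obtain C where C: "C \<ge> 0" "\<And>n. opnorm LG (x n) \<le> C" using linf_bound[OF assms(2)] by blast
  have lim: "((\<lambda>n. C * norm2 LG (a n)) \<longlongrightarrow> 0) \<omega>" using tendsto_mult_right_zero[OF a(2)] .
  have le: "opnorm LG (x n) * norm2 LG (a n) \<le> C * norm2 LG (a n)" for n
    using C(2)[of n] norm2_nonneg[OF m(1)] by (rule mult_right_mono)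
  show "x \<otimes>\<^bsub>R\<^esub> a \<in> N"
    unfolding null_iff linf_simps
    using linf_mult[OF assms(2) a(1)] norm2_mult_left[OF m(2,1)] le
    by (auto intro!: tendsto_null_le[OF lim] norm2_nonneg vN_mult m intro: order_trans)
  show "a \<otimes>\<^bsub>R\<^esub> x \<in> N"
    unfolding null_iff linf_simps
    using linf_mult[OF a(1) assms(2)] norm2_mult_right[OF m(1,2)] le
    by (auto intro!: tendsto_null_le[OF lim] norm2_nonneg vN_mult m intro: order_trans)
qed

lemma ideal_null: "ideal N R"
proof (rule idealI)
  interpret R: ring R by (rule ring_linf)
  show "ring R" by (rule ring_linf)
  show "subgroup N (add_monoid R)"
  proof (rule group.subgroupI)
    show "Group.group (add_monoid R)" by (rule R.a_group)
    show "N \<subseteq> carrier (add_monoid R)" by (auto simp: null_iff)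
    have "\<zero>\<^bsub>R\<^esub> \<in> N"
      unfolding null_iff linf_simps by (simp add: linf_const vN_zero norm2_zero)
    then show "N \<noteq> {}" by blast
  next
    fix a assume a: "a \<in> N"
    then have "a \<in> carrier R" by (simp add: null_iff)
    then have "\<ominus>\<^bsub>R\<^esub> a \<in> N"
      using a unfolding linf_minus[OF \<open>a \<in> carrier R\<close>] null_iff
      by (simp add: linf_smult norm2_smult linf_mem)
    then show "inv\<^bsub>add_monoid R\<^esub> a \<in> N" by (simp add: a_inv_def)
  next
    fix a b assume ab: "a \<in> N" "b \<in> N"
    then have m: "a \<in> carrier R" "b \<in> carrier R" by (auto simp: null_iff)
    have "((\<lambda>n. norm2 LG (a n) + norm2 LG (b n)) \<longlongrightarrow> 0 + 0) \<omega>"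
      using ab by (intro tendsto_add) (auto simp: null_iff)
    then have lim: "((\<lambda>n. norm2 LG (a n) + norm2 LG (b n)) \<longlongrightarrow> 0) \<omega>" by simp
    have "((\<lambda>n. norm2 LG (a n \<oplus>\<^bsub>LG\<^esub> b n)) \<longlongrightarrow> 0) \<omega>"
      by (rule tendsto_null_le[OF lim])
        (use linf_mem[OF m(1)] linf_mem[OF m(2)] in \<open>auto intro: norm2_nonneg norm2_add vN_add\<close>)
    then show "a \<otimes>\<^bsub>add_monoid R\<^esub> b \<in> N" using linf_add[OF m] by (simp add: null_iff linf_simps)
  qed
qed (use null_mult in auto)

section \<open>Classes of sequences and the operations of the ultrapower\<close>

lemma cls_mem: "y \<in> cls x \<Longrightarrow> x \<in> carrier R \<Longrightarrow> y \<in> carrier R \<and> near y x"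
proof -
  assume "y \<in> cls x" and x: "x \<in> carrier R"
  then obtain a where a: "a \<in> N" and y: "y = (\<lambda>n. a n \<oplus>\<^bsub>LG\<^esub> x n)"
    unfolding ultra_class_def a_r_coset_def' linf_simps by blast
  have aR: "a \<in> carrier R" using a by (simp add: null_iff)
  have "y n \<oplus>\<^bsub>LG\<^esub> (-1) \<odot>\<^bsub>LG\<^esub> x n = a n" for n
    unfolding y using linf_mem[OF aR] linf_mem[OF x]
    by (intro LG_eqI) (auto simp: vN_add vN_smult vN_apply)
  then show ?thesis using a aR linf_add[OF aR x] y by (simp add: near_def null_iff)
qed

lemma cls_self: "x \<in> carrier R \<Longrightarrow> x \<in> cls x"
proof -
  interpret ideal N R by (rule ideal_null)
  show "x \<in> carrier R \<Longrightarrow> x \<in> cls x" unfolding ultra_class_def by (rule a_rcos_self)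
qed

lemma cls_eqI:
  assumes "x \<in> carrier R" "y \<in> carrier R" "near x y"
  shows "cls x = cls y"
proof -
  interpret ideal N R by (rule ideal_null)
  note m = linf_mem[OF assms(1)] linf_mem[OF assms(2)]
  let ?a = "\<lambda>n. x n \<oplus>\<^bsub>LG\<^esub> (-1) \<odot>\<^bsub>LG\<^esub> y n"
  have "?a \<in> N" unfolding null_iff using assms linf_add[OF assms(1) linf_smult[OF assms(2)]] by (simp add: near_def)
  moreover have "x = ?a \<oplus>\<^bsub>R\<^esub> y"
    unfolding linf_simps by (rule ext, rule LG_eqI) (use m in \<open>auto simp: vN_add vN_smult vN_apply\<close>)
  ultimately have "x \<in> N +>\<^bsub>R\<^esub> y" unfolding a_r_coset_def' by blast
  then show ?thesis unfolding ultra_class_def using a_repr_independence[OF _ assms(2) a_subgroup] by simp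
qed

lemma cls_eqD:
  assumes "x \<in> carrier R" "y \<in> carrier R" "cls x = cls y"
  shows "near x y"
  using cls_mem[of x y] cls_self[of x] assms by simp

lemma M_simps:
  "carrier M = carrier (R Quot N)" "mult M = mult (R Quot N)" "one M = one (R Quot N)"
  "zero M = zero (R Quot N)" "add M = add (R Quot N)"
  "smult M = (\<lambda>c \<xi>. \<Union>x\<in>\<xi>. cls (c \<odot>\<^bsub>R\<^esub> x))" "star M = (\<lambda>\<xi>. \<Union>x\<in>\<xi>. cls (\<lambda>n. star LG (x n)))"
  "trc M = (\<lambda>\<xi>. THE t. \<exists>x\<in>\<xi>. ((\<lambda>n. trc LG (x n)) \<longlongrightarrow> t) \<omega>)"
  by (simp_all add: ultrapower_def Let_def)

lemma M_carrier: "carrier M = cls ` carrier R"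
  by (auto simp: M_simps FactRing_def A_RCOSETS_def' ultra_class_def)

lemma cls_hom: "cls \<in> ring_hom R (R Quot N)"
proof -
  have "cls = (+>\<^bsub>R\<^esub>) N" by (rule ext) (simp add: ultra_class_def)
  then show ?thesis using ideal.rcos_ring_hom[OF ideal_null] by simp
qed

lemma
  assumes "x \<in> carrier R" "y \<in> carrier R"
  shows cls_mult: "cls x \<otimes>\<^bsub>M\<^esub> cls y = cls (\<lambda>n. x n \<otimes>\<^bsub>LG\<^esub> y n)"
    and cls_add: "cls x \<oplus>\<^bsub>M\<^esub> cls y = cls (\<lambda>n. x n \<oplus>\<^bsub>LG\<^esub> y n)"
  using ring_hom_mult[OF cls_hom assms] ring_hom_add[OF cls_hom assms]
  by (simp_all add: M_simps linf_simps)

lemma cls_one: "\<one>\<^bsub>M\<^esub> = cls (\<lambda>n. \<one>\<^bsub>LG\<^esub>)"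
  using ring_hom_one[OF cls_hom] by (simp add: M_simps linf_simps)

lemma cls_zero: "\<zero>\<^bsub>M\<^esub> = cls (\<lambda>n. \<zero>\<^bsub>LG\<^esub>)"
proof -
  interpret ideal N R by (rule ideal_null)
  have "N +>\<^bsub>R\<^esub> \<zero>\<^bsub>R\<^esub> = N" by (rule a_coset_add_zero) (rule a_subset)
  then show ?thesis by (simp add: M_simps FactRing_def ultra_class_def linf_simps)
qed

lemma near_smult:
  assumes "x \<in> carrier R" "y \<in> carrier R" "near x y"
  shows "near (\<lambda>n. c \<odot>\<^bsub>LG\<^esub> x n) (\<lambda>n. c \<odot>\<^bsub>LG\<^esub> y n)"
proof -
  note m = linf_mem[OF assms(1)] linf_mem[OF assms(2)]
  have "c \<odot>\<^bsub>LG\<^esub> x n \<oplus>\<^bsub>LG\<^esub> (-1) \<odot>\<^bsub>LG\<^esub> (c \<odot>\<^bsub>LG\<^esub> y n) = c \<odot>\<^bsub>LG\<^esub> (x n \<oplus>\<^bsub>LG\<^esub> (-1) \<odot>\<^bsub>LG\<^esub> y n)" for n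
    by (rule LG_eqI) (use m in \<open>auto simp: vN_add vN_smult vN_apply algebra_simps\<close>)
  then show ?thesis using tendsto_mult_right_zero[OF assms(3)[unfolded near_def], of "cmod c"] m
    by (simp add: near_def norm2_smult vN_add vN_smult)
qed

lemma star_diff:
  assumes "T \<in> L I" "S \<in> L I"
  shows "star LG T \<oplus>\<^bsub>LG\<^esub> (-1) \<odot>\<^bsub>LG\<^esub> star LG S = star LG (T \<oplus>\<^bsub>LG\<^esub> (-1) \<odot>\<^bsub>LG\<^esub> S)"
  by (rule vN_eqI)
    (use assms in \<open>auto simp: vN_add vN_smult vN_star subgroup_self coef_star[OF _ _ subgroup_self] vN_apply\<close>)

lemma near_star:
  assumes "x \<in> carrier R" "y \<in> carrier R" "near x y"
  shows "near (\<lambda>n. star LG (x n)) (\<lambda>n. star LG (y n))"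
  using assms(3) linf_mem[OF assms(1)] linf_mem[OF assms(2)]
  by (simp add: near_def star_diff norm2_star vN_add vN_smult)

lemma cls_smult:
  assumes "x \<in> carrier R"
  shows "c \<odot>\<^bsub>M\<^esub> cls x = cls (\<lambda>n. c \<odot>\<^bsub>LG\<^esub> x n)"
  unfolding M_simps linf_simps
proof (rule UN_const_eq)
  show "cls x \<noteq> {}" using cls_self[OF assms] by blast
  fix y assume "y \<in> cls x"
  then have "y \<in> carrier R" "near y x" using cls_mem assms by auto
  then show "cls (\<lambda>n. c \<odot>\<^bsub>LG\<^esub> y n) = cls (\<lambda>n. c \<odot>\<^bsub>LG\<^esub> x n)"
    using assms by (intro cls_eqI linf_smult near_smult)
qed

lemma cls_star:
  assumes "x \<in> carrier R"
  shows "star M (cls x) = cls (\<lambda>n. star LG (x n))"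
  unfolding M_simps linf_simps
proof (rule UN_const_eq)
  show "cls x \<noteq> {}" using cls_self[OF assms] by blast
  fix y assume "y \<in> cls x"
  then have "y \<in> carrier R" "near y x" using cls_mem assms by auto
  then show "cls (\<lambda>n. star LG (y n)) = cls (\<lambda>n. star LG (x n))"
    using assms by (intro cls_eqI linf_star near_star)
qed

text \<open>A coefficient is dominated by the 2-norm, so its limit along \<open>\<omega>\<close>
  depends only on the class.\<close>

lemma near_coef:
  assumes "x \<in> carrier R" "y \<in> carrier R" "near x y" "((\<lambda>n. coef (y n) g) \<longlongrightarrow> t) \<omega>"
  shows "((\<lambda>n. coef (x n) g) \<longlongrightarrow> t) \<omega>"
proof -
  note m = linf_mem[OF assms(1)] linf_mem[OF assms(2)]
  have "((\<lambda>n. cmod (coef (x n) g - coef (y n) g)) \<longlongrightarrow> 0) \<omega>"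
  proof (rule tendsto_null_le[OF assms(3)[unfolded near_def]])
    fix n
    show "cmod (coef (x n) g - coef (y n) g) \<le> norm2 LG (x n \<oplus>\<^bsub>LG\<^esub> (-1) \<odot>\<^bsub>LG\<^esub> y n)"
      using cmod_coef_le_norm2[of "x n \<oplus>\<^bsub>LG\<^esub> (-1) \<odot>\<^bsub>LG\<^esub> y n" g] m by (simp add: vN_add vN_smult vN_apply)
  qed simp
  then have "((\<lambda>n. coef (x n) g - coef (y n) g) \<longlongrightarrow> 0) \<omega>" by (simp add: tendsto_norm_zero_iff)
  from tendsto_add[OF this assms(4)] show ?thesis by simp
qed

text \<open>The trace is a definite description ranging over all representatives; by
  \<open>near_coef\<close> every representative has the same limit.\<close>

lemma cls_trc:
  assumes "x \<in> carrier R" "((\<lambda>n. coef (x n) \<one>) \<longlongrightarrow> t) \<omega>"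
  shows "trc M (cls x) = t"
  unfolding M_simps trc_LG
proof (rule the_equality)
  show "\<exists>y\<in>cls x. ((\<lambda>n. coef (y n) \<one>) \<longlongrightarrow> t) \<omega>" using assms cls_self by blast
  fix s assume "\<exists>y\<in>cls x. ((\<lambda>n. coef (y n) \<one>) \<longlongrightarrow> s) \<omega>"
  then obtain y where y: "y \<in> carrier R" "near y x" "((\<lambda>n. coef (y n) \<one>) \<longlongrightarrow> s) \<omega>"
    using cls_mem assms(1) by blast
  from near_coef[OF y(1) assms(1) y(2) assms(2)] y(3) show "s = t"
    using omega_neq_bot tendsto_unique by blast
qed

lemma coef_convergent:
  assumes "x \<in> carrier R"
  shows "\<exists>t. ((\<lambda>n. coef (x n) g) \<longlongrightarrow> t) \<omega>"
proof (rule free_ultrafilter_convergent[OF uf])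
  obtain C where C: "C \<ge> 0" "\<And>n. opnorm LG (x n) \<le> C" using linf_bound[OF assms] by blast
  have "cmod (coef (x n) g) \<le> C" for n
    using cmod_coef_le_opnorm[OF linf_mem[OF assms], of n g] C(2)[of n] by (simp add: opnorm_LG)
  then show "bounded (range (\<lambda>n. coef (x n) g))" by (auto simp: bounded_iff)
qed

text \<open>\<open>T\<close> is the expectation onto L(H) of the weak limit of \<open>x\<close>
  along \<open>\<omega>\<close>. Outside \<open>H\<close> no condition is imposed, since the
  coefficients of \<open>T\<close> vanish there.\<close>

definition limit_of :: "(nat \<Rightarrow> 'a op) \<Rightarrow> 'a op \<Rightarrow> bool" where
  "limit_of x T \<longleftrightarrow> T \<in> L H \<and> (\<forall>h\<in>H. ((\<lambda>n. coef (x n) h) \<longlongrightarrow> coef T h) \<omega>)"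

text \<open>Defined on classes, hence through a description over all representatives. The value is a
  constant class because amalgamation is over L(H) and not over its ultrapower.\<close>

definition E :: "(nat \<Rightarrow> 'a op) set \<Rightarrow> (nat \<Rightarrow> 'a op) set" where
  "E \<xi> = cls (\<lambda>_. THE T. \<exists>x\<in>carrier R. \<xi> = cls x \<and> limit_of x T)"

lemma limit_of_exists:
  assumes "x \<in> carrier R"
  obtains T where "limit_of x T"
proof -
  obtain C where C: "C \<ge> 0" "\<And>n. opnorm LG (x n) \<le> C" using linf_bound[OF assms] by blast
  obtain c where c: "\<And>h. ((\<lambda>n. coef (x n) h) \<longlongrightarrow> c h) \<omega>"
    using coef_convergent[OF assms] by metis
  obtain T where "T \<in> L H" "\<forall>h\<in>H. coef T h = c h"
    using weak_limit_exists[OF H omega_neq_bot linf_mem[OF assms] C(2) c] by blast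
  then show ?thesis using that[of T] c by (simp add: limit_of_def)
qed

text \<open>On \<open>H\<close> the coefficients are limits that depend only on the class; elsewhere
  both vanish.\<close>

lemma limit_of_unique:
  assumes "x \<in> carrier R" "y \<in> carrier R" "near x y" "limit_of x T" "limit_of y S"
  shows "T = S"
proof (rule vN_eqI)
  show "T \<in> L I" "S \<in> L I" using assms LH_LI by (auto simp: limit_of_def)
  fix h assume "h \<in> I"
  show "coef T h = coef S h"
  proof (cases "h \<in> H")
    case True
    then have "((\<lambda>n. coef (y n) h) \<longlongrightarrow> coef S h) \<omega>" "((\<lambda>n. coef (x n) h) \<longlongrightarrow> coef T h) \<omega>"
      using assms by (auto simp: limit_of_def)
    then show ?thesis using near_coef[OF assms(1-3)] omega_neq_bot tendsto_unique by blast
  next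
    case False
    have "T \<in> L H" "S \<in> L H" using assms by (auto simp: limit_of_def)
    with False show ?thesis using vN_support[OF H, of T h] vN_support[OF H, of S h] by simp
  qed
qed

lemma E_cls:
  assumes "x \<in> carrier R" "limit_of x T"
  shows "E (cls x) = cls (\<lambda>_. T)"
proof -
  have "(THE T. \<exists>y\<in>carrier R. cls x = cls y \<and> limit_of y T) = T"
    using assms limit_of_unique[OF assms(1) _ cls_eqD[OF assms(1)]]
    by (intro the_equality) blast+
  then show ?thesis by (simp add: E_def)
qed

text \<open>Vanishing expectation means that the constant class of the limit \<open>T\<close> is
  zero, so the coefficients of \<open>T\<close> vanish. For a constant sequence the conclusion says
  that the coefficients over \<open>H\<close> are themselves 0.\<close>

lemma E_zeroD:
  assumes "x \<in> carrier R" "E (cls x) = \<zero>\<^bsub>M\<^esub>" "h \<in> H"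
  shows "((\<lambda>n. coef (x n) h) \<longlongrightarrow> 0) \<omega>"
proof -
  obtain T where T: "limit_of x T" by (rule limit_of_exists[OF assms(1)])
  then have TI: "T \<in> L I" using LH_LI by (auto simp: limit_of_def)
  have "cls (\<lambda>_. T) = cls (\<lambda>_. \<zero>\<^bsub>LG\<^esub>)" using E_cls[OF assms(1) T] assms(2) cls_zero by simp
  then have "near (\<lambda>_. T) (\<lambda>_. \<zero>\<^bsub>LG\<^esub>)" using TI by (intro cls_eqD linf_const vN_zero order_refl)
  moreover have "((\<lambda>_. coef \<zero>\<^bsub>LG\<^esub> h) \<longlongrightarrow> 0) \<omega>" by (simp add: vN_apply)
  ultimately have "((\<lambda>_. coef T h) \<longlongrightarrow> 0) \<omega>"
    using near_coef[of "\<lambda>_. T" "\<lambda>_. \<zero>\<^bsub>LG\<^esub>" h 0] TI by (simp add: linf_const vN_zero)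
  then have "coef T h = 0" using omega_neq_bot by (simp add: tendsto_const_iff)
  then show ?thesis using T assms(3) by (auto simp: limit_of_def)
qed

lemma B_iff: "\<xi> \<in> B \<longleftrightarrow> (\<exists>T\<in>L H. \<xi> = cls (\<lambda>_. T))"
  by (auto simp: ultra_const_def)

lemma E_bimodule:
  assumes "x \<in> carrier R" "a \<in> L H" "b \<in> L H"
  shows "E (cls (\<lambda>_. a) \<otimes>\<^bsub>M\<^esub> cls x \<otimes>\<^bsub>M\<^esub> cls (\<lambda>_. b)) = cls (\<lambda>_. a) \<otimes>\<^bsub>M\<^esub> E (cls x) \<otimes>\<^bsub>M\<^esub> cls (\<lambda>_. b)"
proof -
  obtain T where T: "limit_of x T" by (rule limit_of_exists[OF assms(1)])
  have TH: "T \<in> L H" using T by (simp add: limit_of_def)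
  obtain C where C: "C \<ge> 0" "\<And>n. opnorm LG (x n) \<le> C" using linf_bound[OF assms(1)] by blast
  note ab = linf_const[OF LH_LI[OF assms(2)]] linf_const[OF LH_LI[OF assms(3)]] linf_const[OF LH_LI[OF TH]]
  let ?y = "\<lambda>n. a \<otimes>\<^bsub>LG\<^esub> x n \<otimes>\<^bsub>LG\<^esub> b"
  have y: "cls (\<lambda>_. a) \<otimes>\<^bsub>M\<^esub> cls x \<otimes>\<^bsub>M\<^esub> cls (\<lambda>_. b) = cls ?y" "?y \<in> carrier R"
    using cls_mult[OF ab(1) assms(1)] cls_mult[OF linf_mult[OF ab(1) assms(1)] ab(2)]
      linf_mult[OF linf_mult[OF ab(1) assms(1)] ab(2)] by auto
  have "limit_of ?y (a \<otimes>\<^bsub>LG\<^esub> T \<otimes>\<^bsub>LG\<^esub> b)"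
    unfolding limit_of_def
  proof (intro conjI ballI)
    show "a \<otimes>\<^bsub>LG\<^esub> T \<otimes>\<^bsub>LG\<^esub> b \<in> L H" using assms TH HI by (intro vN_mult)
    fix h assume "h \<in> H"
    then show "((\<lambda>n. coef (?y n) h) \<longlongrightarrow> coef (a \<otimes>\<^bsub>LG\<^esub> T \<otimes>\<^bsub>LG\<^esub> b) h) \<omega>"
      using T assms(2,3) by (intro weak_limit_bimodule[OF H linf_mem[OF assms(1)] C(2) TH]) (auto simp: limit_of_def)
  qed
  then have "E (cls ?y) = cls (\<lambda>_. a \<otimes>\<^bsub>LG\<^esub> T \<otimes>\<^bsub>LG\<^esub> b)" by (rule E_cls[OF y(2)])
  then show ?thesis
    using y E_cls[OF assms(1) T] cls_mult[OF ab(1,3)] cls_mult[OF linf_mult[OF ab(1,3)] ab(2)] by simp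
qed

lemma E_trc:
  assumes "x \<in> carrier R"
  shows "trc M (E (cls x)) = trc M (cls x)"
proof -
  obtain T where T: "limit_of x T" by (rule limit_of_exists[OF assms])
  then have TI: "T \<in> L I" using LH_LI by (auto simp: limit_of_def)
  have "((\<lambda>n. coef (x n) \<one>) \<longlongrightarrow> coef T \<one>) \<omega>"
    using T subgroup.one_closed[OF H] by (simp add: limit_of_def)
  then show ?thesis
    using cls_trc[OF assms] cls_trc[OF linf_const[OF TI] tendsto_const] E_cls[OF assms T] by simp
qed

text \<open>By the bimodule property and the invariance of the trace, \<open>b* E(x* x) b\<close>
  has the trace of \<open>(x b)* (x b)\<close>, a limit of squared norms.\<close>

lemma E_positive:
  assumes "x \<in> carrier R"
  shows "positive_in M B (E (star M (cls x) \<otimes>\<^bsub>M\<^esub> cls x))"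
proof -
  define y where "y n = star LG (x n) \<otimes>\<^bsub>LG\<^esub> x n" for n
  have yR: "y \<in> carrier R" unfolding y_def by (rule linf_mult[OF linf_star[OF assms] assms])
  have y: "star M (cls x) \<otimes>\<^bsub>M\<^esub> cls x = cls y"
    using cls_star[OF assms] cls_mult[OF linf_star[OF assms] assms] by (simp add: y_def[abs_def])
  obtain T where T: "limit_of y T" by (rule limit_of_exists[OF yR])
  have "E (cls y) \<in> B" using E_cls[OF yR T] T by (auto simp: B_iff limit_of_def)
  moreover have "trc M (star M \<eta> \<otimes>\<^bsub>M\<^esub> E (cls y) \<otimes>\<^bsub>M\<^esub> \<eta>) \<in> \<real>\<^sub>\<ge>\<^sub>0" if \<eta>: "\<eta> \<in> B" for \<eta>
  proof -
    obtain b where b: "b \<in> L H" "\<eta> = cls (\<lambda>_. b)" using \<eta> B_iff by auto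
    have bR: "(\<lambda>_. b) \<in> carrier R" by (rule linf_const[OF LH_LI[OF b(1)]])
    have sb: "star LG b \<in> L H" "(\<lambda>_. star LG b) \<in> carrier R"
      using vN_star[OF H b(1)] linf_star[OF bR] by auto
    define z where "z n = x n \<otimes>\<^bsub>LG\<^esub> b" for n
    have zR: "z \<in> carrier R" unfolding z_def by (rule linf_mult[OF assms bR])
    define w where "w n = star LG b \<otimes>\<^bsub>LG\<^esub> y n \<otimes>\<^bsub>LG\<^esub> b" for n
    have wR: "w \<in> carrier R" unfolding w_def by (rule linf_mult[OF linf_mult[OF sb(2) yR] bR])
    have w: "cls (\<lambda>_. star LG b) \<otimes>\<^bsub>M\<^esub> cls y \<otimes>\<^bsub>M\<^esub> cls (\<lambda>_. b) = cls w"
      using cls_mult[OF sb(2) yR] cls_mult[OF linf_mult[OF sb(2) yR] bR] by (simp add: w_def[abs_def])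
    interpret LG: ring LG by (rule ring_LG)
    have m: "x n \<in> carrier LG" "star LG (x n) \<in> carrier LG" "b \<in> carrier LG" "star LG b \<in> carrier LG" for n
      using linf_mem[OF assms] linf_mem[OF linf_star[OF assms]] LH_LI[OF b(1)] LH_LI[OF sb(1)]
      by (auto simp: group_vN_simps(1))
    have "w n = star LG (z n) \<otimes>\<^bsub>LG\<^esub> z n" for n
      using m star_mult[of "x n" b] by (simp add: w_def y_def z_def group_vN_simps(1)[symmetric] LG.m_assoc)
    then have pos: "coef (w n) \<one> = of_real ((ell2_norm I (coef (z n)))\<^sup>2)" for n
      using trc_star_mult[OF linf_mem[OF zR], of n] by (simp add: trc_LG)
    have "trc M (star M \<eta> \<otimes>\<^bsub>M\<^esub> E (cls y) \<otimes>\<^bsub>M\<^esub> \<eta>) = trc M (E (cls w))"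
      unfolding b(2) cls_star[OF bR] w[symmetric] E_bimodule[OF yR sb(1) b(1)] ..
    also have "\<dots> = trc M (cls w)" by (rule E_trc[OF wR])
    finally have e: "trc M (star M \<eta> \<otimes>\<^bsub>M\<^esub> E (cls y) \<otimes>\<^bsub>M\<^esub> \<eta>) = trc M (cls w)" .
    obtain t where t: "((\<lambda>n. coef (w n) \<one>) \<longlongrightarrow> t) \<omega>" using coef_convergent[OF wR] by blast
    \<comment> \<open>Each coefficient of \<open>w n\<close> at \<open>\<one>\<close> is a squared
      norm, and nonnegativity survives the limit.\<close>
    have "closed (\<real>\<^sub>\<ge>\<^sub>0 :: complex set)" by (rule closed_nonneg_Reals_complex)
    then have "t \<in> \<real>\<^sub>\<ge>\<^sub>0"
      by (rule Lim_in_closed_set[OF _ _ omega_neq_bot t]) (simp add: pos)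
    then show ?thesis using e cls_trc[OF wR t] by simp
  qed
  ultimately show ?thesis unfolding y positive_in_def by blast
qed

lemma E_cond_exp: "trace_preserving_cond_exp M B E"
  unfolding trace_preserving_cond_exp_def
proof (intro conjI ballI allI)
  show "E \<in> carrier M \<rightarrow> B"
  proof
    fix \<xi> assume "\<xi> \<in> carrier M"
    then obtain x where x: "x \<in> carrier R" "\<xi> = cls x" by (auto simp: M_carrier)
    obtain T where T: "limit_of x T" by (rule limit_of_exists[OF x(1)])
    then show "E \<xi> \<in> B" using E_cls[OF x(1) T] x(2) by (auto simp: B_iff limit_of_def)
  qed
next
  fix \<xi> \<eta> assume "\<xi> \<in> carrier M" "\<eta> \<in> carrier M"
  then obtain x y where x: "x \<in> carrier R" "\<xi> = cls x" and y: "y \<in> carrier R" "\<eta> = cls y" by (auto simp: M_carrier)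
  obtain T where T: "limit_of x T" by (rule limit_of_exists[OF x(1)])
  obtain S where S: "limit_of y S" by (rule limit_of_exists[OF y(1)])
  have "limit_of (\<lambda>n. x n \<oplus>\<^bsub>LG\<^esub> y n) (T \<oplus>\<^bsub>LG\<^esub> S)"
    using T S HI by (auto simp: limit_of_def vN_add vN_apply intro: tendsto_add)
  then have "E (cls (\<lambda>n. x n \<oplus>\<^bsub>LG\<^esub> y n)) = cls (\<lambda>_. T \<oplus>\<^bsub>LG\<^esub> S)" by (rule E_cls[OF linf_add[OF x(1) y(1)]])
  moreover have "T \<in> L I" "S \<in> L I" using T S LH_LI by (auto simp: limit_of_def)
  ultimately show "E (\<xi> \<oplus>\<^bsub>M\<^esub> \<eta>) = E \<xi> \<oplus>\<^bsub>M\<^esub> E \<eta>"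
    using E_cls[OF x(1) T] E_cls[OF y(1) S] x y by (simp add: cls_add linf_const)
next
  fix c \<xi> assume "\<xi> \<in> carrier M"
  then obtain x where x: "x \<in> carrier R" "\<xi> = cls x" by (auto simp: M_carrier)
  obtain T where T: "limit_of x T" by (rule limit_of_exists[OF x(1)])
  have "limit_of (\<lambda>n. c \<odot>\<^bsub>LG\<^esub> x n) (c \<odot>\<^bsub>LG\<^esub> T)"
    using T HI by (auto simp: limit_of_def vN_smult vN_apply intro: tendsto_mult_left)
  then have "E (cls (\<lambda>n. c \<odot>\<^bsub>LG\<^esub> x n)) = cls (\<lambda>_. c \<odot>\<^bsub>LG\<^esub> T)" by (rule E_cls[OF linf_smult[OF x(1)]])
  moreover have "T \<in> L I" using T LH_LI by (auto simp: limit_of_def)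
  ultimately show "E (c \<odot>\<^bsub>M\<^esub> \<xi>) = c \<odot>\<^bsub>M\<^esub> E \<xi>"
    using E_cls[OF x(1) T] x by (simp add: cls_smult linf_const)
next
  fix \<xi> assume "\<xi> \<in> carrier M"
  then obtain x where x: "x \<in> carrier R" "\<xi> = cls x" by (auto simp: M_carrier)
  show "positive_in M B (E (star M \<xi> \<otimes>\<^bsub>M\<^esub> \<xi>))" unfolding x by (rule E_positive[OF x(1)])
  show "trc M (E \<xi>) = trc M \<xi>" unfolding x by (rule E_trc[OF x(1)])
next
  fix \<eta> assume "\<eta> \<in> B"
  then obtain b where b: "b \<in> L H" "\<eta> = cls (\<lambda>_. b)" using B_iff by auto
  show "E \<eta> = \<eta>" unfolding b(2) by (rule E_cls[OF linf_const[OF LH_LI[OF b(1)]]]) (simp add: limit_of_def b)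
next
  fix \<alpha> \<beta> \<xi> assume "\<alpha> \<in> B" "\<beta> \<in> B" "\<xi> \<in> carrier M"
  then obtain a b x where "a \<in> L H" "\<alpha> = cls (\<lambda>_. a)" "b \<in> L H" "\<beta> = cls (\<lambda>_. b)" "x \<in> carrier R" "\<xi> = cls x"
    by (auto simp: M_carrier B_iff)
  then show "E (\<alpha> \<otimes>\<^bsub>M\<^esub> \<xi> \<otimes>\<^bsub>M\<^esub> \<beta>) = \<alpha> \<otimes>\<^bsub>M\<^esub> E \<xi> \<otimes>\<^bsub>M\<^esub> \<beta>" by (simp add: E_bimodule)
qed

end

section \<open>Freeness\<close>

context group_ultrapower
begin

section \<open>Traces of alternating products\<close>

abbreviation seq_prod :: "(nat \<Rightarrow> 'a op) list \<Rightarrow> nat \<Rightarrow> 'a op" where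
  "seq_prod Xs n \<equiv> foldr (\<otimes>\<^bsub>LG\<^esub>) (map (\<lambda>X. X n) Xs) \<one>\<^bsub>LG\<^esub>"

lemma seq_prod_linf: "set Xs \<subseteq> carrier R \<Longrightarrow> seq_prod Xs \<in> carrier R"
  by (induction Xs) (auto simp: linf_const vN_one linf_mult)

lemma foldr_cls: "set Xs \<subseteq> carrier R \<Longrightarrow> foldr (\<otimes>\<^bsub>M\<^esub>) (map cls Xs) \<one>\<^bsub>M\<^esub> = cls (seq_prod Xs)"
proof (induction Xs)
  case Nil
  then show ?case by (simp add: cls_one)
next
  case (Cons X Xs)
  then show ?case using cls_mult[of X "seq_prod Xs"] seq_prod_linf[of Xs] by simp
qed

lemma seq_prod_append:
  assumes "set Xs \<subseteq> carrier R" "set Ys \<subseteq> carrier R"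
  shows "seq_prod (Xs @ Ys) n = seq_prod Xs n \<otimes>\<^bsub>LG\<^esub> seq_prod Ys n"
proof -
  interpret LG: ring LG by (rule ring_LG)
  have m: "Y n \<in> carrier LG" if "Y \<in> carrier R" for Y using that by (simp add: linf_carrier group_vN_simps(1))
  show ?thesis
    using assms(1)
  proof (induction Xs)
    case Nil
    show ?case using m[OF seq_prod_linf[OF assms(2)]] by simp
  next
    case (Cons X Xs)
    then show ?case
      using m[of X] m[OF seq_prod_linf[of Xs]] m[OF seq_prod_linf[OF assms(2)]] by (simp add: LG.m_assoc)
  qed
qed

abbreviation alt_trace :: "(nat \<times> (nat \<Rightarrow> 'a op)) list \<Rightarrow> complex" where
  "alt_trace ws \<equiv> trc M (foldr (\<otimes>\<^bsub>M\<^esub>) (map cls (map snd ws)) \<one>\<^bsub>M\<^esub>)"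

text \<open>The letters of an alternating word with chosen representatives, with vanishing
  expectation already translated into coefficients by \<open>E_zeroD\<close>.\<close>

definition letter1 :: "nat \<times> (nat \<Rightarrow> 'a op) \<Rightarrow> bool" where
  "letter1 w \<longleftrightarrow> fst w = 1 \<and> (\<exists>x\<in>L I. snd w = (\<lambda>_. x) \<and> (\<forall>h\<in>H. coef x h = 0))"

definition letter2 :: "nat \<times> (nat \<Rightarrow> 'a op) \<Rightarrow> bool" where
  "letter2 w \<longleftrightarrow> fst w = 2 \<and> snd w \<in> carrier R \<and> (\<forall>n. snd w n \<in> L H) \<and>
     (\<forall>h\<in>H. ((\<lambda>n. coef (snd w n) h) \<longlongrightarrow> 0) \<omega>)"

text \<open>The sequence is constant, so index \<open>0\<close> stands for all of its
  values.\<close>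

definition letter1_fin :: "nat \<times> (nat \<Rightarrow> 'a op) \<Rightarrow> bool" where
  "letter1_fin w \<longleftrightarrow> letter1 w \<and> finite {g \<in> I. coef (snd w 0) g \<noteq> 0}"

lemma letter_linf: "letter1 w \<or> letter2 w \<Longrightarrow> snd w \<in> carrier R"
  by (auto simp: letter1_def letter2_def linf_const)

lemma letter1_fin_letter1: "letter1_fin w \<Longrightarrow> letter1 w"
  by (simp add: letter1_fin_def)

lemma alt_trace_eq:
  assumes "\<forall>w\<in>set ws. snd w \<in> carrier R" "((\<lambda>n. coef (seq_prod (map snd ws) n) \<one>) \<longlongrightarrow> t) \<omega>"
  shows "alt_trace ws = t"
proof -
  have s: "set (map snd ws) \<subseteq> carrier R" using assms(1) by auto
  show ?thesis unfolding foldr_cls[OF s] by (rule cls_trc[OF seq_prod_linf[OF s] assms(2)])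
qed

lemma alt_trace_tendsto:
  assumes "\<forall>w\<in>set ws. snd w \<in> carrier R"
  shows "((\<lambda>n. coef (seq_prod (map snd ws) n) \<one>) \<longlongrightarrow> alt_trace ws) \<omega>"
proof -
  have s: "set (map snd ws) \<subseteq> carrier R" using assms(1) by auto
  obtain t where t: "((\<lambda>n. coef (seq_prod (map snd ws) n) \<one>) \<longlongrightarrow> t) \<omega>"
    using coef_convergent[OF seq_prod_linf[OF s]] by blast
  then show ?thesis using alt_trace_eq[OF assms t] by (simp del: map_map)
qed

text \<open>The part \<open>S n\<close> of \<open>X n\<close> supported on \<open>K\<close> is
  subtracted. Its operator norm, hence also its 2-norm, is at most a finite sum of absolute
  coefficients; this sum is bounded and tends to 0, so the sequence stays bounded and the class does
  not change.\<close>

lemma letter2_remove: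
  assumes "letter2 w" and K: "finite K" "K \<subseteq> H"
  shows "\<exists>Y\<in>carrier R. cls Y = cls (snd w) \<and> (\<forall>n. Y n \<in> L H \<and> (\<forall>k\<in>K. coef (Y n) k = 0))"
proof -
  define X where "X = snd w"
  have X: "X \<in> carrier R" "\<And>n. X n \<in> L H" "\<And>h. h \<in> H \<Longrightarrow> ((\<lambda>n. coef (X n) h) \<longlongrightarrow> 0) \<omega>"
    using assms(1) by (auto simp: letter2_def X_def)
  have "\<forall>n. \<exists>S. S \<in> L H \<and> coef S = truncated K (coef (X n)) \<and> opnorm LG S \<le> (\<Sum>k\<in>K. cmod (coef (X n) k))"
    using finite_support_exists[OF H K] by blast
  then obtain S where S: "\<And>n. S n \<in> L H" "\<And>n. coef (S n) = truncated K (coef (X n))"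
    "\<And>n. opnorm LG (S n) \<le> (\<Sum>k\<in>K. cmod (coef (X n) k))" by metis
  have SI: "S n \<in> L I" "X n \<in> L I" for n using S(1) X(2) LH_LI by auto
  obtain C where C: "C \<ge> 0" "\<And>n. opnorm LG (X n) \<le> C" using linf_bound[OF X(1)] by blast
  have "cmod (coef (X n) k) \<le> C" for n k
    using cmod_coef_le_opnorm[OF SI(2), of n k] C(2)[of n] by (simp add: opnorm_LG)
  then have "(\<Sum>k\<in>K. cmod (coef (X n) k)) \<le> of_nat (card K) * C" for n by (intro sum_bounded_above)
  then have SR: "S \<in> carrier R" using SI S(3) unfolding linf_carrier by (meson order_trans)
  have normS: "norm2 LG (S n) \<le> (\<Sum>k\<in>K. cmod (coef (X n) k))" for n
  proof -
    have "norm2 LG (S n) \<le> opnorm LG (S n)"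
      using op_norm_bound[OF vN_bounded[OF SI(1)] delta_one_ell2, of n]
      by (simp add: norm2_LG[OF SI(1)] ell2_norm_delta opnorm_LG)
    then show ?thesis using S(3)[of n] by simp
  qed
  define Y where "Y n = X n \<oplus>\<^bsub>LG\<^esub> (-1) \<odot>\<^bsub>LG\<^esub> S n" for n
  have YR: "Y \<in> carrier R" unfolding Y_def by (rule linf_add[OF X(1) linf_smult[OF SR]])
  have lim: "((\<lambda>n. \<Sum>k\<in>K. cmod (coef (X n) k)) \<longlongrightarrow> 0) \<omega>"
    using K X(3) by (intro tendsto_null_sum tendsto_norm_zero) auto
  have "near X Y"
    unfolding near_def
  proof (rule tendsto_null_le[OF lim])
    fix n
    have e: "X n \<oplus>\<^bsub>LG\<^esub> (-1) \<odot>\<^bsub>LG\<^esub> Y n = S n"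
      unfolding Y_def by (rule LG_eqI) (use SI in \<open>auto simp: vN_add vN_smult vN_apply\<close>)
    show "0 \<le> norm2 LG (X n \<oplus>\<^bsub>LG\<^esub> (-1) \<odot>\<^bsub>LG\<^esub> Y n)" unfolding e by (rule norm2_nonneg[OF SI(1)])
    show "norm2 LG (X n \<oplus>\<^bsub>LG\<^esub> (-1) \<odot>\<^bsub>LG\<^esub> Y n) \<le> (\<Sum>k\<in>K. cmod (coef (X n) k))" unfolding e by (rule normS)
  qed
  then have "cls Y = cls X" using cls_eqI[OF X(1) YR] by simp
  moreover have "Y n \<in> L H" for n unfolding Y_def using S(1) X(2) HI by (intro vN_add vN_smult)
  moreover have "coef (Y n) k = 0" if "k \<in> K" for n k
    unfolding Y_def using that by (simp add: vN_apply S(2))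
  ultimately show ?thesis using YR X_def by blast
qed

text \<open>Coefficients are truncated to a finite set. Closeness holds in the 2-norm only; nothing
  is said about the operator norm of \<open>v\<close>.\<close>

lemma letter1_approx:
  assumes "letter1 w" "e > 0"
  shows "\<exists>v. letter1_fin v \<and> norm2 LG (snd w n \<oplus>\<^bsub>LG\<^esub> (-1) \<odot>\<^bsub>LG\<^esub> snd v n) < e"
proof -
  obtain x where x: "x \<in> L I" "snd w = (\<lambda>_. x)" "\<forall>h\<in>H. coef x h = 0"
    using assms(1) by (auto simp: letter1_def)
  obtain A where A: "finite A" "A \<subseteq> I" "ell2_norm I (\<lambda>i. coef x i - truncated A (coef x) i) < e"
    using ell2_approx[OF coef_ell2[OF x(1)] assms(2)] by blast
  obtain y where y: "y \<in> L I" "coef y = truncated A (coef x)"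
    using finite_support_exists[OF subgroup_self A(1,2)] by blast
  have "finite {g \<in> I. coef y g \<noteq> 0}"
    by (rule finite_subset[OF _ A(1)]) (auto simp: y(2) split: if_splits)
  then have "letter1_fin (1, \<lambda>_. y)"
    using x(3) y(1) by (simp add: letter1_fin_def letter1_def) (auto simp: y(2))
  moreover have "norm2 LG (x \<oplus>\<^bsub>LG\<^esub> (-1) \<odot>\<^bsub>LG\<^esub> y) < e"
    using A(3) x(1) y(1) by (simp add: norm2_LG vN_add vN_smult vN_apply y(2))
  ultimately show ?thesis using x(2) by (intro exI[of _ "(1, \<lambda>_. y)"]) simp
qed

text \<open>Once the letters from L(H) have representatives vanishing on a suitable
  \<open>K\<close>, the product has coefficient exactly 0 at \<open>\<one>\<close> for every index
  \<open>n\<close>, not merely in the limit.\<close>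

lemma alt_trace_finite_support:
  assumes he: "hyperbolically_embedded G H" and "ws \<noteq> []" "distinct_adj (map fst ws)"
    and letters: "\<forall>w\<in>set ws. letter1_fin w \<or> letter2 w"
  shows "alt_trace ws = 0"
proof -
  \<comment> \<open>All supports of letters of the first kind together: a finite set outside
    \<open>H\<close>. With it and the length of the word fixed, a single \<open>K\<close> can be
    chosen before any representative is changed.\<close>
  define F where "F = (\<Union>w\<in>{w \<in> set ws. letter1_fin w}. {g \<in> I. coef (snd w 0) g \<noteq> 0})"
  have F: "finite F" "F \<subseteq> I - H"
    unfolding F_def by (auto simp: letter1_fin_def letter1_def)
  obtain K where K: "finite K" "K \<subseteq> H" and
    free: "\<forall>us. us \<noteq> [] \<longrightarrow> length us \<le> length ws \<longrightarrow> distinct_adj (map fst us) \<longrightarrow>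
      (\<forall>(i, x)\<in>set us. i = (1::nat) \<and> x \<in> F \<or> i = 2 \<and> x \<in> H - K) \<longrightarrow> foldr (\<otimes>) (map snd us) \<one> \<noteq> \<one>"
    using alternating_prod_neq_one[OF he F, of "length ws"] by (elim exE conjE)
  have "\<forall>w\<in>set ws. \<exists>Y. Y \<in> carrier R \<and> cls Y = cls (snd w) \<and>
    (\<forall>n. \<forall>g\<in>I. coef (Y n) g \<noteq> 0 \<longrightarrow> fst w = 1 \<and> g \<in> F \<or> fst w = 2 \<and> g \<in> H - K)"
  proof
    fix w assume w: "w \<in> set ws"
    show "\<exists>Y. Y \<in> carrier R \<and> cls Y = cls (snd w) \<and>
      (\<forall>n. \<forall>g\<in>I. coef (Y n) g \<noteq> 0 \<longrightarrow> fst w = 1 \<and> g \<in> F \<or> fst w = 2 \<and> g \<in> H - K)"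
    proof (cases "letter1_fin w")
      case True
      then obtain x where "snd w = (\<lambda>_. x)" by (auto simp: letter1_fin_def letter1_def)
      then have e: "snd w n = snd w 0" for n by simp
      have "coef (snd w n) g \<noteq> 0 \<longrightarrow> g \<in> F" if "g \<in> I" for n g
        using w True that unfolding F_def e[of n] by blast
      then show ?thesis
        using True letter_linf[OF disjI1[OF letter1_fin_letter1[OF True]]]
        by (intro exI[of _ "snd w"]) (auto simp: letter1_fin_def letter1_def)
    next
      case False
      then have l2: "letter2 w" using letters w by auto
      obtain Y where Y: "Y \<in> carrier R" "cls Y = cls (snd w)" "\<And>n. Y n \<in> L H" "\<And>n k. k \<in> K \<Longrightarrow> coef (Y n) k = 0"
        using letter2_remove[OF l2 K] by blast
      then have "coef (Y n) g \<noteq> 0 \<longrightarrow> g \<in> H - K" for n g using vN_support[OF H] by blast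
      then show ?thesis using Y(1,2) l2 by (intro exI[of _ Y]) (auto simp: letter2_def)
    qed
  qed
  then obtain r where r: "\<And>w. w \<in> set ws \<Longrightarrow> r w \<in> carrier R" "\<And>w. w \<in> set ws \<Longrightarrow> cls (r w) = cls (snd w)"
    "\<And>w n g. w \<in> set ws \<Longrightarrow> g \<in> I \<Longrightarrow> coef (r w n) g \<noteq> 0 \<Longrightarrow> fst w = 1 \<and> g \<in> F \<or> fst w = 2 \<and> g \<in> H - K"
    unfolding bchoice_iff by blast
  define ws' where "ws' = map (\<lambda>w. (fst w, r w)) ws"
  have ws'R: "\<forall>w\<in>set ws'. snd w \<in> carrier R" using r(1) by (auto simp: ws'_def)
  have "map cls (map snd ws) = map cls (map snd ws')" using r(2) by (auto simp: ws'_def)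
  then have "alt_trace ws = alt_trace ws'" by (simp only:)
  also have "alt_trace ws' = 0"
  proof (rule alt_trace_eq[OF ws'R])
    \<comment> \<open>A nonzero coefficient would select from each support one group element such
      that their product is \<open>\<one>\<close>; with the tags of \<open>ws\<close> these elements
      form an alternating word excluded by \<open>free\<close>.\<close>
    have "coef (seq_prod (map snd ws') n) \<one> = 0" for n
    proof (rule ccontr)
      let ?Ts = "map (\<lambda>X. X n) (map snd ws')"
      assume "coef (seq_prod (map snd ws') n) \<one> \<noteq> 0"
      moreover have "set ?Ts \<subseteq> L I" using ws'R linf_mem by auto
      ultimately obtain ys where ys: "length ys = length ws" "set ys \<subseteq> I" "\<one> = foldr (\<otimes>) ys \<one>"
        "\<And>i. i < length ws \<Longrightarrow> coef (?Ts ! i) (ys ! i) \<noteq> 0"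
        using coef_foldr_support[of ?Ts \<one>] by (auto simp: ws'_def)
      define us where "us = zip (map fst ws) ys"
      have "foldr (\<otimes>) (map snd us) \<one> \<noteq> \<one>"
      proof (rule free[THEN spec, THEN mp, THEN mp, THEN mp, THEN mp])
        show "us \<noteq> []" using assms(2) ys(1) by (cases ws; cases ys) (auto simp: us_def)
        show "length us \<le> length ws" by (simp add: us_def)
        show "distinct_adj (map fst us)" using assms(3) ys(1) by (simp add: us_def)
        show "\<forall>(i, x)\<in>set us. i = (1::nat) \<and> x \<in> F \<or> i = 2 \<and> x \<in> H - K"
        proof clarify
          fix i x assume ix: "(i, x) \<in> set us" and n2: "\<not> (i = 2 \<and> x \<in> H - K)"
          then obtain j where j: "j < length ws" "i = fst (ws ! j)" "x = ys ! j"
            using ys(1) by (auto simp: us_def in_set_zip)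
          have "coef (r (ws ! j) n) x \<noteq> 0" "x \<in> I" using ys(2) ys(4)[OF j(1)] j ys(1) by (auto simp: ws'_def)
          then show "i = 1 \<and> x \<in> F" using r(3)[of "ws ! j" x n] j n2 by auto
        qed
      qed
      then show False using ys(1,3) by (simp add: us_def)
    qed
    then show "((\<lambda>n. coef (seq_prod (map snd ws') n) \<one>) \<longlongrightarrow> 0) \<omega>" by simp
  qed
  finally show ?thesis .
qed

text \<open>Changing one letter by \<open>z\<close> changes the trace by at most the operator norms
  of the products on either side times the 2-norm of \<open>z\<close>. As \<open>us\<close> and
  \<open>vs\<close> are fixed, these norms are known before \<open>v\<close> is chosen.\<close>

lemma alt_trace_replace:
  assumes "\<forall>w\<in>set us \<union> set vs. snd w \<in> carrier R" "letter1 w"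
    and small: "\<And>v. letter1_fin v \<Longrightarrow> alt_trace (us @ v # vs) = 0"
  shows "alt_trace (us @ w # vs) = 0"
proof -
  have uv: "set (map snd us) \<subseteq> carrier R" "set (map snd vs) \<subseteq> carrier R" using assms(1) by auto
  define a where "a = seq_prod (map snd us)"
  define b where "b = seq_prod (map snd vs)"
  have ab: "a \<in> carrier R" "b \<in> carrier R" unfolding a_def b_def using seq_prod_linf[OF uv(1)] seq_prod_linf[OF uv(2)] by auto
  obtain C where C: "C \<ge> 0" "\<And>n. opnorm LG (a n) \<le> C" using linf_bound[OF ab(1)] by blast
  obtain D where D: "D \<ge> 0" "\<And>n. opnorm LG (b n) \<le> D" using linf_bound[OF ab(2)] by blast
  have "cmod (alt_trace (us @ w # vs)) \<le> e" if e: "e > 0" for e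
  proof -
    \<comment> \<open>The summand 1 keeps the denominator positive when \<open>C * D\<close> is
      0.\<close>
    have "e / (C * D + 1) > 0" using e C D by (simp add: add_nonneg_pos)
    obtain v where v: "letter1_fin v"
      and d: "norm2 LG (snd w 0 \<oplus>\<^bsub>LG\<^esub> (-1) \<odot>\<^bsub>LG\<^esub> snd v 0) < e / (C * D + 1)"
      using letter1_approx[OF assms(2) \<open>e / (C * D + 1) > 0\<close>] by blast
    obtain x where x: "x \<in> L I" "snd w = (\<lambda>_. x)" using assms(2) by (auto simp: letter1_def)
    obtain y where y: "y \<in> L I" "snd v = (\<lambda>_. y)" using v by (auto simp: letter1_fin_def letter1_def)
    define z where "z = x \<oplus>\<^bsub>LG\<^esub> (-1) \<odot>\<^bsub>LG\<^esub> y"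
    have z: "z \<in> L I" using x y by (simp add: z_def vN_add vN_smult)
    have dz: "norm2 LG z < e / (C * D + 1)" using d x y by (simp add: z_def)
    have all: "\<forall>u\<in>set (us @ w # vs). snd u \<in> carrier R" "\<forall>u\<in>set (us @ v # vs). snd u \<in> carrier R"
      using assms(1) x y by (auto simp: linf_const)
    have prods: "seq_prod (map snd (us @ u # vs)) n = a n \<otimes>\<^bsub>LG\<^esub> (snd u n \<otimes>\<^bsub>LG\<^esub> b n)"
      if "snd u \<in> carrier R" for u n
      using seq_prod_append[of "map snd us" "snd u # map snd vs" n] uv that by (simp add: a_def b_def)
    have bound: "cmod (coef (seq_prod (map snd (us @ w # vs)) n) \<one>)
      \<le> cmod (coef (seq_prod (map snd (us @ v # vs)) n) \<one>) + e" for n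
    proof -
      have mem: "a n \<in> L I" "b n \<in> L I" using ab linf_mem by auto
      let ?zb = "z \<otimes>\<^bsub>LG\<^esub> b n"
      have bl: "coef (b n) \<in> ell2 I" by (rule coef_ell2[OF mem(2)])
      have Tl: "T f \<in> ell2 I" if "T \<in> L I" "f \<in> ell2 I" for T f by (rule bounded_opsD(1)[OF vN_bounded[OF that(1)] that(2)])
      have "coef (a n \<otimes>\<^bsub>LG\<^esub> ?zb) = (\<lambda>i. coef (a n \<otimes>\<^bsub>LG\<^esub> (x \<otimes>\<^bsub>LG\<^esub> b n)) i
          - coef (a n \<otimes>\<^bsub>LG\<^esub> (y \<otimes>\<^bsub>LG\<^esub> b n)) i)"
      proof -
        have "z (coef (b n)) = (\<lambda>i. x (coef (b n)) i + (-1) * y (coef (b n)) i)"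
          unfolding z_def by (simp add: vN_apply bl)
        then have "a n (z (coef (b n))) = (\<lambda>i. a n (x (coef (b n))) i + (-1) * a n (y (coef (b n))) i)"
          using bounded_opsD(2)[OF vN_bounded[OF mem(1)] Tl[OF x(1) bl] ell2_scale[OF Tl[OF y(1) bl], of "-1"]]
            bounded_opsD(3)[OF vN_bounded[OF mem(1)] Tl[OF y(1) bl], of "-1"] by simp
        then show ?thesis by (simp add: vN_apply)
      qed
      then have "coef (a n \<otimes>\<^bsub>LG\<^esub> (x \<otimes>\<^bsub>LG\<^esub> b n)) \<one>
          = coef (a n \<otimes>\<^bsub>LG\<^esub> (y \<otimes>\<^bsub>LG\<^esub> b n)) \<one> + coef (a n \<otimes>\<^bsub>LG\<^esub> ?zb) \<one>" by simp
      then have "cmod (coef (a n \<otimes>\<^bsub>LG\<^esub> (x \<otimes>\<^bsub>LG\<^esub> b n)) \<one>)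
          \<le> cmod (coef (a n \<otimes>\<^bsub>LG\<^esub> (y \<otimes>\<^bsub>LG\<^esub> b n)) \<one>) + cmod (coef (a n \<otimes>\<^bsub>LG\<^esub> ?zb) \<one>)"
        by (metis norm_triangle_ineq)
      moreover have "cmod (coef (a n \<otimes>\<^bsub>LG\<^esub> ?zb) \<one>) \<le> e"
      proof -
        have zb: "?zb \<in> L I" using z mem by (simp add: vN_mult)
        have nz: "norm2 LG z \<ge> 0" by (rule norm2_nonneg[OF z])
        have "cmod (coef (a n \<otimes>\<^bsub>LG\<^esub> ?zb) \<one>) \<le> norm2 LG (a n \<otimes>\<^bsub>LG\<^esub> ?zb)"
          by (rule cmod_coef_le_norm2[OF vN_mult[OF order_refl mem(1) zb]])
        also have "\<dots> \<le> opnorm LG (a n) * norm2 LG ?zb" by (rule norm2_mult_left[OF mem(1) zb])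
        also have "\<dots> \<le> C * (opnorm LG (b n) * norm2 LG z)"
          using norm2_mult_right[OF z mem(2)] C norm2_nonneg[OF zb] by (intro mult_mono) auto
        also have "\<dots> \<le> C * (D * norm2 LG z)"
          using C(1) D(2)[of n] nz by (intro mult_left_mono mult_right_mono)
        also have "\<dots> \<le> (C * D + 1) * norm2 LG z" using nz by (simp add: algebra_simps)
        also have "\<dots> \<le> e" using dz C D by (simp add: add_nonneg_pos pos_less_divide_eq mult.commute less_imp_le)
        finally show ?thesis .
      qed
      ultimately show ?thesis using prods[of w n] prods[of v n] x y by (simp add: linf_const)
    qed
    have "((\<lambda>n. cmod (coef (seq_prod (map snd (us @ v # vs)) n) \<one>) + e) \<longlongrightarrow> cmod (alt_trace (us @ v # vs)) + e) \<omega>"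
      by (intro tendsto_add tendsto_norm alt_trace_tendsto all(2) tendsto_const)
    moreover have "((\<lambda>n. cmod (coef (seq_prod (map snd (us @ w # vs)) n) \<one>)) \<longlongrightarrow> cmod (alt_trace (us @ w # vs))) \<omega>"
      by (intro tendsto_norm alt_trace_tendsto all(1))
    ultimately have "cmod (alt_trace (us @ w # vs)) \<le> cmod (alt_trace (us @ v # vs)) + e"
      by (rule tendsto_le[OF omega_neq_bot _ _ always_eventually]) (use bound in blast)
    then show ?thesis unfolding small[OF v] by (simp del: map_map map_append)
  qed
  then have "cmod (alt_trace (us @ w # vs)) \<le> 0 + e" if "e > 0" for e using that by (simp only: add_0)
  then have "cmod (alt_trace (us @ w # vs)) \<le> 0" by (rule field_le_epsilon)
  then show ?thesis by (simp only: norm_le_zero_iff)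
qed

text \<open>Letters move from \<open>vs\<close> to \<open>us\<close> one by one, those of the first
  kind being exchanged for finitely supported ones; when \<open>vs\<close> is exhausted,
  \<open>alt_trace_finite_support\<close> applies.\<close>

lemma alt_trace_zero:
  assumes he: "hyperbolically_embedded G H" and "us @ vs \<noteq> []" "distinct_adj (map fst (us @ vs))"
    and "\<forall>w\<in>set us. letter1_fin w \<or> letter2 w" "\<forall>w\<in>set vs. letter1 w \<or> letter2 w"
  shows "alt_trace (us @ vs) = 0"
  using assms(2-)
proof (induction vs arbitrary: us)
  case Nil
  then show ?case using alt_trace_finite_support[OF he, of us] by simp
next
  case (Cons w vs)
  \<comment> \<open>The replacement must keep the tag, so that the word remains alternating.\<close>
  have step: "alt_trace (us @ v # vs) = 0" if "letter1_fin v \<or> letter2 v" "fst v = fst w" for v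
    using Cons.IH[of "us @ [v]"] Cons.prems that by (simp del: map_map)
  show ?case
  proof (cases "letter2 w")
    case True
    then show ?thesis using step by blast
  next
    case False
    then have w: "letter1 w" using Cons.prems by auto
    show ?thesis
    proof (rule alt_trace_replace[OF _ w])
      show "\<forall>w\<in>set us \<union> set vs. snd w \<in> carrier R"
      proof
        fix u assume "u \<in> set us \<union> set vs"
        then have "letter1 u \<or> letter2 u" using Cons.prems(3,4) letter1_fin_letter1[of u] by auto
        then show "snd u \<in> carrier R" by (rule letter_linf)
      qed
      fix v assume "letter1_fin v"
      then show "alt_trace (us @ v # vs) = 0" using w by (intro step) (auto simp: letter1_fin_def letter1_def)
    qed
  qed
qed

lemma free_const_ultra_sub:
  assumes "hyperbolically_embedded G H"
  shows "free_with_amalgamation M (ultra_const \<omega> LG (carrier LG)) (ultra_sub \<omega> LG (L H)) B"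
  unfolding free_with_amalgamation_def
proof (intro exI[of _ E] conjI allI impI)
  show "trace_preserving_cond_exp M B E" by (rule E_cond_exp)
  fix ws :: "(nat \<times> (nat \<Rightarrow> 'a op) set) list"
  assume ne: "ws \<noteq> []" and alt: "distinct_adj (map fst ws)"
    and mem: "\<forall>(i, \<xi>)\<in>set ws. (i = 1 \<and> \<xi> \<in> ultra_const \<omega> LG (carrier LG) \<or> i = 2 \<and> \<xi> \<in> ultra_sub \<omega> LG (L H)) \<and> E \<xi> = \<zero>\<^bsub>M\<^esub>"
  \<comment> \<open>Each factor gets a representative of the form appropriate to its tag: a constant
    sequence, or a sequence inside L(H).\<close>
  have "\<exists>X. cls X = snd w \<and> (letter1 (fst w, X) \<or> letter2 (fst w, X))" if "w \<in> set ws" for w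
  proof -
    obtain i \<xi> where w: "w = (i, \<xi>)" by (cases w)
    then have "(i = 1 \<and> \<xi> \<in> ultra_const \<omega> LG (carrier LG) \<or> i = 2 \<and> \<xi> \<in> ultra_sub \<omega> LG (L H))" and E0: "E \<xi> = \<zero>\<^bsub>M\<^esub>"
      using mem that by auto
    then show ?thesis
    proof (elim disjE conjE)
      assume i: "i = 1" and "\<xi> \<in> ultra_const \<omega> LG (carrier LG)"
      then obtain x where x: "x \<in> L I" "\<xi> = cls (\<lambda>_. x)" by (auto simp: ultra_const_def group_vN_simps(1))
      have "coef x h = 0" if "h \<in> H" for h
        using E_zeroD[OF linf_const[OF x(1)] _ that] E0 x(2) omega_neq_bot by (simp add: tendsto_const_iff)
      then show ?thesis using i x w by (intro exI[of _ "\<lambda>_. x"]) (auto simp: letter1_def)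
    next
      assume i: "i = 2" and "\<xi> \<in> ultra_sub \<omega> LG (L H)"
      then obtain X where X: "X \<in> carrier R" "\<And>n. X n \<in> L H" "\<xi> = cls X" by (auto simp: ultra_sub_def)
      then show ?thesis using i w E_zeroD[OF X(1)] E0 by (intro exI[of _ X]) (auto simp: letter2_def)
    qed
  qed
  then obtain r where r: "\<And>w. w \<in> set ws \<Longrightarrow> cls (r w) = snd w"
    "\<And>w. w \<in> set ws \<Longrightarrow> letter1 (fst w, r w) \<or> letter2 (fst w, r w)" by metis
  define vs where "vs = map (\<lambda>w. (fst w, r w)) ws"
  have "alt_trace ([] @ vs) = 0"
  proof (rule alt_trace_zero[OF assms])
    have "map fst vs = map fst ws" by (simp add: vs_def)
    then show "distinct_adj (map fst ([] @ vs))" using alt by simp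
  qed (use ne r in \<open>auto simp: vs_def\<close>)
  moreover have "map cls (map snd vs) = map snd ws" using r by (auto simp: vs_def)
  ultimately show "trc M (foldr (\<otimes>\<^bsub>M\<^esub>) (map snd ws) \<one>\<^bsub>M\<^esub>) = 0" by (simp only: append_Nil)
qed

lemma B_subset: "B \<subseteq> ultra_const \<omega> LG (carrier LG) \<inter> ultra_sub \<omega> LG (L H)"
  using LH_LI linf_const by (auto simp: ultra_const_def ultra_sub_def group_vN_simps(1))

end

theorem theorem3:
  fixes G :: "('g, 'm) monoid_scheme" and H :: "'g set" and \<omega> :: "nat filter"
  assumes "group G"
    and "hyperbolically_embedded G H"
    and "free_ultrafilter \<omega>"
  shows "let LG = group_vN G;
             M = ultrapower \<omega> LG;
             M1 = ultra_const \<omega> LG (carrier LG);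
             M2 = ultra_sub \<omega> LG (group_vN_sub G H);
             B = ultra_const \<omega> LG (group_vN_sub G H)
         in is_amalgamated_free_product M (vN_join M M1 M2) M1 M2 B"
proof -
  interpret group G by fact
  interpret group_ultrapower G H \<omega>
    using assms(2,3) by (intro group_ultrapower.intro group_ultrapower_axioms.intro is_group)
      (simp_all add: hyperbolically_embedded_def)
  \<comment> \<open>The algebra is by definition the one generated by the two factors, so the
    inclusion of \<open>B\<close> and freeness remain.\<close>
  show ?thesis
    unfolding Let_def is_amalgamated_free_product_def
    using B_subset free_const_ultra_sub[OF assms(2)] by blast
qed

end
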